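(* Let $\alpha\in\mathbb{C}$ with $\mathrm{Re}(\alpha)>0$. Then, as operators in $L^2(\mathbb{R}_+)$, $$(\mathcal{C}_+)^\alpha=H_{\alpha+}.$$
   Context: $\mathbb{R}_+=(0,\infty)$. $\mathcal{C}_+$ is the Cesàro operator in $L^2(\mathbb{R}_+)$, $(\mathcal{C}_+f)(x)=\frac1x\int_0^x f(t)\,dt=\int_0^1 f(ux)\,du$; it is a bounded normal operator with spectrum $\{z\in\mathbb{C}:|z-1|=1\}$. For $\mathrm{Re}(\alpha)>0$, $z^\alpha$ denotes the branch on $\{\mathrm{Re}(z)>0\}$ with $1^\alpha=1$, and $0^\alpha:=0$; $(\mathcal{C}_+)^\alpha$ is defined by the functional calculus for normal operators. $H_{\alpha+}$ is the restriction to $L^2(\mathbb{R}_+)$ of the Hölder operator $(H_\alpha f)(x)=\frac{1}{\Gamma(\alpha)}\int_0^1\left(\log\frac1u\right)^{\alpha-1}f(ux)\,du$ in $L^2(\mathbb{R})$, where $L^2(\mathbb{R}_+)$ is viewed as a subspace of $L^2(\mathbb{R})$ (extension by zero). *)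

theory Defs
  imports "HOL-Analysis.Analysis"
begin

section \<open>Complex inner product spaces and bounded operators\<close>

class scaleC =
  fixes scaleC :: "complex \<Rightarrow> 'a \<Rightarrow> 'a"  (infixr \<open>*\<^sub>C\<close> 75)

class complex_inner = real_inner + scaleC +
  fixes cinner :: "'a \<Rightarrow> 'a \<Rightarrow> complex"
  assumes scaleC_add_right: "c *\<^sub>C (x + y) = c *\<^sub>C x + c *\<^sub>C y"
    and scaleC_add_left: "(c + d) *\<^sub>C x = c *\<^sub>C x + d *\<^sub>C x"
    and scaleC_scaleC: "c *\<^sub>C (d *\<^sub>C x) = (c * d) *\<^sub>C x"
    and scaleC_of_real: "complex_of_real r *\<^sub>C x = r *\<^sub>R x"
    and cinner_commute: "cinner x y = cnj (cinner y x)"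
    and cinner_add_left: "cinner (x + y) z = cinner x z + cinner y z"
    and cinner_scaleC_left: "cinner (c *\<^sub>C x) y = c * cinner x y"
    and inner_eq_Re_cinner: "inner x y = Re (cinner x y)"

definition bounded_op :: "('a::complex_inner \<Rightarrow> 'a) \<Rightarrow> bool" where
  "bounded_op T \<longleftrightarrow> bounded_linear T \<and> (\<forall>c x. T (c *\<^sub>C x) = c *\<^sub>C T x)"

definition is_adjoint :: "('a::complex_inner \<Rightarrow> 'a) \<Rightarrow> ('a \<Rightarrow> 'a) \<Rightarrow> bool" where
  "is_adjoint T S \<longleftrightarrow> (\<forall>x y. cinner (T x) y = cinner x (S y))"

definition op_spectrum :: "('a::complex_inner \<Rightarrow> 'a) \<Rightarrow> complex set" where
  "op_spectrum T =
     {z. \<not> (\<exists>S. bounded_op S \<and> (\<forall>x. S (T x - z *\<^sub>C x) = x) \<and> (\<forall>x. T (S x) - z *\<^sub>C S x = x))}"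


section \<open>The continuous functional calculus\<close>

text \<open>
  \<open>is_cfc T \<Phi>\<close>: \<open>\<Phi>\<close> is a unital *-homomorphism from \<open>C(\<sigma>(T))\<close> into the bounded operators
  that maps the identity function to \<open>T\<close>. Elements of \<open>C(\<sigma>(T))\<close> are represented by functions on
  all of \<open>\<complex>\<close>, of which only the values on \<open>\<sigma>(T)\<close> matter. On a Hilbert space such a \<open>\<Phi>\<close> exists
  iff \<open>T\<close> is a bounded normal operator, and it is then uniquely determined on \<open>C(\<sigma>(T))\<close>
  (continuity of \<open>\<Phi>\<close> is automatic).
\<close>

definition is_cfc ::
    "('a::complex_inner \<Rightarrow> 'a) \<Rightarrow> ((complex \<Rightarrow> complex) \<Rightarrow> 'a \<Rightarrow> 'a) \<Rightarrow> bool" where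
  "is_cfc T \<Phi> \<longleftrightarrow>
     (let C = {f. continuous_on (op_spectrum T) f} in
       (\<forall>f\<in>C. bounded_op (\<Phi> f)) \<and>
       (\<forall>f\<in>C. \<forall>g\<in>C. (\<forall>z\<in>op_spectrum T. f z = g z) \<longrightarrow> \<Phi> f = \<Phi> g) \<and>
       (\<forall>f\<in>C. \<forall>g\<in>C. \<Phi> (\<lambda>z. f z + g z) = (\<lambda>x. \<Phi> f x + \<Phi> g x)) \<and>
       (\<forall>c. \<forall>f\<in>C. \<Phi> (\<lambda>z. c * f z) = (\<lambda>x. c *\<^sub>C \<Phi> f x)) \<and>
       (\<forall>f\<in>C. \<forall>g\<in>C. \<Phi> (\<lambda>z. f z * g z) = \<Phi> f \<circ> \<Phi> g) \<and>
       (\<forall>f\<in>C. is_adjoint (\<Phi> f) (\<Phi> (\<lambda>z. cnj (f z)))) \<and>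
       \<Phi> (\<lambda>z. 1) = id \<and>
       \<Phi> (\<lambda>z. z) = T)"

definition functional_calculus ::
    "('a::complex_inner \<Rightarrow> 'a) \<Rightarrow> (complex \<Rightarrow> complex) \<Rightarrow> 'a \<Rightarrow> 'a" where
  "functional_calculus T f = (THE S. \<exists>\<Phi>. is_cfc T \<Phi> \<and> S = \<Phi> f)"


section \<open>The spaces \<open>L\<^sup>2(\<real>)\<close> and \<open>L\<^sup>2(\<real>\<^sub>+)\<close>\<close>

text \<open>
  The underlying set of an \<open>L\<^sup>2\<close> space is encoded by a phantom type parameter \<open>'d\<close>, so that
  both spaces are instances of one type constructor.
\<close>

class line_domain =
  fixes line_dom :: "'a itself \<Rightarrow> real set"
  assumes line_dom_borel: "line_dom TYPE('a) \<in> sets borel"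

datatype whole_line = Whole_Line
datatype half_line = Half_Line

instantiation whole_line :: line_domain
begin
definition "line_dom (_ :: whole_line itself) = (UNIV :: real set)"
instance by standard (simp add: line_dom_whole_line_def)
end

instantiation half_line :: line_domain
begin
definition "line_dom (_ :: half_line itself) = {0::real<..}"
instance by standard (simp add: line_dom_half_line_def)
end

abbreviation line_measure :: "'d::line_domain itself \<Rightarrow> real measure" where
  "line_measure D \<equiv> restrict_space lborel (line_dom D)"

definition square_integrable :: "real measure \<Rightarrow> (real \<Rightarrow> complex) \<Rightarrow> bool" where
  "square_integrable M f \<longleftrightarrow>
     f \<in> borel_measurable M \<and> integrable M (\<lambda>x. (cmod (f x))\<^sup>2)"

lemma square_integrable_zero: "square_integrable M (\<lambda>x. 0)"
  by (simp add: square_integrable_def)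

lemma square_integrable_scale:
  "square_integrable M f \<Longrightarrow> square_integrable M (\<lambda>x. c * f x)"
  by (auto simp: square_integrable_def norm_mult power_mult_distrib)

lemma square_integrable_add:
  assumes "square_integrable M f" "square_integrable M g"
  shows "square_integrable M (\<lambda>x. f x + g x)"
proof -
  have m [measurable]: "f \<in> borel_measurable M" "g \<in> borel_measurable M"
    using assms by (auto simp: square_integrable_def)
  have "integrable M (\<lambda>x. 2 * (cmod (f x))\<^sup>2 + 2 * (cmod (g x))\<^sup>2)"
    using assms by (auto simp: square_integrable_def)
  moreover have "(cmod (f x + g x))\<^sup>2 \<le> 2 * (cmod (f x))\<^sup>2 + 2 * (cmod (g x))\<^sup>2" for x
  proof -
    have "(cmod (f x + g x))\<^sup>2 \<le> (cmod (f x) + cmod (g x))\<^sup>2"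
      by (intro power_mono norm_triangle_ineq) auto
    also have "\<dots> \<le> 2 * (cmod (f x))\<^sup>2 + 2 * (cmod (g x))\<^sup>2"
      using zero_le_power2[of "cmod (f x) - cmod (g x)"]
      by (simp add: power2_eq_square algebra_simps)
    finally show ?thesis .
  qed
  ultimately have "integrable M (\<lambda>x. (cmod (f x + g x))\<^sup>2)"
    by (elim Bochner_Integration.integrable_bound) auto
  then show ?thesis
    by (simp add: square_integrable_def)
qed

lemma square_integrable_prod:
  assumes "square_integrable M f" "square_integrable M g"
  shows "integrable M (\<lambda>x. f x * cnj (g x))"
proof -
  have m [measurable]: "f \<in> borel_measurable M" "g \<in> borel_measurable M"
    using assms by (auto simp: square_integrable_def)
  have "integrable M (\<lambda>x. (cmod (f x))\<^sup>2 + (cmod (g x))\<^sup>2)"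
    using assms by (auto simp: square_integrable_def)
  moreover have "cmod (f x * cnj (g x)) \<le> (cmod (f x))\<^sup>2 + (cmod (g x))\<^sup>2" for x
  proof -
    have "cmod (f x) * cmod (g x) * 2 \<le> (cmod (f x))\<^sup>2 + (cmod (g x))\<^sup>2"
      using zero_le_power2[of "cmod (f x) - cmod (g x)"]
      by (simp add: power2_eq_square algebra_simps)
    moreover have "0 \<le> cmod (f x) * cmod (g x)" by simp
    ultimately have "cmod (f x) * cmod (g x) \<le> (cmod (f x))\<^sup>2 + (cmod (g x))\<^sup>2" by linarith
    then show ?thesis by (simp add: norm_mult)
  qed
  ultimately show ?thesis
    by (elim Bochner_Integration.integrable_bound)
      (auto intro!: borel_measurable_times borel_measurable_continuous_onI
        measurable_compose[OF m(2)] continuous_intros)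
qed

typedef (overloaded) 'd sqint =
  "{f. square_integrable (line_measure TYPE('d::line_domain)) f}"
  by (auto intro: exI[of _ "\<lambda>x. 0"] square_integrable_zero)

setup_lifting type_definition_sqint

definition sqint_eq :: "'d::line_domain sqint \<Rightarrow> 'd sqint \<Rightarrow> bool" where
  "sqint_eq f g \<longleftrightarrow> (AE x in line_measure TYPE('d). Rep_sqint f x = Rep_sqint g x)"

quotient_type (overloaded) 'd L2 = "'d::line_domain sqint" / sqint_eq
  morphisms rep_L2 abs_L2
proof (rule equivpI)
  show "reflp (sqint_eq :: 'd sqint \<Rightarrow> _)"
    by (auto intro!: reflpI simp: sqint_eq_def)
  show "symp (sqint_eq :: 'd sqint \<Rightarrow> _)"
    by (auto intro!: sympI simp: sqint_eq_def elim: eventually_mono)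
  show "transp (sqint_eq :: 'd sqint \<Rightarrow> _)"
    by (auto intro!: transpI simp: sqint_eq_def elim: eventually_elim2)
qed

lift_definition sq_zero :: "'d::line_domain sqint" is "\<lambda>x. 0"
  by (rule square_integrable_zero)
lift_definition sq_add :: "'d::line_domain sqint \<Rightarrow> 'd sqint \<Rightarrow> 'd sqint" is "\<lambda>f g x. f x + g x"
  by (rule square_integrable_add)
lift_definition sq_scale :: "complex \<Rightarrow> 'd::line_domain sqint \<Rightarrow> 'd sqint" is "\<lambda>c f x. c * f x"
  by (rule square_integrable_scale)

text \<open>
  \<open>L2_class f\<close> is the class of a square-integrable function \<open>f\<close> (and unspecified for other \<open>f\<close>);
  \<open>L2_fun F\<close> is some square-integrable representative of \<open>F\<close>.
\<close>

definition L2_class :: "(real \<Rightarrow> complex) \<Rightarrow> 'd::line_domain L2" where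
  "L2_class f = abs_L2 (Abs_sqint f)"

definition L2_fun :: "'d::line_domain L2 \<Rightarrow> real \<Rightarrow> complex" where
  "L2_fun F = Rep_sqint (rep_L2 F)"

lemma square_integrable_L2_fun:
  "square_integrable (line_measure TYPE('d)) (L2_fun (F :: 'd::line_domain L2))"
  using Rep_sqint by (auto simp: L2_fun_def)

lemma L2_class_L2_fun: "L2_class (L2_fun F) = F"
  by (simp add: L2_class_def L2_fun_def Rep_sqint_inverse Quotient3_abs_rep[OF Quotient3_L2])

lemma L2_class_eq_iff:
  assumes "square_integrable (line_measure TYPE('d)) f" "square_integrable (line_measure TYPE('d)) g"
  shows "L2_class f = (L2_class g :: 'd::line_domain L2) \<longleftrightarrow> (AE x in line_measure TYPE('d). f x = g x)"
  using assms by (simp add: L2_class_def L2.abs_eq_iff sqint_eq_def Abs_sqint_inverse)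

instantiation L2 :: (line_domain) scaleC
begin

lift_definition scaleC_L2 :: "complex \<Rightarrow> 'a L2 \<Rightarrow> 'a L2" is sq_scale
  by (auto simp: sqint_eq_def sq_scale.rep_eq elim: eventually_mono)

instance ..

end

instantiation L2 :: (line_domain) real_vector
begin

lift_definition zero_L2 :: "'a L2" is sq_zero .

lift_definition plus_L2 :: "'a L2 \<Rightarrow> 'a L2 \<Rightarrow> 'a L2" is sq_add
  by (auto simp: sqint_eq_def sq_add.rep_eq elim: eventually_elim2)

definition uminus_L2 :: "'a L2 \<Rightarrow> 'a L2" where "uminus_L2 F = (-1) *\<^sub>C F"
definition minus_L2 :: "'a L2 \<Rightarrow> 'a L2 \<Rightarrow> 'a L2" where "minus_L2 F G = F + (-1) *\<^sub>C G"
definition scaleR_L2 :: "real \<Rightarrow> 'a L2 \<Rightarrow> 'a L2" where "scaleR_L2 r F = complex_of_real r *\<^sub>C F"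

instance
proof
  fix F G K :: "'a L2" and a b :: real
  note rep_eqs = sqint_eq_def sq_zero.rep_eq sq_add.rep_eq sq_scale.rep_eq
  have assoc: "(F + G) + K = F + (G + K)" for F G K :: "'a L2"
    by transfer (simp add: rep_eqs add.assoc)
  have comm: "F + G = G + F" for F G :: "'a L2"
    by transfer (simp add: rep_eqs add.commute)
  have zero: "0 + F = F" for F :: "'a L2"
    by transfer (simp add: rep_eqs)
  have C1: "c *\<^sub>C (F + G) = c *\<^sub>C F + c *\<^sub>C G" for c and F G :: "'a L2"
    by transfer (simp add: rep_eqs distrib_left)
  have C2: "(c + d) *\<^sub>C F = c *\<^sub>C F + d *\<^sub>C F" for c d and F :: "'a L2"
    by transfer (simp add: rep_eqs distrib_right)
  have C3: "c *\<^sub>C (d *\<^sub>C F) = (c * d) *\<^sub>C F" for c d and F :: "'a L2"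
    by transfer (simp add: rep_eqs mult.assoc)
  have C4: "1 *\<^sub>C F = F" for F :: "'a L2"
    by transfer (simp add: rep_eqs)
  have C5: "0 *\<^sub>C F = 0" for F :: "'a L2"
    by transfer (simp add: rep_eqs)
  show "F + G + K = F + (G + K)" by (rule assoc)
  show "F + G = G + F" by (rule comm)
  show "0 + F = F" by (rule zero)
  show "- F + F = 0"
    using C2[of "-1" 1 F] by (simp add: uminus_L2_def C4 C5)
  show "F - G = F + - G"
    by (simp add: uminus_L2_def minus_L2_def)
  show "a *\<^sub>R (F + G) = a *\<^sub>R F + a *\<^sub>R G" by (simp add: scaleR_L2_def C1)
  show "(a + b) *\<^sub>R F = a *\<^sub>R F + b *\<^sub>R F" by (simp add: scaleR_L2_def C2)
  show "a *\<^sub>R b *\<^sub>R F = (a * b) *\<^sub>R F" by (simp add: scaleR_L2_def C3)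
  show "1 *\<^sub>R F = F" by (simp add: scaleR_L2_def C4)
qed

end

lift_definition L2_cinner :: "'d::line_domain L2 \<Rightarrow> 'd L2 \<Rightarrow> complex"
  is "\<lambda>f g. \<integral>x. Rep_sqint f x * cnj (Rep_sqint g x) \<partial>line_measure TYPE('d)"
proof -
  fix f f' g g' :: "'d sqint"
  assume "sqint_eq f f'" "sqint_eq g g'"
  then show "(\<integral>x. Rep_sqint f x * cnj (Rep_sqint g x) \<partial>line_measure TYPE('d)) =
      (\<integral>x. Rep_sqint f' x * cnj (Rep_sqint g' x) \<partial>line_measure TYPE('d))"
    using Rep_sqint[of f] Rep_sqint[of f'] Rep_sqint[of g] Rep_sqint[of g']
    by (intro integral_cong_AE borel_measurable_integrable square_integrable_prod)
      (auto simp: sqint_eq_def elim: eventually_elim2)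
qed

lemma L2_scaleC_laws:
  fixes F G :: "'d::line_domain L2"
  shows "c *\<^sub>C (F + G) = c *\<^sub>C F + c *\<^sub>C G"
    and "(c + d) *\<^sub>C F = c *\<^sub>C F + d *\<^sub>C F"
    and "c *\<^sub>C (d *\<^sub>C F) = (c * d) *\<^sub>C F"
  by (transfer; simp add: sqint_eq_def sq_add.rep_eq sq_scale.rep_eq distrib_left distrib_right mult.assoc)+

instantiation L2 :: (line_domain) complex_inner
begin

definition cinner_L2 :: "'a L2 \<Rightarrow> 'a L2 \<Rightarrow> complex" where "cinner_L2 = L2_cinner"
definition inner_L2 :: "'a L2 \<Rightarrow> 'a L2 \<Rightarrow> real" where "inner_L2 F G = Re (L2_cinner F G)"
definition norm_L2 :: "'a L2 \<Rightarrow> real" where "norm_L2 F = sqrt (inner F F)"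
definition dist_L2 :: "'a L2 \<Rightarrow> 'a L2 \<Rightarrow> real" where "dist_L2 F G = norm (F - G)"
definition sgn_L2 :: "'a L2 \<Rightarrow> 'a L2" where "sgn_L2 F = F /\<^sub>R norm F"
definition uniformity_L2 :: "('a L2 \<times> 'a L2) filter" where
  "uniformity_L2 = (INF e\<in>{0<..}. principal {(F, G). dist F G < e})"
definition open_L2 :: "'a L2 set \<Rightarrow> bool" where
  "open_L2 U = (\<forall>F\<in>U. \<forall>\<^sub>F (F', G) in uniformity. F' = F \<longrightarrow> G \<in> U)"

instance
proof
  fix F G K :: "'a L2" and c d :: complex and r :: real
  show "dist F G = norm (F - G)" by (rule dist_L2_def)
  show "sgn F = F /\<^sub>R norm F" by (rule sgn_L2_def)
  show "(uniformity :: ('a L2 \<times> 'a L2) filter) = (INF e\<in>{0<..}. principal {(F, G). dist F G < e})"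
    by (rule uniformity_L2_def)
  show "open U = (\<forall>F\<in>U. \<forall>\<^sub>F (F', G) in uniformity. F' = F \<longrightarrow> G \<in> U)" for U :: "'a L2 set"
    by (rule open_L2_def)
  note ci = cinner_L2_def inner_L2_def
  have I1: "cinner F G = cnj (cinner G F)" for F G :: "'a L2"
    unfolding ci by transfer (simp add: mult.commute flip: Bochner_Integration.integral_cnj)
  have I2: "cinner (F + G) K = cinner F K + cinner G K" for F G K :: "'a L2"
    unfolding ci
  proof transfer
    fix f g k :: "'a sqint"
    show "(\<integral>x. Rep_sqint (sq_add f g) x * cnj (Rep_sqint k x) \<partial>line_measure TYPE('a)) =
        (\<integral>x. Rep_sqint f x * cnj (Rep_sqint k x) \<partial>line_measure TYPE('a)) +
        (\<integral>x. Rep_sqint g x * cnj (Rep_sqint k x) \<partial>line_measure TYPE('a))"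
      using Rep_sqint[of f] Rep_sqint[of g] Rep_sqint[of k]
      by (simp add: sq_add.rep_eq distrib_right square_integrable_prod)
  qed
  have I3: "cinner (c *\<^sub>C F) G = c * cinner F G" for c and F G :: "'a L2"
    unfolding ci by transfer (simp add: sq_scale.rep_eq mult.assoc)
  show "inner F G = inner G F"
    using I1[of F G] by (simp add: inner_L2_def flip: cinner_L2_def)
  show "inner (F + G) K = inner F K + inner G K"
    by (simp add: inner_L2_def I2 flip: cinner_L2_def)
  show "inner (r *\<^sub>R F) G = r * inner F G"
    by (simp add: inner_L2_def scaleR_L2_def I3 flip: cinner_L2_def)
  have sq: "inner F F = (\<integral>x. (cmod (L2_fun F x))\<^sup>2 \<partial>line_measure TYPE('a))" for F :: "'a L2"
  proof -
    have "cinner F F = cinner (abs_L2 (rep_L2 F)) (abs_L2 (rep_L2 F))"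
      by (simp add: Quotient3_abs_rep[OF Quotient3_L2])
    also have "\<dots> = (\<integral>x. L2_fun F x * cnj (L2_fun F x) \<partial>line_measure TYPE('a))"
      unfolding cinner_L2_def L2_cinner.abs_eq L2_fun_def ..
    also have "\<dots> = (\<integral>x. complex_of_real ((cmod (L2_fun F x))\<^sup>2) \<partial>line_measure TYPE('a))"
      by (simp only: complex_norm_square)
    also have "\<dots> = complex_of_real (\<integral>x. (cmod (L2_fun F x))\<^sup>2 \<partial>line_measure TYPE('a))"
      by (rule integral_complex_of_real)
    finally show ?thesis
      by (simp add: inner_L2_def flip: cinner_L2_def)
  qed
  show "0 \<le> inner F F" by (simp add: sq)
  show "inner F F = 0 \<longleftrightarrow> F = 0"
  proof -
    note sqF = square_integrable_L2_fun[of F]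
    have "inner F F = 0 \<longleftrightarrow> (AE x in line_measure TYPE('a). L2_fun F x = 0)"
      using sqF unfolding sq by (subst integral_nonneg_eq_0_iff_AE) (auto simp: square_integrable_def)
    also have "\<dots> \<longleftrightarrow> L2_class (L2_fun F) = (L2_class (\<lambda>x. 0) :: 'a L2)"
      by (rule L2_class_eq_iff[symmetric, OF sqF square_integrable_zero])
    also have "\<dots> \<longleftrightarrow> F = 0"
      by (simp add: L2_class_L2_fun) (simp add: L2_class_def zero_L2_def sq_zero_def)
    finally show ?thesis .
  qed
  show "norm F = sqrt (inner F F)" by (rule norm_L2_def)
  show "c *\<^sub>C (F + G) = c *\<^sub>C F + c *\<^sub>C G" by (rule L2_scaleC_laws)
  show "(c + d) *\<^sub>C F = c *\<^sub>C F + d *\<^sub>C F" by (rule L2_scaleC_laws)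
  show "c *\<^sub>C (d *\<^sub>C F) = (c * d) *\<^sub>C F" by (rule L2_scaleC_laws)
  show "complex_of_real r *\<^sub>C F = r *\<^sub>R F" by (simp add: scaleR_L2_def)
  show "cinner F G = cnj (cinner G F)" by (rule I1)
  show "cinner (F + G) K = cinner F K + cinner G K" by (rule I2)
  show "cinner (c *\<^sub>C F) G = c * cinner F G" by (rule I3)
  show "inner F G = Re (cinner F G)" by (simp add: inner_L2_def cinner_L2_def)
qed

end

definition extend_zero :: "half_line L2 \<Rightarrow> whole_line L2" where
  "extend_zero F = L2_class (\<lambda>x. if 0 < x then L2_fun F x else 0)"


section \<open>The operators\<close>

definition cesaro_plus :: "half_line L2 \<Rightarrow> half_line L2" where
  "cesaro_plus F = L2_class (\<lambda>x. (1 / x) *\<^sub>R (LINT t:{0<..<x}|lborel. L2_fun F t))"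

definition holder :: "complex \<Rightarrow> whole_line L2 \<Rightarrow> whole_line L2" where
  "holder \<alpha> F = L2_class (\<lambda>x. 1 / Gamma \<alpha> *
     (LINT u:{0<..<1}|lborel. complex_of_real (ln (1 / u)) powr (\<alpha> - 1) * L2_fun F (u * x)))"

text \<open>The restriction of \<open>holder \<alpha>\<close> to the invariant subspace \<open>range extend_zero\<close>.\<close>

definition holder_plus :: "complex \<Rightarrow> half_line L2 \<Rightarrow> half_line L2" where
  "holder_plus \<alpha> F = the_inv extend_zero (holder \<alpha> (extend_zero F))"

text \<open>
  Complex \<open>powr\<close> is the principal branch \<open>exp (\<alpha> * Ln z)\<close> for \<open>z \<noteq> 0\<close>, and \<open>0 powr \<alpha> = 0\<close>. For
  \<open>0 < Re \<alpha>\<close> it is continuous on the spectrum \<open>{z. cmod (z - 1) = 1}\<close> of the Cesaro operator.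
\<close>

definition op_power :: "('a::complex_inner \<Rightarrow> 'a) \<Rightarrow> complex \<Rightarrow> 'a \<Rightarrow> 'a" where
  "op_power T \<alpha> = functional_calculus T (\<lambda>z. z powr \<alpha>)"

end

theory Submission
  imports Defs
begin

text \<open>
  Both sides are determined by how they act on powers of \<open>x\<close>. The Cesaro operator \<open>\<C>\<close> is causal:
  on \<open>(0,b)\<close> the function \<open>\<C>F\<close> depends only on the values of \<open>F\<close> there (\<open>trunc_Dil_trunc\<close>). On
  \<open>(0,b)\<close> it multiplies \<open>x\<^sup>n\<close> by \<open>\<integral>\<^sub>0\<^sup>1 u\<^sup>n du = 1/(n+1)\<close>, and the Hoelder operator multiplies it by
  \<open>\<Gamma>(\<alpha>)\<^sup>-\<^sup>1 \<integral>\<^sub>0\<^sup>1 (log 1/u)\<^sup>\<alpha>\<^sup>-\<^sup>1 u\<^sup>n du = (1/(n+1))\<^sup>\<alpha>\<close>, a Gamma integral (\<open>holder_kernel_moment\<close>). Since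
  polynomials are dense in \<open>L\<^sup>2(0,b)\<close> (\<open>bounded_op_kills_trunc\<close>), it is enough that the power
  \<open>\<C>\<^sup>\<alpha>\<close> of the functional calculus is also causal and also multiplies \<open>x\<^sup>n\<close> by \<open>(1/(n+1))\<^sup>\<alpha>\<close>.

  This follows from a power series. Both products of \<open>\<C>\<close> with its adjoint equal \<open>\<C> + \<C>*\<close>, because
  all of them have the kernel \<open>1 / max x s\<close>; so \<open>U = \<C> - 1\<close> is unitary (\<open>unitary_cesaro\<close>). For \<open>Re \<alpha> > 0\<close>
  the binomial series of \<open>(1 + w)\<^sup>\<alpha>\<close> converges absolutely and uniformly on the closed unit disc
  (\<open>binomial_series_closed_disc\<close>), and a *-homomorphism on continuous functions is contractive
  (\<open>is_cfc_contraction\<close>), so \<open>\<C>\<^sup>\<alpha>\<close> is the sum of \<open>(\<alpha> gchoose k) U\<^sup>k\<close> (\<open>op_power_one_plus_sums\<close>). Each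
  \<open>U\<^sup>k\<close> is causal, and on \<open>x\<^sup>n\<close> the series is evaluated at \<open>w = 1/(n+1) - 1\<close>, inside the disc.

  The power is defined by a definite description, so the calculus must also be shown to exist. For a
  unitary \<open>U\<close> on a complete space this rests on the inequality \<open>|p(U) x| \<le> sup |p| |x|\<close> for
  polynomials \<open>p\<close> in \<open>z\<close> and its conjugate (\<open>poly_op_contraction\<close>). It is proved with the waves
  \<open>\<Sum>\<^sub>k\<^sub><\<^sub>n w\<^sup>-\<^sup>k U\<^sup>k x\<close>, which are nearly eigenvectors of \<open>U\<close> and, averaged over the \<open>n\<close>-th roots of unity
  \<open>w\<close>, carry the norm of \<open>x\<close> by Parseval's identity; the Stone--Weierstrass theorem then gives all
  continuous functions on the circle. The calculus lives on the spectrum, which must be identified as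
  the whole circle \<open>|z - 1| = 1\<close>. Here causality helps again: the indicator of \<open>(0,1)\<close> is orthogonal to its
  images under \<open>U\<^sup>n\<close>, \<open>n \<ge> 1\<close>, so its waves have norm of order \<open>\<surd>n\<close> and
  are approximate eigenvectors for every point of the circle (\<open>op_spectrum_one_plus\<close>).
\<close>

section \<open>Complex inner product spaces\<close>

lemma scaleC_one [simp]: "1 *\<^sub>C x = (x::'a::complex_inner)"
  using scaleC_of_real[of 1 x] by simp

lemma scaleC_zero_left [simp]: "0 *\<^sub>C x = (0::'a::complex_inner)"
  using scaleC_of_real[of 0 x] by simp

lemma scaleC_zero_right [simp]: "c *\<^sub>C 0 = (0::'a::complex_inner)"
  using scaleC_scaleC[of c 0 "0::'a"] by simp

lemma scaleC_minus_one: "(-1) *\<^sub>C x = - (x::'a::complex_inner)"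
  using scaleC_of_real[of "-1" x] by simp

lemma scaleC_minus_left: "(- c) *\<^sub>C x = - (c *\<^sub>C (x::'a::complex_inner))"
  using scaleC_scaleC[of "-1" c x] by (simp add: scaleC_minus_one)

lemma scaleC_minus_right: "c *\<^sub>C (- x) = - (c *\<^sub>C (x::'a::complex_inner))"
  using scaleC_scaleC[of c "-1" x] by (simp add: scaleC_minus_one scaleC_minus_left)

lemma scaleC_diff_right: "c *\<^sub>C (x - y) = c *\<^sub>C x - c *\<^sub>C (y::'a::complex_inner)"
  using scaleC_add_right[of c x "-y"] by (simp add: scaleC_minus_right)

lemma scaleC_diff_left: "(c - d) *\<^sub>C x = c *\<^sub>C x - d *\<^sub>C (x::'a::complex_inner)"
  using scaleC_add_left[of c "-d" x] by (simp add: scaleC_minus_left)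

lemma scaleC_sum_right: "c *\<^sub>C (\<Sum>i\<in>I. f i) = (\<Sum>i\<in>I. c *\<^sub>C (f i :: 'a::complex_inner))"
  by (induction I rule: infinite_finite_induct) (auto simp: scaleC_add_right)

lemma cinner_zero_left [simp]: "cinner 0 (x::'a::complex_inner) = 0"
  using cinner_scaleC_left[of 0 0 x] by simp

lemma cinner_zero_right [simp]: "cinner (x::'a::complex_inner) 0 = 0"
  using cinner_commute[of x 0] by simp

lemma cinner_add_right: "cinner x (y + z) = cinner x y + cinner (x::'a::complex_inner) z"
  by (metis cinner_add_left cinner_commute complex_cnj_add)

lemma cinner_scaleC_right: "cinner x (c *\<^sub>C y) = cnj c * cinner (x::'a::complex_inner) y"
  by (metis cinner_commute cinner_scaleC_left complex_cnj_mult)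

lemma cinner_minus_left: "cinner (- x) y = - cinner (x::'a::complex_inner) y"
  using cinner_scaleC_left[of "-1" x y] by (simp add: scaleC_minus_one)

lemma cinner_diff_left: "cinner (x - y) z = cinner x z - cinner (y::'a::complex_inner) z"
  using cinner_add_left[of x "-y" z] by (simp add: cinner_minus_left)

lemma cinner_diff_right: "cinner x (y - z) = cinner x y - cinner (x::'a::complex_inner) z"
  by (metis cinner_commute cinner_diff_left complex_cnj_diff)

lemma cinner_sum_left: "cinner (\<Sum>i\<in>I. f i) x = (\<Sum>i\<in>I. cinner (f i) (x::'a::complex_inner))"
  by (induction I rule: infinite_finite_induct) (auto simp: cinner_add_left)

lemma cinner_sum_right: "cinner x (\<Sum>i\<in>I. f i) = (\<Sum>i\<in>I. cinner x (f i ::'a::complex_inner))"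
  by (induction I rule: infinite_finite_induct) (auto simp: cinner_add_right)

lemma cinner_self: "cinner x x = complex_of_real ((norm (x::'a::complex_inner))\<^sup>2)"
proof (rule complex_eqI)
  show "Re (cinner x x) = Re (complex_of_real ((norm x)\<^sup>2))"
    using inner_eq_Re_cinner[of x x] by (simp add: power2_norm_eq_inner)
  show "Im (cinner x x) = Im (complex_of_real ((norm x)\<^sup>2))"
    using arg_cong[OF cinner_commute[of x x], of Im] by simp
qed

lemma norm_scaleC: "norm (c *\<^sub>C x) = cmod c * norm (x::'a::complex_inner)"
proof -
  have "cinner (c *\<^sub>C x) (c *\<^sub>C x) = (c * cnj c) * cinner x x"
    by (simp add: cinner_scaleC_left cinner_scaleC_right)
  then have "complex_of_real ((norm (c *\<^sub>C x))\<^sup>2) = complex_of_real ((cmod c * norm x)\<^sup>2)"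
    by (simp only: cinner_self complex_norm_square[symmetric] power_mult_distrib of_real_mult)
  then have "(norm (c *\<^sub>C x))\<^sup>2 = (cmod c * norm x)\<^sup>2"
    using of_real_eq_iff by blast
  then show ?thesis by simp
qed

lemma norm_eqI_cinner:
  "cinner x x = cinner y y \<Longrightarrow> norm x = norm (y::'a::complex_inner)"
  by (simp only: cinner_self of_real_eq_iff power2_eq_iff_nonneg norm_ge_zero)

text \<open>Rotating \<open>x\<close> by a phase makes \<open>cinner x y\<close> real, where the real inequality applies.\<close>

lemma cinner_Cauchy_Schwarz: "cmod (cinner x y) \<le> norm x * norm (y::'a::complex_inner)"
proof (cases "cinner x y = 0")
  case False
  define c where "c = cnj (sgn (cinner x y))"
  have c: "cmod c = 1" using False by (simp add: c_def norm_sgn)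
  have "cinner (c *\<^sub>C x) y = complex_of_real (cmod (cinner x y))"
    using False by (simp add: cinner_scaleC_left c_def sgn_eq complex_norm_square[symmetric]
        power2_eq_square mult.commute)
  then have "cmod (cinner x y) = inner (c *\<^sub>C x) y"
    by (simp add: inner_eq_Re_cinner)
  also have "\<dots> \<le> norm (c *\<^sub>C x) * norm y"
    using Cauchy_Schwarz_ineq2[of "c *\<^sub>C x" y] by linarith
  finally show ?thesis by (simp add: norm_scaleC c)
qed simp

lemma bounded_linear_scaleC: "bounded_linear (\<lambda>x::'a::complex_inner. c *\<^sub>C x)"
proof (rule bounded_linear_intro)
  show "c *\<^sub>C (r *\<^sub>R x) = r *\<^sub>R (c *\<^sub>C x)" for r and x :: 'a
    by (simp flip: scaleC_of_real add: scaleC_scaleC mult.commute)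
  show "norm (c *\<^sub>C x) \<le> norm x * cmod c" for x :: 'a
    by (simp add: norm_scaleC mult.commute)
qed (rule scaleC_add_right)

lemma tendsto_scaleC: "(f \<longlongrightarrow> l) F \<Longrightarrow> ((\<lambda>x. c *\<^sub>C (f x :: 'a::complex_inner)) \<longlongrightarrow> c *\<^sub>C l) F"
  by (rule bounded_linear.tendsto[OF bounded_linear_scaleC])

lemma cinner_eqI:
  assumes "\<And>y. cinner x y = cinner x' (y::'a::complex_inner)"
  shows "x = x'"
  using assms[of "x - x'"] cinner_self[of "x - x'"] by (simp add: cinner_diff_left)

lemma bounded_op_add: "bounded_op T \<Longrightarrow> T (x + y) = T x + T y"
  and bounded_op_diff: "bounded_op T \<Longrightarrow> T (x - y) = T x - T y"
  and bounded_op_scaleC: "bounded_op T \<Longrightarrow> T (c *\<^sub>C x) = c *\<^sub>C T x"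
  and bounded_op_sum: "bounded_op T \<Longrightarrow> T (sum f I) = (\<Sum>i\<in>I. T (f i))"
  by (auto simp: bounded_op_def bounded_linear.linear linear_add linear_diff linear_sum)

lemma bounded_opI:
  assumes "\<And>x y. T (x + y) = T x + T y" "\<And>c x. T (c *\<^sub>C x) = c *\<^sub>C T x"
    and "\<And>x. norm (T x) \<le> K * norm x"
  shows "bounded_op (T::'a::complex_inner \<Rightarrow> 'a)"
  unfolding bounded_op_def
proof safe
  show "bounded_linear T"
    by (rule bounded_linear_intro[where K=K])
      (use assms in \<open>auto simp flip: scaleC_of_real simp: mult.commute\<close>)
qed (rule assms)

lemma bounded_op_bound:
  assumes "bounded_op T" obtains K where "K \<ge> 0" "\<And>x. norm (T x) \<le> K * norm x"
  using assms bounded_linear.nonneg_bounded[of T] unfolding bounded_op_def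
  by (metis mult.commute)

lemma bounded_op_plus:
  assumes "bounded_op S" "bounded_op T" shows "bounded_op (\<lambda>x. S x + T x)"
  using assms by (auto simp: bounded_op_def bounded_linear_add scaleC_add_right)

lemma bounded_op_comp:
  assumes "bounded_op S" "bounded_op T" shows "bounded_op (\<lambda>x. S (T x))"
  using assms by (auto simp: bounded_op_def intro: bounded_linear_compose)

lemma bounded_op_scale: "bounded_op (\<lambda>x. c *\<^sub>C (x::'a::complex_inner))"
  unfolding bounded_op_def using bounded_linear_scaleC by (auto simp: scaleC_scaleC mult.commute)

lemma bounded_op_id: "bounded_op (\<lambda>x. (x::'a::complex_inner))"
  using bounded_op_scale[of 1] by simp

lemma bounded_op_minus:
  assumes "bounded_op S" "bounded_op T" shows "bounded_op (\<lambda>x. S x - T x)"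
  using assms by (auto simp: bounded_op_def bounded_linear_sub scaleC_diff_right)

lemma is_adjoint_sym: "is_adjoint T S \<Longrightarrow> is_adjoint S (T::'a::complex_inner \<Rightarrow> 'a)"
  unfolding is_adjoint_def by (metis cinner_commute)

section \<open>The functional calculus of a unitary operator\<close>

locale unitary_op =
  fixes U V :: "'a::{complex_inner, complete_space} \<Rightarrow> 'a"
  assumes bU: "bounded_op U" and adj: "is_adjoint U V"
    and VU: "V (U x) = x" and UV: "U (V x) = x"
begin

lemma bV: "bounded_op V"
proof (rule bounded_opI)
  note a = adj[THEN is_adjoint_sym, unfolded is_adjoint_def, rule_format]
  show "V (x + y) = V x + V y" for x y
    by (rule cinner_eqI) (simp add: a cinner_add_left)
  show "V (c *\<^sub>C x) = c *\<^sub>C V x" for c x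
    by (rule cinner_eqI) (simp add: a cinner_scaleC_left)
  show "norm (V x) \<le> 1 * norm x" for x
    using norm_eqI_cinner[of "V x" x] by (simp add: a UV)
qed

lemma norm_U: "norm (U x) = norm x"
  by (rule norm_eqI_cinner) (use adj in \<open>simp add: is_adjoint_def VU\<close>)

lemma norm_U_funpow: "norm ((U ^^ n) x) = norm x"
  by (induction n) (auto simp: norm_U)

lemma norm_V: "norm (V x) = norm x"
  using norm_U[of "V x"] by (simp add: UV)

subsection \<open>Polynomials in \<open>U\<close> and its adjoint\<close>

text \<open>
  This is a relation because a function on the circle is given by many polynomials in \<open>z\<close> and
  \<open>cnj z\<close>; that the operator depends only on the function is a consequence of
  \<open>poly_op_contraction\<close>.
\<close>

inductive poly_op :: "(complex \<Rightarrow> complex) \<Rightarrow> ('a \<Rightarrow> 'a) \<Rightarrow> bool" where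
  const: "poly_op (\<lambda>z. c) (\<lambda>x. c *\<^sub>C x)"
| gen: "poly_op (\<lambda>z. z) U"
| gen_adj: "poly_op cnj V"
| add: "poly_op p A \<Longrightarrow> poly_op q B \<Longrightarrow> poly_op (\<lambda>z. p z + q z) (\<lambda>x. A x + B x)"
| mult: "poly_op p A \<Longrightarrow> poly_op q B \<Longrightarrow> poly_op (\<lambda>z. p z * q z) (\<lambda>x. A (B x))"

lemma poly_op_bounded: "poly_op p A \<Longrightarrow> bounded_op A"
  by (induction rule: poly_op.induct)
    (auto intro: bounded_op_plus bounded_op_comp bounded_op_scale bU bV)

lemma poly_op_continuous: "poly_op p A \<Longrightarrow> continuous_on S p"
  by (induction rule: poly_op.induct) (auto intro!: continuous_intros)

lemma poly_op_adjoint: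
  "poly_op p A \<Longrightarrow> \<exists>B. poly_op (\<lambda>z. cnj (p z)) B \<and> is_adjoint A B"
proof (induction rule: poly_op.induct)
  case (const c)
  show ?case
    by (rule exI[of _ "\<lambda>x. cnj c *\<^sub>C x"])
      (auto simp: is_adjoint_def cinner_scaleC_left cinner_scaleC_right intro: poly_op.const)
next
  case gen
  then show ?case using poly_op.gen_adj adj by auto
next
  case gen_adj
  then show ?case using poly_op.gen is_adjoint_sym[OF adj] by auto
next
  case (add p A q B)
  then obtain A' B' where "poly_op (\<lambda>z. cnj (p z)) A'" "is_adjoint A A'"
     "poly_op (\<lambda>z. cnj (q z)) B'" "is_adjoint B B'" by blast
  then show ?case
    by (intro exI[of _ "\<lambda>x. A' x + B' x"])
      (auto simp: is_adjoint_def cinner_add_left cinner_add_right dest: poly_op.add)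
next
  case (mult p A q B)
  then obtain A' B' where *: "poly_op (\<lambda>z. cnj (p z)) A'" "is_adjoint A A'"
     "poly_op (\<lambda>z. cnj (q z)) B'" "is_adjoint B B'" by blast
  from poly_op.mult[OF *(3,1)] have "poly_op (\<lambda>z. cnj (p z * q z)) (\<lambda>x. B' (A' x))"
    by (simp add: mult.commute)
  with * show ?case
    by (intro exI[of _ "\<lambda>x. B' (A' x)"]) (auto simp: is_adjoint_def)
qed

lemma poly_op_commute: "poly_op p A \<Longrightarrow> A (U x) = U (A x)"
proof (induction arbitrary: x rule: poly_op.induct)
  case (const c) then show ?case by (simp add: bounded_op_scaleC[OF bU])
qed (auto simp: VU UV bounded_op_add[OF bU])

lemma poly_op_commute_funpow: "poly_op p A \<Longrightarrow> A ((U ^^ k) x) = (U ^^ k) (A x)"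
  by (induction k) (auto simp: poly_op_commute)

subsection \<open>Approximate eigenvectors\<close>

text \<open>
  A partial sum of the formal eigenvector \<open>\<Sum>\<^sub>k w\<^sup>-\<^sup>k U\<^sup>k x\<close>.
\<close>

definition wave :: "complex \<Rightarrow> nat \<Rightarrow> 'a \<Rightarrow> 'a" where
  "wave w n x = (\<Sum>k<n. (cnj w ^ k) *\<^sub>C (U ^^ k) x)"

text \<open>
  Applying \<open>U\<close> shifts the sum by one index, so only the two boundary terms survive. The
  error stays bounded while the wave itself has norm of order \<open>\<surd>n\<close> in quadratic mean over \<open>w\<close>.
\<close>

lemma norm_U_wave:
  assumes "cmod w = 1"
  shows "norm (U (wave w n x) - w *\<^sub>C wave w n x) \<le> 2 * norm x"
proof -
  have wc: "w * cnj w = 1" using assms complex_norm_square[of w] by simp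
  define g where "g k = (cnj w ^ k) *\<^sub>C (U ^^ k) x" for k
  have "w * cnj w ^ Suc k = cnj w ^ k" for k using wc by (simp flip: mult.assoc)
  then have 1: "U (wave w n x) = w *\<^sub>C (\<Sum>k<n. g (Suc k))"
    by (simp add: wave_def bounded_op_sum[OF bU] bounded_op_scaleC[OF bU] g_def
        scaleC_sum_right scaleC_scaleC del: power_Suc)
  have 2: "w *\<^sub>C wave w n x = w *\<^sub>C (\<Sum>k<n. g k)"
    by (simp add: wave_def g_def)
  have "U (wave w n x) - w *\<^sub>C wave w n x = w *\<^sub>C (g n - g 0)"
    by (simp only: 1 2 scaleC_diff_right[symmetric] sum_subtractf[symmetric] sum_lessThan_telescope)
  then have "norm (U (wave w n x) - w *\<^sub>C wave w n x) = norm (g n - g 0)"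
    by (simp add: norm_scaleC assms)
  also have "\<dots> \<le> norm (g n) + norm (g 0)" by (rule norm_triangle_ineq4)
  also have "\<dots> = 2 * norm x"
    by (simp add: g_def norm_scaleC norm_power assms norm_U_funpow)
  finally show ?thesis .
qed

text \<open>
  The error bound, uniform in \<open>w\<close> and \<open>n\<close>, passes through products because operators are bounded and
  polynomials are bounded on the circle.
\<close>

lemma poly_op_wave:
  "poly_op p A \<Longrightarrow> \<exists>K\<ge>0. \<forall>w n x. cmod w = 1 \<longrightarrow>
     norm (A (wave w n x) - p w *\<^sub>C wave w n x) \<le> K * norm x"
proof (induction rule: poly_op.induct)
  case (const c)
  then show ?case by (intro exI[of _ 0]) auto
next
  case gen
  then show ?case using norm_U_wave by (intro exI[of _ 2]) auto
next
  case gen_adj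
  have "norm (V (wave w n x) - cnj w *\<^sub>C wave w n x) \<le> 2 * norm x" if w: "cmod w = 1" for w n x
  proof -
    have wc: "cnj w * w = 1" using w complex_norm_square[of w] by (simp add: mult.commute)
    let ?y = "wave w n x"
    have "V ?y - cnj w *\<^sub>C ?y = - (cnj w *\<^sub>C V (U ?y - w *\<^sub>C ?y))"
      by (simp add: bounded_op_diff[OF bV] bounded_op_scaleC[OF bV] VU scaleC_diff_right
          scaleC_scaleC wc)
    then show ?thesis using norm_U_wave[OF w] by (simp add: norm_scaleC norm_V w)
  qed
  then show ?case by (intro exI[of _ 2]) auto
next
  case (add p A q B)
  then obtain K L where *: "K \<ge> 0" "L \<ge> 0"
    "\<And>w n x. cmod w = 1 \<Longrightarrow> norm (A (wave w n x) - p w *\<^sub>C wave w n x) \<le> K * norm x"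
    "\<And>w n x. cmod w = 1 \<Longrightarrow> norm (B (wave w n x) - q w *\<^sub>C wave w n x) \<le> L * norm x"
    by metis
  have "norm (A (wave w n x) + B (wave w n x) - (p w + q w) *\<^sub>C wave w n x) \<le> (K + L) * norm x"
    if "cmod w = 1" for w n x
    using norm_triangle_mono[OF *(3)[OF that, of n x] *(4)[OF that, of n x]]
    by (simp add: scaleC_add_left algebra_simps)
  then show ?case using * by (intro exI[of _ "K+L"]) auto
next
  case (mult p A q B)
  then obtain K L where *: "K \<ge> 0" "L \<ge> 0"
    "\<And>w n x. cmod w = 1 \<Longrightarrow> norm (A (wave w n x) - p w *\<^sub>C wave w n x) \<le> K * norm x"
    "\<And>w n x. cmod w = 1 \<Longrightarrow> norm (B (wave w n x) - q w *\<^sub>C wave w n x) \<le> L * norm x"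
    by metis
  have bA: "bounded_op A" using mult poly_op_bounded by auto
  obtain N where N: "N \<ge> 0" "\<And>x. norm (A x) \<le> N * norm x" using bounded_op_bound[OF bA] by blast
  have "compact (q ` sphere 0 1)"
    using mult by (intro compact_continuous_image poly_op_continuous) auto
  then obtain Q where "\<forall>z\<in>q ` sphere 0 1. cmod z \<le> Q"
    using compact_imp_bounded bounded_iff by metis
  then have Q: "cmod w = 1 \<Longrightarrow> cmod (q w) \<le> Q" for w by auto
  have Q0: "Q \<ge> 0" using Q[of 1] norm_ge_zero[of "q 1"] by (simp del: norm_ge_zero)
  have "norm (A (B (wave w n x)) - (p w * q w) *\<^sub>C wave w n x) \<le> (N * L + Q * K) * norm x"
    if w: "cmod w = 1" for w n x
  proof -
    let ?y = "wave w n x"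
    have "A (B ?y) - (p w * q w) *\<^sub>C ?y
        = A (B ?y - q w *\<^sub>C ?y) + q w *\<^sub>C (A ?y - p w *\<^sub>C ?y)"
      by (simp add: bounded_op_diff[OF bA] bounded_op_scaleC[OF bA] scaleC_diff_right
          scaleC_scaleC mult.commute)
    also have "norm \<dots> \<le> norm (A (B ?y - q w *\<^sub>C ?y)) + norm (q w *\<^sub>C (A ?y - p w *\<^sub>C ?y))"
      by (rule norm_triangle_ineq)
    also have "\<dots> \<le> N * (L * norm x) + Q * (K * norm x)"
      unfolding norm_scaleC using N Q[OF w] Q0 *(1,2) *(3,4)[OF w, of n x]
      by (intro add_mono mult_mono order_trans[OF N(2)] mult_left_mono) auto
    finally show ?thesis by (simp add: algebra_simps)
  qed
  then show ?case using * N Q0 by (intro exI[of _ "N*L+Q*K"]) auto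
qed

end

text \<open>Orthogonality of the characters of \<open>\<int>/n\<close>.\<close>

lemma sum_root_unity_characters:
  assumes "k < n" "l < n"
  shows "(\<Sum>j<n. cnj (cis (2*pi*real j/real n)) ^ k * cis (2*pi*real j/real n) ^ l)
       = (if k = l then of_nat n else 0)"
proof -
  define x where "x = cis (2*pi*(real l - real k)/real n)"
  have "cnj (cis (2*pi*real j/real n)) ^ k * cis (2*pi*real j/real n) ^ l = x ^ j" for j
    by (simp add: x_def cis_cnj Complex.DeMoivre cis_mult algebra_simps add_divide_distrib diff_divide_distrib)
  then have eq: "(\<Sum>j<n. cnj (cis (2*pi*real j/real n)) ^ k * cis (2*pi*real j/real n) ^ l) = (\<Sum>j<n. x ^ j)"
    by simp
  have "x ^ n = cis (2 * pi * real_of_int (int l - int k))"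
    using assms by (simp add: x_def Complex.DeMoivre)
  then have xn: "x ^ n = 1" by (simp only: cis_multiple_2pi Ints_of_int)
  show ?thesis
  proof (cases "k = l")
    case True then show ?thesis unfolding eq by (simp add: x_def)
  next
    case False
    have "x \<noteq> 1"
    proof
      assume "x = 1"
      then obtain m :: int where "2*pi*(real l - real k)/real n = of_int m * (2 * pi)"
        by (auto simp: x_def complex_eq_iff cos_one_2pi_int)
      then have "2*pi*(real l - real k) = 2 * pi * (of_int m * real n)"
        using assms by (simp add: field_simps)
      then have "real l - real k = of_int m * real n" by (simp only: mult_cancel_left) simp
      then have "int l - int k = m * int n"
        by (metis of_int_diff of_int_eq_iff of_int_mult of_int_of_nat_eq)
      moreover have "\<bar>int l - int k\<bar> < int n" using assms by auto
      ultimately have "\<bar>m\<bar> * int n < 1 * int n" by (simp add: abs_mult)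
      then have "m = 0" by (subst (asm) mult_less_cancel_right) auto
      with \<open>int l - int k = m * int n\<close> False show False by simp
    qed
    then have "(\<Sum>j<n. x ^ j) = 0" using geometric_sum[of x n] xn by simp
    then show ?thesis unfolding eq using False by simp
  qed
qed

text \<open>
  The discrete Fourier transform is unitary up to scale, also for vector-valued sequences.
\<close>

lemma finite_Parseval:
  fixes v :: "nat \<Rightarrow> 'a::complex_inner"
  defines "\<omega> \<equiv> \<lambda>n j. cis (2*pi*real j/real n)"
  shows "(\<Sum>j<n. (norm (\<Sum>k<n. (cnj (\<omega> n j) ^ k) *\<^sub>C v k))\<^sup>2) = real n * (\<Sum>k<n. (norm (v k))\<^sup>2)"
proof -
  have "complex_of_real (\<Sum>j<n. (norm (\<Sum>k<n. (cnj (\<omega> n j) ^ k) *\<^sub>C v k))\<^sup>2)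
     = (\<Sum>j<n. \<Sum>k<n. \<Sum>l<n. (cnj (\<omega> n j) ^ k * \<omega> n j ^ l) * cinner (v k) (v l))"
    unfolding of_real_sum cinner_self[symmetric]
    by (intro sum.cong refl) (simp only: cinner_sum_left,
      simp only: cinner_sum_right cinner_scaleC_left cinner_scaleC_right complex_cnj_power complex_cnj_cnj mult_ac)
  also have "\<dots> = (\<Sum>k<n. \<Sum>j<n. \<Sum>l<n. (cnj (\<omega> n j) ^ k * \<omega> n j ^ l) * cinner (v k) (v l))"
    by (rule sum.swap)
  also have "\<dots> = (\<Sum>k<n. \<Sum>l<n. \<Sum>j<n. (cnj (\<omega> n j) ^ k * \<omega> n j ^ l) * cinner (v k) (v l))"
    by (rule sum.cong, rule refl, rule sum.swap)
  also have "\<dots> = (\<Sum>k<n. \<Sum>l<n. (\<Sum>j<n. cnj (\<omega> n j) ^ k * \<omega> n j ^ l) * cinner (v k) (v l))"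
    by (simp only: sum_distrib_right)
  also have "\<dots> = (\<Sum>k<n. \<Sum>l<n. (if k = l then of_nat n else 0) * cinner (v k) (v l))"
    unfolding \<omega>_def by (intro sum.cong refl, subst sum_root_unity_characters) auto
  also have "\<dots> = (\<Sum>k<n. of_nat n * cinner (v k) (v k))"
    by (intro sum.cong refl) (simp add: if_distrib[of "\<lambda>x. x * _"] sum.delta cong: if_cong)
  also have "\<dots> = complex_of_real (real n * (\<Sum>k<n. (norm (v k))\<^sup>2))"
    by (simp add: cinner_self sum_distrib_left)
  finally show ?thesis using of_real_eq_iff by blast
qed

context unitary_op
begin

text \<open>
  The operator \<open>A\<close> commutes with \<open>U\<close>, so it maps the waves of \<open>x\<close> to the waves of \<open>A x\<close>. By
  Parseval over the \<open>n\<close>-th roots of unity, \<open>n |A x|\<close> is the \<open>\<ell>\<^sup>2\<close> norm of \<open>|A wave|\<close>, where \<open>A\<close> acts like the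
  scalar \<open>p w\<close> with bounded error. The errors contribute \<open>O(\<surd>n)\<close> in total and disappear after
  division by \<open>n\<close>.
\<close>

lemma poly_op_contraction:
  assumes pA: "poly_op p A" and M: "\<And>z. cmod z = 1 \<Longrightarrow> cmod (p z) \<le> M"
  shows "norm (A x) \<le> M * norm x"
proof -
  obtain K where K: "K \<ge> 0"
    "\<And>w n x. cmod w = 1 \<Longrightarrow> norm (A (wave w n x) - p w *\<^sub>C wave w n x) \<le> K * norm x"
    using poly_op_wave[OF pA] by blast
  have M0: "M \<ge> 0" using M[of 1] norm_ge_zero[of "p 1"] by (simp del: norm_ge_zero)
  have A: "bounded_op A" using poly_op_bounded[OF pA] .
  define \<omega> where "\<omega> n j = cis (2*pi*real j/real n)" for n j
  have L2w: "L2_set (\<lambda>j. norm (wave (\<omega> n j) n y)) {..<n} = real n * norm y" for n y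
  proof -
    have "(\<Sum>j<n. (norm (wave (\<omega> n j) n y))\<^sup>2) = real n * (\<Sum>k<n. (norm y)\<^sup>2)"
      unfolding wave_def \<omega>_def finite_Parseval norm_U_funpow ..
    also have "\<dots> = (real n * norm y)\<^sup>2" by (simp add: power2_eq_square)
    finally show ?thesis by (simp add: L2_set_def)
  qed
  have bound: "norm (A x) \<le> M * norm x + K * norm x * (1 / sqrt (real n))" if n: "n > 0" for n
  proof -
    have "real n * norm (A x) = L2_set (\<lambda>j. norm (wave (\<omega> n j) n (A x))) {..<n}"
      by (simp add: L2w)
    also have "(\<lambda>j. norm (wave (\<omega> n j) n (A x))) = (\<lambda>j. norm (A (wave (\<omega> n j) n x)))"
      by (simp add: wave_def bounded_op_sum[OF A] bounded_op_scaleC[OF A] poly_op_commute_funpow[OF pA])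
    also have "L2_set \<dots> {..<n} \<le> L2_set (\<lambda>j. M * norm (wave (\<omega> n j) n x) + K * norm x) {..<n}"
    proof (rule L2_set_mono)
      fix j
      let ?w = "\<omega> n j" and ?y = "wave (\<omega> n j) n x"
      have w: "cmod ?w = 1" by (simp add: \<omega>_def)
      have "norm (A ?y) \<le> norm (p ?w *\<^sub>C ?y) + norm (A ?y - p ?w *\<^sub>C ?y)"
        using norm_triangle_sub by blast
      also have "\<dots> \<le> M * norm ?y + K * norm x"
        unfolding norm_scaleC by (intro add_mono K w mult_right_mono M) auto
      finally show "norm (A ?y) \<le> M * norm ?y + K * norm x" .
    qed auto
    also have "\<dots> \<le> L2_set (\<lambda>j. M * norm (wave (\<omega> n j) n x)) {..<n} + L2_set (\<lambda>j. K * norm x) {..<n}"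
      by (rule L2_set_triangle_ineq)
    also have "\<dots> = real n * (M * norm x) + sqrt (real n) * (K * norm x)"
    proof -
      have "L2_set (\<lambda>j. M * norm (wave (\<omega> n j) n x)) {..<n} = M * (real n * norm x)"
        by (simp only: L2_set_right_distrib[OF M0, symmetric] L2w)
      moreover have "L2_set (\<lambda>j. K * norm x) {..<n} = sqrt (real n) * (K * norm x)"
        using K(1) by (simp add: L2_set_def real_sqrt_mult)
      ultimately show ?thesis by simp
    qed
    finally have "norm (A x) * real n \<le> real n * (M * norm x) + sqrt (real n) * (K * norm x)"
      by (simp add: mult.commute)
    then have "norm (A x) \<le> (real n * (M * norm x) + sqrt (real n) * (K * norm x)) / real n"
      using n by (simp add: pos_le_divide_eq)
    also have "\<dots> = M * norm x + K * norm x * (sqrt (real n) / real n)"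
      using n by (simp add: add_divide_distrib)
    also have "sqrt (real n) / real n = 1 / sqrt (real n)"
      using n by (simp add: field_simps)
    finally show ?thesis .
  qed
  have "(\<lambda>n. 1 / sqrt (real n)) \<longlonglongrightarrow> 0"
    by (intro tendsto_divide_0[OF tendsto_const] filterlim_at_top_imp_at_infinity
        filterlim_compose[OF sqrt_at_top filterlim_real_sequentially])
  then have "(\<lambda>n. M * norm x + K * norm x * (1 / sqrt (real n))) \<longlonglongrightarrow> M * norm x + K * norm x * 0"
    by (intro tendsto_intros)
  then show ?thesis
    using bound by (intro Lim_bounded2[where N=1]) auto
qed

subsection \<open>Continuous functions\<close>

lemma small_multiple:
  fixes t e :: real
  assumes "0 \<le> t" "0 < e"
  obtains d where "d > 0" "d * t < e"
proof
  show "e / (t + 1) > 0" "e / (t + 1) * t < e"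
    using assms by (auto simp: field_simps)
qed

text \<open>
  The closure of \<open>poly_op\<close>, in the uniform norm on the circle and in the operator norm.
\<close>

definition cfc_rel :: "(complex \<Rightarrow> complex) \<Rightarrow> ('a \<Rightarrow> 'a) \<Rightarrow> bool" where
  "cfc_rel f A \<longleftrightarrow> bounded_op A \<and> (\<forall>e>0. \<exists>p B. poly_op p B \<and>
     (\<forall>z. cmod z = 1 \<longrightarrow> cmod (f z - p z) \<le> e) \<and> (\<forall>x. norm (A x - B x) \<le> e * norm x))"

lemma cfc_relD:
  assumes "cfc_rel f A" "e > 0"
  obtains p B where "poly_op p B" "\<And>z. cmod z = 1 \<Longrightarrow> cmod (f z - p z) \<le> e"
    "\<And>x. norm (A x - B x) \<le> e * norm x"
  using assms unfolding cfc_rel_def by blast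

lemma cfc_rel_bounded: "cfc_rel f A \<Longrightarrow> bounded_op A"
  by (simp add: cfc_rel_def)

lemma cfc_rel_poly: "poly_op p A \<Longrightarrow> cfc_rel p A"
  unfolding cfc_rel_def
proof (intro conjI allI impI)
  assume pA: "poly_op p A"
  then show "bounded_op A" by (rule poly_op_bounded)
  show "\<exists>q B. poly_op q B \<and> (\<forall>z. cmod z = 1 \<longrightarrow> cmod (p z - q z) \<le> e) \<and>
      (\<forall>x. norm (A x - B x) \<le> e * norm x)" if "e > 0" for e
    using that by (intro exI[of _ p] exI[of _ A] conjI pA) auto
qed

lemma cfc_rel_cong: "cfc_rel f A \<Longrightarrow> (\<And>z. cmod z = 1 \<Longrightarrow> f z = g z) \<Longrightarrow> cfc_rel g A"
  unfolding cfc_rel_def by simp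

lemma cfc_rel_contraction:
  assumes "cfc_rel f A" and M: "\<And>z. cmod z = 1 \<Longrightarrow> cmod (f z) \<le> M"
  shows "norm (A x) \<le> M * norm x"
proof (rule field_le_epsilon)
  fix d :: real assume d: "d > 0"
  obtain e where e: "e > 0" and "e * (2 * norm x) < d"
    by (rule small_multiple[of "2 * norm x" d]) (use d in auto)
  obtain p B where B: "poly_op p B" "\<And>z. cmod z = 1 \<Longrightarrow> cmod (f z - p z) \<le> e"
    "\<And>x. norm (A x - B x) \<le> e * norm x"
    by (rule cfc_relD[OF assms(1) e]) (rule that)
  have "cmod (p z) \<le> M + e" if "cmod z = 1" for z
    using norm_triangle_ineq4[of "f z" "f z - p z"] B(2)[OF that] M[OF that] by simp
  then have "norm (B x) \<le> (M + e) * norm x" by (rule poly_op_contraction[OF B(1)])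
  then have "norm (A x) \<le> (M + e) * norm x + e * norm x"
    using norm_triangle_ineq[of "A x - B x" "B x"] B(3)[of x] by simp
  then show "norm (A x) \<le> M * norm x + d"
    using \<open>e * (2 * norm x) < d\<close> by (simp add: algebra_simps)
qed

lemma cfc_rel_bdd:
  assumes "cfc_rel f A" obtains M where "M \<ge> 0" "\<And>z. cmod z = 1 \<Longrightarrow> cmod (f z) \<le> M"
proof -
  obtain p B where B: "poly_op p B" "\<And>z. cmod z = 1 \<Longrightarrow> cmod (f z - p z) \<le> 1"
    by (rule cfc_relD[OF assms zero_less_one]) (rule that)
  have "compact (p ` sphere 0 1)"
    using B by (intro compact_continuous_image poly_op_continuous) auto
  then obtain Q where "\<forall>z\<in>p ` sphere 0 1. cmod z \<le> Q"
    using compact_imp_bounded bounded_iff by metis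
  then have Q: "cmod w = 1 \<Longrightarrow> cmod (p w) \<le> Q" for w by auto
  have "cmod (f z) \<le> Q + 1" if "cmod z = 1" for z
    using norm_triangle_ineq[of "f z - p z" "p z"] B(2)[OF that] Q[OF that] by simp
  then show ?thesis using that[of "max 0 (Q + 1)"] by (simp add: le_max_iff_disj)
qed

lemma cfc_rel_add:
  assumes "cfc_rel f A" "cfc_rel g B"
  shows "cfc_rel (\<lambda>z. f z + g z) (\<lambda>x. A x + B x)"
  unfolding cfc_rel_def
proof safe
  show "bounded_op (\<lambda>x. A x + B x)"
    using assms by (intro bounded_op_plus cfc_rel_bounded)
  fix e :: real assume "e > 0"
  then have e: "e/2 > 0" by simp
  obtain p P where P: "poly_op p P" "\<And>z. cmod z = 1 \<Longrightarrow> cmod (f z - p z) \<le> e/2"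
    "\<And>x. norm (A x - P x) \<le> e/2 * norm x" by (rule cfc_relD[OF assms(1) e]) (rule that)
  obtain q Q where Q: "poly_op q Q" "\<And>z. cmod z = 1 \<Longrightarrow> cmod (g z - q z) \<le> e/2"
    "\<And>x. norm (B x - Q x) \<le> e/2 * norm x" by (rule cfc_relD[OF assms(2) e]) (rule that)
  have "cmod (f z + g z - (p z + q z)) \<le> e" if "cmod z = 1" for z
    using norm_triangle_mono[OF P(2)[OF that] Q(2)[OF that]] by (simp add: algebra_simps)
  moreover have "norm (A x + B x - (P x + Q x)) \<le> e * norm x" for x
    using norm_triangle_mono[OF P(3)[of x] Q(3)[of x]] by (simp add: algebra_simps)
  ultimately show "\<exists>p B'. poly_op p B' \<and> (\<forall>z. cmod z = 1 \<longrightarrow> cmod (f z + g z - p z) \<le> e) \<and>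
      (\<forall>x. norm (A x + B x - B' x) \<le> e * norm x)"
    using poly_op.add[OF P(1) Q(1)] by blast
qed

lemma cfc_rel_mult:
  assumes "cfc_rel f A" "cfc_rel g B"
  shows "cfc_rel (\<lambda>z. f z * g z) (\<lambda>x. A (B x))"
  unfolding cfc_rel_def
proof safe
  have bA: "bounded_op A" and bB: "bounded_op B" using assms cfc_rel_bounded by blast+
  then show "bounded_op (\<lambda>x. A (B x))" by (rule bounded_op_comp)
  fix e :: real assume e: "e > 0"
  obtain M where M: "M \<ge> 0" "\<And>z. cmod z = 1 \<Longrightarrow> cmod (f z) \<le> M" by (rule cfc_rel_bdd[OF assms(1)]) (rule that)
  obtain N where N: "N \<ge> 0" "\<And>z. cmod z = 1 \<Longrightarrow> cmod (g z) \<le> N" by (rule cfc_rel_bdd[OF assms(2)]) (rule that)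
  define d where "d = min 1 (e / (M + N + 1))"
  have d: "d > 0" "d \<le> 1" using e M N by (auto simp: d_def)
  have "d \<le> e / (M + N + 1)" by (simp add: d_def)
  then have de: "d * (M + N + 1) \<le> e" using M N by (simp add: pos_le_divide_eq)
  obtain p P where P: "poly_op p P" "\<And>z. cmod z = 1 \<Longrightarrow> cmod (f z - p z) \<le> d"
    "\<And>x. norm (A x - P x) \<le> d * norm x" by (rule cfc_relD[OF assms(1) d(1)]) (rule that)
  obtain q Q where Q: "poly_op q Q" "\<And>z. cmod z = 1 \<Longrightarrow> cmod (g z - q z) \<le> d"
    "\<And>x. norm (B x - Q x) \<le> d * norm x" by (rule cfc_relD[OF assms(2) d(1)]) (rule that)
  have q: "cmod (q z) \<le> N + 1" if "cmod z = 1" for z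
    using norm_triangle_ineq4[of "g z" "g z - q z"] Q(2)[OF that] N(2)[OF that] d by simp
  have bd: "d * (N + 1) + M * d \<le> e" using de by (simp add: algebra_simps)
  have "cmod (f z * g z - p z * q z) \<le> e" if z: "cmod z = 1" for z
  proof -
    have "f z * g z - p z * q z = (f z - p z) * q z + f z * (g z - q z)" by (simp add: algebra_simps)
    also have "cmod \<dots> \<le> d * (N + 1) + M * d"
      using P(2)[OF z] q[OF z] M(1) M(2)[OF z] Q(2)[OF z] d
      by (intro norm_triangle_mono) (auto simp: norm_mult intro!: mult_mono)
    finally show ?thesis using bd by linarith
  qed
  moreover have "norm (A (B x) - P (Q x)) \<le> e * norm x" for x
  proof -
    have "A (B x) - P (Q x) = (A (Q x) - P (Q x)) + A (B x - Q x)"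
      by (simp add: bounded_op_diff[OF bA])
    also have "norm \<dots> \<le> d * ((N + 1) * norm x) + M * (d * norm x)"
    proof (rule norm_triangle_mono)
      show "norm (A (Q x) - P (Q x)) \<le> d * ((N + 1) * norm x)"
        using P(3)[of "Q x"] poly_op_contraction[OF Q(1) q, of x] d
        by (meson dual_order.trans less_imp_le mult_left_mono)
      show "norm (A (B x - Q x)) \<le> M * (d * norm x)"
        using cfc_rel_contraction[OF assms(1) M(2), of "B x - Q x"] Q(3)[of x] M(1)
        by (meson dual_order.trans mult_left_mono)
    qed
    also have "\<dots> = (d * (N + 1) + M * d) * norm x" by (simp add: algebra_simps)
    also have "\<dots> \<le> e * norm x" using bd by (rule mult_right_mono) simp
    finally show ?thesis .
  qed
  ultimately show "\<exists>p B'. poly_op p B' \<and> (\<forall>z. cmod z = 1 \<longrightarrow> cmod (f z * g z - p z) \<le> e) \<and>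
      (\<forall>x. norm (A (B x) - B' x) \<le> e * norm x)"
    using poly_op.mult[OF P(1) Q(1)] by blast
qed

lemma cfc_rel_const: "cfc_rel (\<lambda>z. c) (\<lambda>x. c *\<^sub>C x)"
  by (rule cfc_rel_poly, rule poly_op.const)

lemma cfc_rel_unique:
  assumes "cfc_rel f A" "cfc_rel f B" shows "A = B"
proof
  fix x
  have "cfc_rel (\<lambda>z. f z + (-1) * f z) (\<lambda>x. A x + (-1) *\<^sub>C B x)"
    by (intro cfc_rel_add cfc_rel_mult[OF cfc_rel_const assms(2)] assms)
  from cfc_rel_contraction[OF this, of 0 x] show "A x = B x"
    by (simp add: scaleC_minus_one)
qed

text \<open>
  Contractivity makes the operators a Cauchy sequence in norm; completeness of the space gives the
  pointwise limits.
\<close>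

lemma cfc_rel_lim:
  assumes A: "\<And>n. cfc_rel (f n) (A n)"
    and lim: "\<And>n z. cmod z = 1 \<Longrightarrow> cmod (g z - f n z) \<le> inverse (real (Suc n))"
  shows "\<exists>B. cfc_rel g B"
proof -
  have b: "bounded_op (A n)" for n by (rule cfc_rel_bounded[OF A])
  have dist: "norm (A m x - A n x) \<le> (inverse (real (Suc m)) + inverse (real (Suc n))) * norm x" for m n x
  proof -
    have r: "cfc_rel (\<lambda>z. f m z + (-1) * f n z) (\<lambda>x. A m x + (-1) *\<^sub>C A n x)"
      by (intro cfc_rel_add cfc_rel_mult[OF cfc_rel_const A] A)
    have "cmod (f m z + (-1) * f n z) \<le> inverse (real (Suc m)) + inverse (real (Suc n))"
      if "cmod z = 1" for z
      using norm_triangle_ineq4[of "g z - f n z" "g z - f m z"] lim[OF that, of m] lim[OF that, of n]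
      by simp
    from cfc_rel_contraction[OF r this] show ?thesis by (simp add: scaleC_minus_one)
  qed
  have "Cauchy (\<lambda>n. A n x)" for x
  proof (rule metric_CauchyI)
    fix e :: real assume e: "e > 0"
    obtain d where d: "d > 0" "d * (2 * norm x) < e"
      by (rule small_multiple[of "2 * norm x" e]) (use e in auto)
    obtain N where N: "inverse (real (Suc N)) < d"
      using reals_Archimedean[OF d(1)] by blast
    have "dist (A m x) (A n x) < e" if "m \<ge> N" "n \<ge> N" for m n
    proof -
      have "inverse (real (Suc m)) \<le> inverse (real (Suc N))" "inverse (real (Suc n)) \<le> inverse (real (Suc N))"
        using that by auto
      then have "norm (A m x - A n x) \<le> (2 * d) * norm x"
        using N by (intro order_trans[OF dist] mult_right_mono) (linarith | simp)+
      also have "\<dots> < e" using d by simp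
      finally show ?thesis by (simp add: dist_norm)
    qed
    then show "\<exists>M. \<forall>m\<ge>M. \<forall>n\<ge>M. dist (A m x) (A n x) < e" by blast
  qed
  then have conv: "convergent (\<lambda>n. A n x)" for x by (rule Cauchy_convergent)
  define B where "B x = lim (\<lambda>n. A n x)" for x
  have B: "(\<lambda>n. A n x) \<longlonglongrightarrow> B x" for x
    using conv by (simp add: B_def convergent_LIMSEQ_iff)
  have lim0: "(\<lambda>n. inverse (real (Suc n))) \<longlonglongrightarrow> 0"
    by (rule LIMSEQ_inverse_real_of_nat)
  have near: "norm (B x - A n x) \<le> inverse (real (Suc n)) * norm x" for n x
  proof (rule LIMSEQ_le)
    show "(\<lambda>m. norm (A m x - A n x)) \<longlonglongrightarrow> norm (B x - A n x)"
      by (intro tendsto_intros B)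
    show "(\<lambda>m. (inverse (real (Suc m)) + inverse (real (Suc n))) * norm x)
        \<longlonglongrightarrow> inverse (real (Suc n)) * norm x"
      using tendsto_mult_right[OF tendsto_add[OF lim0 tendsto_const], of "inverse (real (Suc n))" "norm x"]
      by simp
  qed (use dist in blast)
  obtain K where K: "\<And>x. norm (A 0 x) \<le> K * norm x"
    by (rule bounded_op_bound[OF b[of 0]]) (rule that)
  have bB: "bounded_op B"
  proof (rule bounded_opI)
    show "B (x + y) = B x + B y" for x y
      by (rule LIMSEQ_unique[OF B]) (simp add: bounded_op_add[OF b] tendsto_add B)
    show "B (c *\<^sub>C x) = c *\<^sub>C B x" for c x
      by (rule LIMSEQ_unique[OF B]) (simp add: bounded_op_scaleC[OF b] tendsto_scaleC B)
    show "norm (B x) \<le> (1 + K) * norm x" for x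
      using norm_triangle_ineq[of "B x - A 0 x" "A 0 x"] near[of x 0] K[of x]
      by (simp add: algebra_simps)
  qed
  have "cfc_rel g B"
    unfolding cfc_rel_def
  proof (intro conjI allI impI bB)
    fix e :: real assume e: "e > 0"
    then have e2: "e / 2 > 0" by simp
    obtain n where n: "inverse (real (Suc n)) < e / 2" using reals_Archimedean[OF e2] by blast
    obtain p P where P: "poly_op p P" "\<And>z. cmod z = 1 \<Longrightarrow> cmod (f n z - p z) \<le> e/2"
      "\<And>x. norm (A n x - P x) \<le> e/2 * norm x" by (rule cfc_relD[OF A e2]) (rule that)
    have "cmod (g z - p z) \<le> e" if "cmod z = 1" for z
      using norm_triangle_ineq[of "g z - f n z" "f n z - p z"] lim[OF that, of n] P(2)[OF that] n
      by simp
    moreover have "norm (B x - P x) \<le> e * norm x" for x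
    proof -
      have "norm (B x - P x) \<le> inverse (real (Suc n)) * norm x + e/2 * norm x"
        using norm_triangle_ineq[of "B x - A n x" "A n x - P x"] near[of x n] P(3)[of x] by simp
      also have "\<dots> \<le> e/2 * norm x + e/2 * norm x"
        using n by (intro add_right_mono mult_right_mono) auto
      finally show ?thesis by simp
    qed
    ultimately show "\<exists>p B'. poly_op p B' \<and> (\<forall>z. cmod z = 1 \<longrightarrow> cmod (g z - p z) \<le> e) \<and>
      (\<forall>x. norm (B x - B' x) \<le> e * norm x)"
      using P(1) by blast
  qed
  then show ?thesis by blast
qed

text \<open>
  A real-linear functional on \<open>\<complex>\<close> is a combination of \<open>z\<close> and \<open>cnj z\<close>, so polynomials in the real
  coordinates of \<open>z\<close>, to which the Stone--Weierstrass theorem applies, are covered.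
\<close>

lemma real_polynomial_poly_op:
  "real_polynomial_function r \<Longrightarrow> \<exists>A. poly_op (\<lambda>z. complex_of_real (r z)) A"
proof (induction rule: real_polynomial_function.induct)
  case (linear h)
  define c d where "c = (complex_of_real (h 1) - \<i> * complex_of_real (h \<i>)) / 2"
    and "d = (complex_of_real (h 1) + \<i> * complex_of_real (h \<i>)) / 2"
  have "complex_of_real (h z) = c * z + d * cnj z" for z
  proof -
    interpret bounded_linear h by fact
    have "h z = h (Re z *\<^sub>R 1 + Im z *\<^sub>R \<i>)"
      by (rule arg_cong[where f=h]) (simp add: complex_eq_iff)
    also have "\<dots> = Re z * h 1 + Im z * h \<i>" by (simp add: add scaleR)
    finally show ?thesis by (simp add: c_def d_def complex_eq_iff field_simps)
  qed
  then have "(\<lambda>z. complex_of_real (h z)) = (\<lambda>z. c * z + d * cnj z)" by (rule ext)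
  then show ?case
    using poly_op.add[OF poly_op.mult[OF poly_op.const[of c] poly_op.gen]
        poly_op.mult[OF poly_op.const[of d] poly_op.gen_adj]] by (simp only:) (rule exI)
next
  case (const c)
  show ?case by (rule exI, rule poly_op.const)
next
  case (add f g)
  then obtain A B where "poly_op (\<lambda>z. complex_of_real (f z)) A" "poly_op (\<lambda>z. complex_of_real (g z)) B"
    by (elim exE)
  from poly_op.add[OF this] show ?case by (simp only: of_real_add) (rule exI)
next
  case (mult f g)
  then obtain A B where "poly_op (\<lambda>z. complex_of_real (f z)) A" "poly_op (\<lambda>z. complex_of_real (g z)) B"
    by (elim exE)
  from poly_op.mult[OF this] show ?case by (simp only: of_real_mult) (rule exI)
qed

lemma cfc_rel_real_exists:
  fixes h :: "complex \<Rightarrow> real"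
  assumes h: "continuous_on (sphere 0 1) h"
  shows "\<exists>A. cfc_rel (\<lambda>z. complex_of_real (h z)) A"
proof -
  have "\<exists>r. real_polynomial_function r \<and> (\<forall>z. cmod z = 1 \<longrightarrow> \<bar>h z - r z\<bar> < inverse (real (Suc n)))" for n
    by (rule Stone_Weierstrass_real_polynomial_function[OF compact_sphere h, of "inverse (real (Suc n))"])
      auto
  then obtain r where r: "\<And>n. real_polynomial_function (r n)"
    "\<And>n z. cmod z = 1 \<Longrightarrow> \<bar>h z - r n z\<bar> < inverse (real (Suc n))"
    by metis
  have "\<exists>A. \<forall>n. poly_op (\<lambda>z. complex_of_real (r n z)) (A n)"
    by (rule choice) (use real_polynomial_poly_op[OF r(1)] in blast)
  then obtain A where "\<And>n. poly_op (\<lambda>z. complex_of_real (r n z)) (A n)"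
    by blast
  then show ?thesis
  proof (intro cfc_rel_lim[of "\<lambda>n z. complex_of_real (r n z)" A])
    fix n and z :: complex assume "cmod z = 1"
    from r(2)[OF this, of n]
    show "cmod (complex_of_real (h z) - complex_of_real (r n z)) \<le> inverse (real (Suc n))"
      by (metis less_imp_le norm_of_real of_real_diff)
  qed (rule cfc_rel_poly)
qed

lemma cfc_rel_exists:
  assumes "continuous_on (sphere 0 1) f"
  shows "\<exists>A. cfc_rel f A"
proof -
  have "continuous_on (sphere 0 1) (\<lambda>z. Re (f z))" "continuous_on (sphere 0 1) (\<lambda>z. Im (f z))"
    using assms by (auto intro: continuous_intros)
  from cfc_rel_real_exists[OF this(1)] cfc_rel_real_exists[OF this(2)]
  obtain A B where "cfc_rel (\<lambda>z. complex_of_real (Re (f z))) A"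
    and "cfc_rel (\<lambda>z. complex_of_real (Im (f z))) B"
    by (elim exE)
  then have "cfc_rel (\<lambda>z. complex_of_real (Re (f z)) + \<i> * complex_of_real (Im (f z))) (\<lambda>x. A x + \<i> *\<^sub>C B x)"
    by (intro cfc_rel_add cfc_rel_mult[OF cfc_rel_const])
  moreover have "(\<lambda>z. complex_of_real (Re (f z)) + \<i> * complex_of_real (Im (f z))) = f"
    by (rule ext) (simp add: complex_eq_iff)
  ultimately show ?thesis by (intro exI) (simp only:)
qed

lemma cfc_rel_adjoint:
  assumes A: "cfc_rel f A" and B: "cfc_rel (\<lambda>z. cnj (f z)) B"
  shows "is_adjoint A B"
  unfolding is_adjoint_def
proof safe
  fix x y
  have "cmod (cinner (A x) y - cinner x (B y)) \<le> e" if e: "e > 0" for e :: real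
  proof -
    obtain d where d: "d > 0" "d * (2 * (norm x * norm y)) < e"
      by (rule small_multiple[of "2 * (norm x * norm y)" e]) (use e in auto)
    obtain p P where P: "poly_op p P" "\<And>z. cmod z = 1 \<Longrightarrow> cmod (f z - p z) \<le> d"
      "\<And>x. norm (A x - P x) \<le> d * norm x" by (rule cfc_relD[OF A d(1)]) (rule that)
    obtain Q where Q: "poly_op (\<lambda>z. cnj (p z)) Q" "is_adjoint P Q"
      using poly_op_adjoint[OF P(1)] by (elim exE conjE)
    have r: "cfc_rel (\<lambda>z. cnj (p z) + (-1) * cnj (f z)) (\<lambda>x. Q x + (-1) *\<^sub>C B x)"
      by (rule cfc_rel_add[OF cfc_rel_poly[OF Q(1)] cfc_rel_mult[OF cfc_rel_const B]])
    have "cmod (cnj (p z) + (-1) * cnj (f z)) \<le> d" if "cmod z = 1" for z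
    proof -
      have "cnj (p z) + (-1) * cnj (f z) = cnj (p z - f z)" by simp
      then show ?thesis using P(2)[OF that] by (simp only: complex_mod_cnj norm_minus_commute)
    qed
    from cfc_rel_contraction[OF r this] have Q3: "norm (Q y - B y) \<le> d * norm y"
      by (simp add: scaleC_minus_one)
    have "cinner (A x) y - cinner x (B y) = cinner (A x - P x) y + cinner x (Q y - B y)"
      using Q(2)[unfolded is_adjoint_def, rule_format, of x y] by (simp add: cinner_diff_left cinner_diff_right)
    also have "cmod \<dots> \<le> norm (A x - P x) * norm y + norm x * norm (Q y - B y)"
      by (rule norm_triangle_mono) (rule cinner_Cauchy_Schwarz)+
    also have "\<dots> \<le> (d * norm x) * norm y + norm x * (d * norm y)"
      by (rule add_mono, rule mult_right_mono, rule P(3), simp, rule mult_left_mono, rule Q3, simp)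
    also have "\<dots> \<le> e" using d by (simp add: algebra_simps)
    finally show "cmod (cinner (A x) y - cinner x (B y)) \<le> e" .
  qed
  then have "cmod (cinner (A x) y - cinner x (B y)) \<le> 0"
    by (rule field_le_epsilon) (simp only: add_0)
  then show "cinner (A x) y = cinner x (B y)" by simp
qed

definition cfc :: "(complex \<Rightarrow> complex) \<Rightarrow> 'a \<Rightarrow> 'a" where
  "cfc f = (THE A. cfc_rel f A)"

lemma cfc_eqI: "cfc_rel f A \<Longrightarrow> cfc f = A"
  unfolding cfc_def by (rule the_equality) (simp_all add: cfc_rel_unique)

lemma cfc_rel_cfc:
  assumes "continuous_on (sphere 0 1) f" shows "cfc_rel f (cfc f)"
proof -
  obtain A where "cfc_rel f A" using cfc_rel_exists[OF assms] by (elim exE)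
  then show ?thesis by (simp only: cfc_eqI)
qed

text \<open>
  For \<open>z\<close> off the circle \<open>w \<mapsto> 1 / (1 + w - z)\<close> is continuous on \<open>|w| = 1\<close>, and the calculus turns it
  into the inverse.
\<close>

lemma op_spectrum_one_plus_subset: "op_spectrum (\<lambda>x. x + U x) \<subseteq> sphere 1 1"
proof
  fix z assume z: "z \<in> op_spectrum (\<lambda>x. x + U x)"
  show "z \<in> sphere 1 1"
  proof (rule ccontr)
    assume nsph: "z \<notin> sphere 1 1"
    have nz: "1 + w - z \<noteq> 0" if "cmod w = 1" for w
    proof
      assume "1 + w - z = 0"
      then have "z = 1 + w" by simp
      with that nsph show False by (simp add: dist_norm)
    qed
    define S where "S = cfc (\<lambda>w. 1 / (1 + w - z))"
    have S: "cfc_rel (\<lambda>w. 1 / (1 + w - z)) S"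
      unfolding S_def by (rule cfc_rel_cfc) (use nz in \<open>auto intro!: continuous_intros\<close>)
    have R: "cfc_rel (\<lambda>w. (1 - z) + w) (\<lambda>x. (1 - z) *\<^sub>C x + U x)"
      by (rule cfc_rel_add[OF cfc_rel_const cfc_rel_poly[OF poly_op.gen]])
    have one: "cfc_rel (\<lambda>w. 1) (\<lambda>x. 1 *\<^sub>C x)" by (rule cfc_rel_const)
    have SR: "cfc_rel (\<lambda>w. 1) (\<lambda>x. S ((1 - z) *\<^sub>C x + U x))"
      by (rule cfc_rel_cong[OF cfc_rel_mult[OF S R]]) (use nz in \<open>simp add: algebra_simps\<close>)
    have RS: "cfc_rel (\<lambda>w. 1) (\<lambda>x. (1 - z) *\<^sub>C S x + U (S x))"
      by (rule cfc_rel_cong[OF cfc_rel_mult[OF R S]]) (use nz in \<open>simp add: algebra_simps\<close>)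
    have "\<forall>x. S ((x + U x) - z *\<^sub>C x) = x" "\<forall>x. (S x + U (S x)) - z *\<^sub>C S x = x"
      using fun_cong[OF cfc_rel_unique[OF SR one]] fun_cong[OF cfc_rel_unique[OF RS one]]
      by (simp_all add: scaleC_diff_left algebra_simps)
    then have "z \<notin> op_spectrum (\<lambda>x. x + U x)"
      unfolding op_spectrum_def using cfc_rel_bounded[OF S] by blast
    with z show False by simp
  qed
qed

text \<open>
  The orbit of a wandering vector is orthogonal, so Pythagoras applies to its waves.
\<close>

lemma norm_wave_wandering:
  assumes e: "\<And>n. n \<ge> 1 \<Longrightarrow> cinner ((U ^^ n) e) e = 0" and w: "cmod w = 1"
  shows "(norm (wave w n e))\<^sup>2 = real n * (norm e)\<^sup>2"
proof -
  have UU: "cinner ((U ^^ k) x) ((U ^^ k) y) = cinner x y" for k x y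
    using adj by (induction k) (simp_all add: is_adjoint_def VU)
  have lt: "cinner ((U ^^ j) e) ((U ^^ k) e) = 0" if "k < j" for j k
  proof -
    have "(U ^^ j) e = (U ^^ k) ((U ^^ (j - k)) e)"
      using that by (metis add_diff_inverse_nat comp_apply funpow_add less_imp_not_less)
    then show ?thesis using that by (simp add: UU e)
  qed
  have ne: "cinner ((U ^^ j) e) ((U ^^ k) e) = (if j = k then cinner e e else 0)" for j k
    using lt[of j k] lt[of k j] cinner_commute[of "(U ^^ j) e" "(U ^^ k) e"] UU[of k e e]
    by (cases j k rule: linorder_cases) auto
  have "w * cnj w = 1" using w complex_norm_square[of w] by simp
  then have wk: "cnj w ^ j * w ^ j = 1" for j by (simp flip: power_mult_distrib add: mult.commute)
  have "complex_of_real ((norm (wave w n e))\<^sup>2) = cinner (wave w n e) (wave w n e)"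
    by (rule cinner_self[symmetric])
  also have "\<dots> = (\<Sum>j<n. \<Sum>k<n. if j = k then (cnj w ^ j * w ^ k) * cinner e e else 0)"
    unfolding wave_def by (simp only: cinner_sum_left, simp only: cinner_sum_right
       cinner_scaleC_left cinner_scaleC_right ne) (intro sum.cong refl, simp)
  also have "\<dots> = (\<Sum>j<n. (cnj w ^ j * w ^ j) * cinner e e)"
    by (intro sum.cong refl) simp
  also have "\<dots> = complex_of_real (real n * (norm e)\<^sup>2)"
    by (simp add: wk cinner_self)
  finally show ?thesis using of_real_eq_iff by blast
qed

text \<open>
  The waves of a wandering vector have unbounded norm, but \<open>U - w\<close> maps them to a bounded set. So
  \<open>U - w\<close> has no bounded inverse for any \<open>w\<close> on the circle.
\<close>

lemma op_spectrum_one_plus: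
  assumes e: "\<And>n. n \<ge> 1 \<Longrightarrow> cinner ((U ^^ n) e) e = 0" and e0: "e \<noteq> 0"
  shows "op_spectrum (\<lambda>x. x + U x) = sphere 1 1"
proof (rule antisym[OF op_spectrum_one_plus_subset], rule subsetI)
  fix z :: complex assume "z \<in> sphere 1 1"
  then have w: "cmod (z - 1) = 1" by (simp add: dist_norm norm_minus_commute)
  show "z \<in> op_spectrum (\<lambda>x. x + U x)"
  proof (rule ccontr)
    assume "z \<notin> op_spectrum (\<lambda>x. x + U x)"
    then obtain S where S: "bounded_op S" "\<And>x. S ((x + U x) - z *\<^sub>C x) = x"
      unfolding op_spectrum_def by auto
    obtain K where K: "K \<ge> 0" "\<And>x. norm (S x) \<le> K * norm x"
      by (rule bounded_op_bound[OF S(1)]) (rule that)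
    define B where "B = (2 * K)\<^sup>2"
    have le: "real n \<le> B" for n
    proof -
      let ?y = "wave (z - 1) n e"
      have eq: "(?y + U ?y) - z *\<^sub>C ?y = U ?y - (z - 1) *\<^sub>C ?y"
        by (simp add: scaleC_diff_left algebra_simps)
      then have "norm ?y = norm (S (U ?y - (z - 1) *\<^sub>C ?y))" using S(2)[of ?y] by (simp only: eq)
      also have "\<dots> \<le> K * norm (U ?y - (z - 1) *\<^sub>C ?y)" by (rule K(2))
      also have "\<dots> \<le> K * (2 * norm e)" by (rule mult_left_mono[OF norm_U_wave[OF w] K(1)])
      finally have "(norm ?y)\<^sup>2 \<le> (K * (2 * norm e))\<^sup>2" by (rule power_mono) simp
      then have "real n * (norm e)\<^sup>2 \<le> B * (norm e)\<^sup>2"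
        by (simp add: norm_wave_wandering[OF e w] B_def power_mult_distrib)
      then show ?thesis using e0 by simp
    qed
    obtain n where "B < real n" using reals_Archimedean2 by blast
    with le[of n] show False by simp
  qed
qed

lemma is_cfc_one_plus:
  assumes spec: "op_spectrum (\<lambda>x. x + U x) = sphere 1 1"
  shows "is_cfc (\<lambda>x. x + U x) (\<lambda>f. cfc (\<lambda>w. f (1 + w)))"
proof -
  have rel: "cfc_rel (\<lambda>w. f (1 + w)) (cfc (\<lambda>w. f (1 + w)))" if "continuous_on (sphere 1 1) f" for f
  proof (rule cfc_rel_cfc)
    have "(\<lambda>w. 1 + w) ` sphere 0 1 \<subseteq> sphere (1::complex) 1" by (auto simp: dist_norm)
    then show "continuous_on (sphere 0 1) (\<lambda>w. f (1 + w))"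
      by (intro continuous_on_compose2[OF that]) (auto intro!: continuous_intros)
  qed
  have s: "1 + w \<in> sphere 1 1" if "cmod w = 1" for w :: complex using that by (simp add: dist_norm)
  show ?thesis
    unfolding is_cfc_def Let_def spec mem_Collect_eq Ball_def
  proof (intro conjI allI impI)
    fix f g :: "complex \<Rightarrow> complex" and c
    assume f: "continuous_on (sphere 1 1) f"
    note rf = rel[OF f]
    show "bounded_op (cfc (\<lambda>w. f (1 + w)))" by (rule cfc_rel_bounded[OF rf])
    show "cfc (\<lambda>w. c * f (1 + w)) = (\<lambda>x. c *\<^sub>C cfc (\<lambda>w. f (1 + w)) x)"
      by (rule cfc_eqI[OF cfc_rel_mult[OF cfc_rel_const rf]])
    have "continuous_on (sphere 1 1) (\<lambda>z. cnj (f z))" using f by (intro continuous_intros)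
    from rel[OF this] show "is_adjoint (cfc (\<lambda>w. f (1 + w))) (cfc (\<lambda>w. cnj (f (1 + w))))"
      by (rule cfc_rel_adjoint[OF rf])
    assume g: "continuous_on (sphere 1 1) g"
    note rg = rel[OF g]
    show "cfc (\<lambda>w. f (1 + w) + g (1 + w)) = (\<lambda>x. cfc (\<lambda>w. f (1 + w)) x + cfc (\<lambda>w. g (1 + w)) x)"
      by (rule cfc_eqI[OF cfc_rel_add[OF rf rg]])
    show "cfc (\<lambda>w. f (1 + w) * g (1 + w)) = cfc (\<lambda>w. f (1 + w)) \<circ> cfc (\<lambda>w. g (1 + w))"
      unfolding comp_def by (rule cfc_eqI[OF cfc_rel_mult[OF rf rg]])
    assume eq: "\<forall>z. z \<in> sphere 1 1 \<longrightarrow> f z = g z"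
    show "cfc (\<lambda>w. f (1 + w)) = cfc (\<lambda>w. g (1 + w))"
      by (rule cfc_rel_unique[OF cfc_rel_cong[OF rf] rg]) (simp only: s eq)
  next
    show "cfc (\<lambda>w. 1) = id" using cfc_eqI[OF cfc_rel_const[of 1]] by (simp add: id_def)
    show "cfc (\<lambda>w. 1 + w) = (\<lambda>x. x + U x)"
      using cfc_eqI[OF cfc_rel_add[OF cfc_rel_const[of 1] cfc_rel_poly[OF poly_op.gen]]] by simp
  qed
qed

end

section \<open>Uniqueness of the calculus and power series\<close>

lemma
  assumes "is_cfc T \<Phi>"
  shows is_cfc_add: "continuous_on (op_spectrum T) f \<Longrightarrow> continuous_on (op_spectrum T) g \<Longrightarrow>
      \<Phi> (\<lambda>z. f z + g z) = (\<lambda>x. \<Phi> f x + \<Phi> g x)"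
    and is_cfc_mult: "continuous_on (op_spectrum T) f \<Longrightarrow> continuous_on (op_spectrum T) g \<Longrightarrow>
      \<Phi> (\<lambda>z. f z * g z) = \<Phi> f \<circ> \<Phi> g"
    and is_cfc_scale: "continuous_on (op_spectrum T) f \<Longrightarrow> \<Phi> (\<lambda>z. c * f z) = (\<lambda>x. c *\<^sub>C \<Phi> f x)"
    and is_cfc_adjoint: "continuous_on (op_spectrum T) f \<Longrightarrow> is_adjoint (\<Phi> f) (\<Phi> (\<lambda>z. cnj (f z)))"
    and is_cfc_cong: "continuous_on (op_spectrum T) f \<Longrightarrow> continuous_on (op_spectrum T) g \<Longrightarrow>
      (\<forall>z. z \<in> op_spectrum T \<longrightarrow> f z = g z) \<Longrightarrow> \<Phi> f = \<Phi> g"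
    and is_cfc_one: "\<Phi> (\<lambda>z. 1) = id"
    and is_cfc_id: "\<Phi> (\<lambda>z. z) = T"
  using assms unfolding is_cfc_def Let_def mem_Collect_eq Ball_def by blast+

text \<open>
  The function \<open>g = (M\<^sup>2 - |f|\<^sup>2)\<^sup>1\<^sup>/\<^sup>2\<close> is continuous and real, so that
  \<open>M\<^sup>2 |x|\<^sup>2 - |\<Phi> f x|\<^sup>2 = |\<Phi> g x|\<^sup>2\<close>. Applied to an arbitrary calculus, this is what makes the value of
  the power independent of the choice of \<open>\<Phi>\<close>.
\<close>

lemma is_cfc_contraction:
  assumes \<Phi>: "is_cfc T \<Phi>" and f: "continuous_on (op_spectrum T) f"
    and M: "\<And>z. z \<in> op_spectrum T \<Longrightarrow> cmod (f z) \<le> M" "M \<ge> 0"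
  shows "norm (\<Phi> f x) \<le> M * norm x"
proof -
  define \<sigma> where "\<sigma> = op_spectrum T"
  \<comment> \<open>The radicand is nonnegative on the spectrum, where the identity for \<open>g\<close> is used.\<close>
  define g where "g z = complex_of_real (sqrt (M\<^sup>2 - (cmod (f z))\<^sup>2))" for z
  have f: "continuous_on \<sigma> f" using f by (simp add: \<sigma>_def)
  then have cf: "continuous_on \<sigma> (\<lambda>z. cnj (f z))" by (intro continuous_intros)
  have g: "continuous_on \<sigma> g" unfolding g_def using f by (intro continuous_intros)
  have ff: "continuous_on \<sigma> (\<lambda>z. cnj (f z) * f z)" using f by (intro continuous_intros)
  have gg: "continuous_on \<sigma> (\<lambda>z. g z * g z)" using g by (intro continuous_intros)
  have one: "continuous_on \<sigma> (\<lambda>z. 1 :: complex)" "continuous_on \<sigma> (\<lambda>z. complex_of_real (M\<^sup>2) * 1)"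
    by (intro continuous_intros)+
  note \<Phi>add = is_cfc_add[OF \<Phi>, folded \<sigma>_def] and \<Phi>mult = is_cfc_mult[OF \<Phi>, folded \<sigma>_def]
    and \<Phi>scale = is_cfc_scale[OF \<Phi>, folded \<sigma>_def] and \<Phi>1 = is_cfc_one[OF \<Phi>]
    and \<Phi>adj = is_cfc_adjoint[OF \<Phi>, folded \<sigma>_def] and \<Phi>cong = is_cfc_cong[OF \<Phi>, folded \<sigma>_def]
  have "\<Phi> (\<lambda>z. cnj (f z) * f z + g z * g z) = \<Phi> (\<lambda>z. complex_of_real (M\<^sup>2) * 1)"
  proof (rule \<Phi>cong[OF continuous_on_add[OF ff gg] one(2)], intro allI impI)
    fix z assume z: "z \<in> \<sigma>"
    then have "(cmod (f z))\<^sup>2 \<le> M\<^sup>2" using M(1)[of z] by (simp add: \<sigma>_def power_mono)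
    then have "g z * g z = complex_of_real (M\<^sup>2 - (cmod (f z))\<^sup>2)"
      unfolding g_def of_real_mult[symmetric] by simp
    moreover have "cnj (f z) * f z = complex_of_real ((cmod (f z))\<^sup>2)"
      by (simp only: complex_norm_square mult.commute)
    ultimately show "cnj (f z) * f z + g z * g z = complex_of_real (M\<^sup>2) * 1"
      by simp
  qed
  then have sum: "\<Phi> (\<lambda>z. cnj (f z)) (\<Phi> f x) + \<Phi> g (\<Phi> g x) = complex_of_real (M\<^sup>2) *\<^sub>C x"
    unfolding \<Phi>add[OF ff gg] \<Phi>mult[OF cf f] \<Phi>mult[OF g g] \<Phi>scale[OF one(1)] \<Phi>1
    by (simp add: fun_eq_iff)
  have "(\<lambda>z. cnj (g z)) = g" by (simp add: g_def fun_eq_iff)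
  with \<Phi>adj[OF g] have gadj: "is_adjoint (\<Phi> g) (\<Phi> g)" by simp
  have "cinner (\<Phi> f x) (\<Phi> f x) + cinner (\<Phi> g x) (\<Phi> g x)
      = cinner x (\<Phi> (\<lambda>z. cnj (f z)) (\<Phi> f x) + \<Phi> g (\<Phi> g x))"
    using \<Phi>adj[OF f] gadj by (simp add: is_adjoint_def cinner_add_right)
  also have "\<dots> = complex_of_real (M\<^sup>2) * cinner x x"
    by (simp only: sum cinner_scaleC_right complex_cnj_complex_of_real)
  finally have "complex_of_real ((norm (\<Phi> f x))\<^sup>2 + (norm (\<Phi> g x))\<^sup>2) = complex_of_real (M\<^sup>2 * (norm x)\<^sup>2)"
    by (simp only: cinner_self of_real_add of_real_mult)
  then have "(norm (\<Phi> f x))\<^sup>2 + (norm (\<Phi> g x))\<^sup>2 = M\<^sup>2 * (norm x)\<^sup>2" using of_real_eq_iff by blast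
  then have "(norm (\<Phi> f x))\<^sup>2 \<le> M\<^sup>2 * (norm x)\<^sup>2"
    using zero_le_power2[of "norm (\<Phi> g x)"] by linarith
  then have "(norm (\<Phi> f x))\<^sup>2 \<le> (M * norm x)\<^sup>2" by (simp only: power_mult_distrib)
  then show ?thesis using M(2) by (simp add: power2_le_iff_abs_le)
qed

text \<open>
  On the partial sums, polynomials in \<open>z - 1\<close>, every calculus takes the same value; the tails are uniformly
  small.
\<close>

lemma is_cfc_power_sums:
  fixes U :: "'a::complex_inner \<Rightarrow> 'a"
  assumes \<Phi>: "is_cfc (\<lambda>x. x + U x) \<Phi>" and f: "continuous_on (op_spectrum (\<lambda>x. x + U x)) f"
    and a: "summable (\<lambda>n. cmod (a n))"
    and sp: "\<And>z. z \<in> op_spectrum (\<lambda>x. x + U x) \<Longrightarrow> cmod (z - 1) \<le> 1"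
    and sums: "\<And>z. z \<in> op_spectrum (\<lambda>x. x + U x) \<Longrightarrow> (\<lambda>n. a n * (z - 1) ^ n) sums f z"
  shows "(\<lambda>n. a n *\<^sub>C (U ^^ n) x) sums \<Phi> f x"
proof -
  define \<sigma> where "\<sigma> = op_spectrum (\<lambda>x. x + U x)"
  note \<Phi>add = is_cfc_add[OF \<Phi>, folded \<sigma>_def] and \<Phi>mult = is_cfc_mult[OF \<Phi>, folded \<sigma>_def]
    and \<Phi>scale = is_cfc_scale[OF \<Phi>, folded \<sigma>_def] and \<Phi>1 = is_cfc_one[OF \<Phi>]
    and \<Phi>z = is_cfc_id[OF \<Phi>]
  have con: "continuous_on \<sigma> (\<lambda>z. 1 :: complex)" "continuous_on \<sigma> (\<lambda>z. z)"
    "continuous_on \<sigma> (\<lambda>z. (-1) * 1 :: complex)" "continuous_on \<sigma> (\<lambda>z. z - 1)"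
    "\<And>n. continuous_on \<sigma> (\<lambda>z. (z - 1) ^ n)" "\<And>n. continuous_on \<sigma> (\<lambda>z. a n * (z - 1) ^ n)"
    "\<And>n. continuous_on \<sigma> (\<lambda>z. \<Sum>k<n. a k * (z - 1) ^ k)"
    by (intro continuous_intros)+
  have U: "\<Phi> (\<lambda>z. z - 1) = U"
    using \<Phi>add[OF con(2,3)] \<Phi>scale[OF con(1), of "-1"] \<Phi>1 \<Phi>z
    by (simp add: fun_eq_iff scaleC_minus_one)
  have Un: "\<Phi> (\<lambda>z. (z - 1) ^ n) = U ^^ n" for n
  proof (induction n)
    case 0 then show ?case using \<Phi>1 by (simp add: id_def)
  next
    case (Suc n)
    then show ?case using \<Phi>mult[OF con(4) con(5)[of n]] U by simp
  qed
  have P: "\<Phi> (\<lambda>z. \<Sum>k<n. a k * (z - 1) ^ k) = (\<lambda>x. \<Sum>k<n. a k *\<^sub>C (U ^^ k) x)" for n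
  proof (induction n)
    case 0 
    then show ?case using \<Phi>scale[OF con(1), of 0] by simp
  next
    case (Suc n)
    show ?case using \<Phi>add[OF con(7)[of n] con(6)[of n]] \<Phi>scale[OF con(5)[of n], of "a n"] Suc Un
      by simp
  qed
  define r where "r n = (\<Sum>k. cmod (a (k + n)))" for n
  have r: "r \<longlonglongrightarrow> 0"
    unfolding r_def by (rule suminf_exist_split2[OF a])
  have near: "norm (\<Phi> f x - (\<Sum>k<n. a k *\<^sub>C (U ^^ k) x)) \<le> r n * norm x" for n
  proof -
    have fc: "continuous_on \<sigma> f" using f by (simp add: \<sigma>_def)
    have scon: "continuous_on \<sigma> (\<lambda>z. (-1) * (\<Sum>k<n. a k * (z - 1) ^ k))"
      by (intro continuous_intros)
    have dcon: "continuous_on \<sigma> (\<lambda>z. f z + (-1) * (\<Sum>k<n. a k * (z - 1) ^ k))"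
      by (rule continuous_on_add[OF fc scon])
    have sa: "summable (\<lambda>k. cmod (a (k + n)))" 
      using a summable_iff_shift[of "\<lambda>k. cmod (a k)" n] by simp
    have "norm (\<Phi> (\<lambda>z. f z + (-1) * (\<Sum>k<n. a k * (z - 1) ^ k)) x) \<le> r n * norm x"
    proof (rule is_cfc_contraction[OF \<Phi> dcon[unfolded \<sigma>_def]])
      show "0 \<le> r n" unfolding r_def by (rule suminf_nonneg[OF sa]) simp
      fix z assume z: "z \<in> op_spectrum (\<lambda>x. x + U x)"
      have le: "norm (a (k + n) * (z - 1) ^ (k + n)) \<le> cmod (a (k + n))" for k
        using sp[OF z] by (simp add: norm_mult norm_power mult_left_le power_le_one)
      have "f z - (\<Sum>k<n. a k * (z - 1) ^ k) = (\<Sum>k. a (k + n) * (z - 1) ^ (k + n))"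
        using sums[OF z] by (subst suminf_minus_initial_segment) (auto simp: sums_iff)
      also have "cmod \<dots> \<le> r n"
        unfolding r_def by (rule norm_suminf_le[OF le sa])
      finally show "cmod (f z + (-1) * (\<Sum>k<n. a k * (z - 1) ^ k)) \<le> r n" by simp
    qed
    then show ?thesis
      unfolding \<Phi>add[OF fc scon] \<Phi>scale[OF con(7)] P by (simp add: scaleC_minus_one)
  qed
  have "(\<lambda>n. r n * norm x) \<longlonglongrightarrow> 0" using tendsto_mult_right[OF r, of "norm x"] by simp
  then have "(\<lambda>n. \<Phi> f x - (\<Sum>k<n. a k *\<^sub>C (U ^^ k) x)) \<longlonglongrightarrow> 0"
    by (rule Lim_null_comparison[rotated]) (use near in simp)
  then have "(\<lambda>n. \<Sum>k<n. a k *\<^sub>C (U ^^ k) x) \<longlonglongrightarrow> \<Phi> f x"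
    using tendsto_diff[OF tendsto_const[of "\<Phi> f x"]] by fastforce
  then show ?thesis by (simp add: sums_def)
qed

section \<open>The binomial series on the closed unit disc\<close>

text \<open>
  The coefficients are bounded by a multiple of \<open>n\<close> to the power \<open>- Re \<alpha> - 1\<close>, by Gauss's product for \<open>\<Gamma>\<close>.
\<close>

lemma summable_norm_gbinomial:
  fixes \<alpha> :: complex
  assumes "Re \<alpha> > 0"
  shows "summable (\<lambda>n. cmod (\<alpha> gchoose n))"
proof -
  have "Bseq (\<lambda>n. (\<alpha> gchoose n) / ((-1)^n / exp ((\<alpha>+1) * of_real (ln (real n)))))"
    by (rule convergent_imp_Bseq, rule convergentI, rule gbinomial_asymptotic)
  then obtain B where B: "\<And>n. cmod ((\<alpha> gchoose n) / ((-1)^n / exp ((\<alpha>+1) * of_real (ln (real n))))) \<le> B"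
    unfolding Bseq_def by blast
  show ?thesis
  proof (rule summable_comparison_test')
    show "summable (\<lambda>n. B * real n powr (- Re \<alpha> - 1))"
      using assms by (intro summable_mult) (simp add: summable_real_powr_iff)
    fix n :: nat assume n: "n \<ge> 1"
    have "cmod (\<alpha> gchoose n) * real n powr (Re \<alpha> + 1) \<le> B"
      using B[of n] n by (simp add: norm_mult norm_divide norm_power powr_def algebra_simps)
    then have "cmod (\<alpha> gchoose n) \<le> B / real n powr (Re \<alpha> + 1)"
      using n by (simp add: pos_le_divide_eq)
    also have "\<dots> = B * real n powr (- Re \<alpha> - 1)"
      using powr_minus[of "real n" "Re \<alpha> + 1"] by (simp add: divide_inverse)
    finally show "norm (cmod (\<alpha> gchoose n)) \<le> B * real n powr (- Re \<alpha> - 1)" by simp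
  qed
qed

text \<open>
  Both sides are continuous on the closed disc, at \<open>z = -1\<close> because \<open>Re \<alpha> > 0\<close>, and they agree on
  the open disc.
\<close>

lemma binomial_series_closed_disc:
  fixes \<alpha> z :: complex
  assumes \<alpha>: "Re \<alpha> > 0" and z: "cmod z \<le> 1"
  shows "(\<lambda>n. (\<alpha> gchoose n) * z ^ n) sums (1 + z) powr \<alpha>"
proof -
  have sm: "summable (\<lambda>n. (\<alpha> gchoose n) * w ^ n)" if "cmod w \<le> 1" for w
  proof (rule summable_comparison_test'[OF summable_norm_gbinomial[OF \<alpha>]])
    show "norm ((\<alpha> gchoose n) * w ^ n) \<le> cmod (\<alpha> gchoose n)" for n
      using that by (simp add: norm_mult norm_power mult_left_le power_le_one)
  qed
  have ul: "uniform_limit (cball 0 1) (\<lambda>n w. \<Sum>k<n. (\<alpha> gchoose k) * w ^ k) (\<lambda>w. \<Sum>k. (\<alpha> gchoose k) * w ^ k) sequentially"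
    by (rule Weierstrass_m_test[OF _ summable_norm_gbinomial[OF \<alpha>]])
      (simp add: norm_mult norm_power mult_left_le power_le_one)
  have c1: "continuous_on (cball 0 1) (\<lambda>w. \<Sum>k. (\<alpha> gchoose k) * w ^ k)"
    by (rule uniform_limit_theorem[OF always_eventually ul]) (auto intro!: continuous_intros)
  have c2: "continuous_on (cball 0 1) (\<lambda>w. (1 + w) powr \<alpha>)"
  proof (rule continuous_on_powr_complex[of _ "\<lambda>w. 1 + w" "\<lambda>_. \<alpha>"])
    show "cball 0 1 \<subseteq> {z. 0 \<le> Re (1 + z) \<or> Im (1 + z) \<noteq> 0}"
    proof
      fix w :: complex assume "w \<in> cball 0 1"
      then have "\<bar>Re w\<bar> \<le> 1" using abs_Re_le_cmod[of w] by simp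
      then show "w \<in> {z. 0 \<le> Re (1 + z) \<or> Im (1 + z) \<noteq> 0}" by auto
    qed
  qed (use \<alpha> in \<open>auto intro!: continuous_intros\<close>)
  have "(\<Sum>k. (\<alpha> gchoose k) * z ^ k) - (1 + z) powr \<alpha> = 0"
  proof (rule continuous_constant_on_closure[where S="ball 0 1"
        and f="\<lambda>z. (\<Sum>k. (\<alpha> gchoose k) * z ^ k) - (1 + z) powr \<alpha>"])
    show "continuous_on (closure (ball 0 1)) (\<lambda>z. (\<Sum>k. (\<alpha> gchoose k) * z ^ k) - (1 + z) powr \<alpha>)"
      using continuous_on_diff[OF c1 c2] by simp
    show "(\<Sum>k. (\<alpha> gchoose k) * w ^ k) - (1 + w) powr \<alpha> = 0" if "w \<in> ball 0 1" for w
      using gen_binomial_complex[of w \<alpha>] that by (simp add: sums_iff)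
  qed (use z in auto)
  with sm[OF z] show ?thesis by (simp add: sums_iff)
qed

text \<open>
  Existence of the calculus is needed for the definite description to denote, and the series
  identifies its value.
\<close>

lemma (in unitary_op) op_power_one_plus_sums:
  assumes e: "\<And>n. n \<ge> 1 \<Longrightarrow> cinner ((U ^^ n) e) e = 0" and e0: "e \<noteq> 0" and \<alpha>: "Re \<alpha> > 0"
  shows "bounded_op (op_power (\<lambda>x. x + U x) \<alpha>)"
    and "(\<lambda>n. (\<alpha> gchoose n) *\<^sub>C (U ^^ n) x) sums op_power (\<lambda>x. x + U x) \<alpha> x"
proof -
  have spec: "op_spectrum (\<lambda>x. x + U x) = sphere 1 1"
    by (rule op_spectrum_one_plus[OF _ e0]) (rule e)
  have 1: "continuous_on (op_spectrum (\<lambda>x. x + U x)) (\<lambda>z. z powr \<alpha>)"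
    unfolding spec
  proof (rule continuous_on_powr_complex[of _ "\<lambda>z. z" "\<lambda>_. \<alpha>"])
    show "sphere 1 1 \<subseteq> {z. 0 \<le> Re z \<or> Im z \<noteq> 0}"
    proof
      fix z :: complex assume "z \<in> sphere 1 1"
      then have "\<bar>1 - Re z\<bar> \<le> 1" using abs_Re_le_cmod[of "1 - z"] by (simp add: dist_norm)
      then show "z \<in> {z. 0 \<le> Re z \<or> Im z \<noteq> 0}" by auto
    qed
  qed (use \<alpha> in \<open>auto intro!: continuous_intros\<close>)
  have sp: "cmod (z - 1) \<le> 1" if "z \<in> op_spectrum (\<lambda>x. x + U x)" for z
    using that by (simp add: spec dist_norm norm_minus_commute)
  have 2: "(\<lambda>n. (\<alpha> gchoose n) * (z - 1) ^ n) sums (z powr \<alpha>)"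
    if "z \<in> op_spectrum (\<lambda>x. x + U x)" for z
    using binomial_series_closed_disc[OF \<alpha> sp[OF that]] by simp
  have *: "(\<lambda>n. (\<alpha> gchoose n) *\<^sub>C (U ^^ n) x) sums \<Phi> (\<lambda>z. z powr \<alpha>) x"
    if "is_cfc (\<lambda>x. x + U x) \<Phi>" for \<Phi> x
    by (rule is_cfc_power_sums[OF that 1 summable_norm_gbinomial[OF \<alpha>] sp 2])
  define \<Phi>0 where "\<Phi>0 = (\<lambda>f. cfc (\<lambda>w. f (1 + w)))"
  have \<Phi>0: "is_cfc (\<lambda>x. x + U x) \<Phi>0"
    unfolding \<Phi>0_def by (rule is_cfc_one_plus[OF spec])
  have op: "op_power (\<lambda>x. x + U x) \<alpha> = \<Phi>0 (\<lambda>z. z powr \<alpha>)"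
    unfolding op_power_def functional_calculus_def
  proof (rule the_equality)
    show "\<exists>\<Phi>. is_cfc (\<lambda>x. x + U x) \<Phi> \<and> \<Phi>0 (\<lambda>z. z powr \<alpha>) = \<Phi> (\<lambda>z. z powr \<alpha>)"
      using \<Phi>0 by blast
    show "S = \<Phi>0 (\<lambda>z. z powr \<alpha>)" if "\<exists>\<Phi>. is_cfc (\<lambda>x. x + U x) \<Phi> \<and> S = \<Phi> (\<lambda>z. z powr \<alpha>)" for S
      using that sums_unique2[OF * *] \<Phi>0 by (auto simp: fun_eq_iff)
  qed
  then show "(\<lambda>n. (\<alpha> gchoose n) *\<^sub>C (U ^^ n) x) sums op_power (\<lambda>x. x + U x) \<alpha> x"
    using *[OF \<Phi>0] by simp
  show "bounded_op (op_power (\<lambda>x. x + U x) \<alpha>)"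
    using \<Phi>0 1 op unfolding is_cfc_def Let_def mem_Collect_eq Ball_def by metis
qed

section \<open>Completeness of \<open>L\<^sup>2\<close>\<close>

lemma L2_fun_L2_class:
  assumes "square_integrable (line_measure TYPE('d)) f"
  shows "AE x in line_measure TYPE('d). L2_fun (L2_class f :: 'd::line_domain L2) x = f x"
  using L2_class_eq_iff[OF square_integrable_L2_fun assms, of "L2_class f"] by (simp add: L2_class_L2_fun)

lemma L2_class_add:
  assumes "square_integrable (line_measure TYPE('d)) f" "square_integrable (line_measure TYPE('d)) g"
  shows "L2_class f + L2_class g = (L2_class (\<lambda>x. f x + g x) :: 'd::line_domain L2)"
  using assms by (simp add: L2_class_def plus_L2.abs_eq sq_add_def Abs_sqint_inverse)

lemma L2_class_scale:
  assumes "square_integrable (line_measure TYPE('d)) f"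
  shows "c *\<^sub>C L2_class f = (L2_class (\<lambda>x. c * f x) :: 'd::line_domain L2)"
  using assms by (simp add: L2_class_def scaleC_L2.abs_eq sq_scale_def Abs_sqint_inverse)

lemma L2_fun_add:
  "AE x in line_measure TYPE('d). L2_fun (F + G :: 'd::line_domain L2) x = L2_fun F x + L2_fun G x"
  using L2_fun_L2_class[OF square_integrable_add[OF square_integrable_L2_fun[of F] square_integrable_L2_fun[of G]]]
  by (simp add: L2_class_add[OF square_integrable_L2_fun square_integrable_L2_fun, symmetric] L2_class_L2_fun)

lemma L2_fun_scale:
  "AE x in line_measure TYPE('d). L2_fun (c *\<^sub>C F :: 'd::line_domain L2) x = c * L2_fun F x"
  using L2_fun_L2_class[OF square_integrable_scale[OF square_integrable_L2_fun[of F], of c]]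
  by (simp add: L2_class_scale[OF square_integrable_L2_fun, symmetric] L2_class_L2_fun)

lemma L2_fun_diff:
  "AE x in line_measure TYPE('d). L2_fun (F - G :: 'd::line_domain L2) x = L2_fun F x - L2_fun G x"
  using L2_fun_add[of F "(-1) *\<^sub>C G"] L2_fun_scale[of "-1" G]
  by eventually_elim (simp add: scaleC_minus_one)

lemma cinner_L2_eq:
  fixes F G :: "'d::line_domain L2"
  shows "cinner F G = (\<integral>x. L2_fun F x * cnj (L2_fun G x) \<partial>line_measure TYPE('d))"
proof -
  have "cinner F G = L2_cinner (abs_L2 (rep_L2 F)) (abs_L2 (rep_L2 G))"
    by (simp add: Quotient3_abs_rep[OF Quotient3_L2] cinner_L2_def)
  then show ?thesis unfolding L2_cinner.abs_eq L2_fun_def .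
qed

lemma L2_fun_measurable [measurable]:
  "L2_fun (F :: 'd::line_domain L2) \<in> borel_measurable (line_measure TYPE('d))"
  using square_integrable_L2_fun[of F] by (simp add: square_integrable_def)

lemma nn_norm_L2:
  "(\<integral>\<^sup>+x. ennreal ((cmod (L2_fun F x))\<^sup>2) \<partial>line_measure TYPE('d)) = ennreal ((norm (F :: 'd::line_domain L2))\<^sup>2)"
proof -
  have i: "integrable (line_measure TYPE('d)) (\<lambda>x. (cmod (L2_fun F x))\<^sup>2)"
    using square_integrable_L2_fun[of F] by (simp add: square_integrable_def)
  have "complex_of_real ((norm F)\<^sup>2) = (\<integral>x. complex_of_real ((cmod (L2_fun F x))\<^sup>2) \<partial>line_measure TYPE('d))"
    by (simp only: cinner_self[symmetric] cinner_L2_eq complex_norm_square)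
  also have "\<dots> = complex_of_real (\<integral>x. (cmod (L2_fun F x))\<^sup>2 \<partial>line_measure TYPE('d))"
    by (rule integral_complex_of_real)
  finally have "(norm F)\<^sup>2 = (\<integral>x. (cmod (L2_fun F x))\<^sup>2 \<partial>line_measure TYPE('d))"
    using of_real_eq_iff by blast
  then show ?thesis using nn_integral_eq_integral[OF i] by simp
qed

lemma nn_norm_L2_class:
  assumes "square_integrable (line_measure TYPE('d)) f"
  shows "(\<integral>\<^sup>+x. ennreal ((cmod (f x))\<^sup>2) \<partial>line_measure TYPE('d))
      = ennreal ((norm (L2_class f :: 'd::line_domain L2))\<^sup>2)"
  unfolding nn_norm_L2[symmetric] using L2_fun_L2_class[OF assms]
  by (intro nn_integral_cong_AE) (auto elim: eventually_mono)

lemma square_integrableI_nn: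
  assumes "f \<in> borel_measurable M" "(\<integral>\<^sup>+x. ennreal ((cmod (f x))\<^sup>2) \<partial>M) < \<infinity>"
  shows "square_integrable M f"
  unfolding square_integrable_def using assms by (auto intro!: integrableI_bounded)

lemma square_integrable_diff:
  assumes "square_integrable M f" "square_integrable M g"
  shows "square_integrable M (\<lambda>x. f x - g x)"
  using square_integrable_add[OF assms(1) square_integrable_scale[OF assms(2), of "-1"]] by simp

lemma square_integrable_nn:
  "square_integrable M f \<Longrightarrow> (\<integral>\<^sup>+x. ennreal ((cmod (f x))\<^sup>2) \<partial>M) < \<infinity>"
  unfolding square_integrable_def by (auto simp: integrable_iff_bounded)

text \<open>
  The core of the Riesz--Fischer theorem. As the differences \<open>d\<^sub>n\<close> have norm at most \<open>2\<^sup>-\<^sup>n\<close>,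
  the sum of \<open>2\<^sup>n |d\<^sub>n|\<^sup>2\<close> is integrable, hence finite almost everywhere, and
  \<open>|d\<^sub>n| \<le> 2\<^sup>-\<^sup>n + 2\<^sup>n |d\<^sub>n|\<^sup>2\<close> gives pointwise convergence; Fatou's lemma turns the pointwise limit into
  a limit in norm.
\<close>

lemma L2_rapid_Cauchy_converges:
  fixes F :: "nat \<Rightarrow> 'd::line_domain L2"
  assumes F: "\<And>m n. n \<le> m \<Longrightarrow> norm (F m - F n) \<le> (1/2) ^ n"
  shows "\<exists>G. F \<longlonglongrightarrow> G"
proof -
  define M where "M = line_measure TYPE('d)"
  define f where "f n = L2_fun (F n)" for n
  have fm [measurable]: "f n \<in> borel_measurable M" for n by (simp add: f_def M_def)
  have nd: "(\<integral>\<^sup>+x. ennreal ((cmod (f m x - f n x))\<^sup>2) \<partial>M) = ennreal ((norm (F m - F n))\<^sup>2)" for m n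
    unfolding nn_norm_L2[symmetric] M_def f_def using L2_fun_diff[of "F m" "F n"]
    by (intro nn_integral_cong_AE) (auto elim: eventually_mono)
  define d where "d n x = f (Suc n) x - f n x" for n x
  have dm [measurable]: "d n \<in> borel_measurable M" for n unfolding d_def by measurable
  have "(\<integral>\<^sup>+x. (\<Sum>n. ennreal (2 ^ n * (cmod (d n x))\<^sup>2)) \<partial>M) = (\<Sum>n. \<integral>\<^sup>+x. ennreal (2 ^ n * (cmod (d n x))\<^sup>2) \<partial>M)"
    by (rule nn_integral_suminf) measurable
  also have "\<dots> \<le> (\<Sum>n. ennreal ((1/2) ^ n))"
  proof (rule suminf_le)
    fix n
    have "(\<integral>\<^sup>+x. ennreal (2 ^ n * (cmod (d n x))\<^sup>2) \<partial>M) = (\<integral>\<^sup>+x. ennreal (2 ^ n) * ennreal ((cmod (d n x))\<^sup>2) \<partial>M)"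
      by (simp add: ennreal_mult)
    also have "\<dots> = ennreal (2 ^ n) * (\<integral>\<^sup>+x. ennreal ((cmod (d n x))\<^sup>2) \<partial>M)"
      by (rule nn_integral_cmult) measurable
    also have "\<dots> = ennreal (2 ^ n * (norm (F (Suc n) - F n))\<^sup>2)"
      by (simp add: d_def nd ennreal_mult)
    also have "\<dots> \<le> ennreal (2 ^ n * ((1/2) ^ n)\<^sup>2)"
      by (intro ennreal_leI mult_left_mono power_mono F) auto
    also have "2 ^ n * ((1/2) ^ n)\<^sup>2 = (1/2 :: real) ^ n"
      by (simp add: power2_eq_square power_divide)
    finally show "(\<integral>\<^sup>+x. ennreal (2 ^ n * (cmod (d n x))\<^sup>2) \<partial>M) \<le> ennreal ((1/2) ^ n)" .
  qed auto
  also have "\<dots> = ennreal (\<Sum>n. (1/2) ^ n)"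
    by (rule suminf_ennreal2) (auto intro: summable_geometric)
  also have "\<dots> < \<infinity>" by simp
  finally have "AE x in M. (\<Sum>n. ennreal (2 ^ n * (cmod (d n x))\<^sup>2)) \<noteq> \<infinity>"
    by (intro nn_integral_PInf_AE) auto
  then have conv: "AE x in M. convergent (\<lambda>n. f n x)"
  proof eventually_elim
    case (elim x)
    then have "summable (\<lambda>n. 2 ^ n * (cmod (d n x))\<^sup>2)"
      by (intro summable_suminf_not_top) auto
    then have s: "summable (\<lambda>n. (1/2) ^ n + 2 ^ n * (cmod (d n x))\<^sup>2)"
      by (intro summable_add summable_geometric) auto
    have "summable (\<lambda>n. d n x)"
    proof (rule summable_comparison_test'[OF s])
      fix n
      define a t where "a = cmod (d n x)" and "t = (2::real) ^ n"
      have t: "t \<ge> 1" by (simp add: t_def)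
      \<comment> \<open>Completing the square; this is the bound announced above, multiplied by \<open>t\<close>.\<close>
      have "a * t \<le> 1 + (t * a)\<^sup>2"
        using zero_le_power2[of "t * a - 1/2"] by (simp add: power2_eq_square algebra_simps)
      then have "a \<le> (1 + (t * a)\<^sup>2) / t" using t by (simp add: pos_le_divide_eq)
      also have "\<dots> = 1 / t + t * a\<^sup>2" using t by (simp add: field_simps power2_eq_square)
      finally show "norm (d n x) \<le> (1/2) ^ n + 2 ^ n * (cmod (d n x))\<^sup>2"
        by (simp add: a_def t_def power_divide)
    qed
    then have "(\<lambda>n. \<Sum>k<n. d k x) \<longlonglongrightarrow> (\<Sum>k. d k x)" by (rule summable_LIMSEQ)
    moreover have "(\<Sum>k<n. d k x) = f n x - f 0 x" for n
      unfolding d_def by (rule sum_lessThan_telescope)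
    ultimately have "(\<lambda>n. (f n x - f 0 x) + f 0 x) \<longlonglongrightarrow> (\<Sum>k. d k x) + f 0 x"
      by (intro tendsto_add) auto
    then show ?case by (auto simp: convergent_def)
  qed
  define g where "g x = lim (\<lambda>n. f n x)" for x
  have gm [measurable]: "g \<in> borel_measurable M" unfolding g_def by measurable
  have lim: "AE x in M. (\<lambda>n. f n x) \<longlonglongrightarrow> g x"
    using conv by (auto simp: g_def convergent_LIMSEQ_iff)
  have fatou: "(\<integral>\<^sup>+x. ennreal ((cmod (g x - f n x))\<^sup>2) \<partial>M) \<le> ennreal (((1/2) ^ n)\<^sup>2)" for n
  proof -
    have "(\<integral>\<^sup>+x. ennreal ((cmod (g x - f n x))\<^sup>2) \<partial>M)
        = (\<integral>\<^sup>+x. liminf (\<lambda>m. ennreal ((cmod (f m x - f n x))\<^sup>2)) \<partial>M)"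
    proof (rule nn_integral_cong_AE)
      show "AE x in M. ennreal ((cmod (g x - f n x))\<^sup>2) = liminf (\<lambda>m. ennreal ((cmod (f m x - f n x))\<^sup>2))"
        using lim
      proof eventually_elim
        case (elim x)
        have "(\<lambda>m. ennreal ((cmod (f m x - f n x))\<^sup>2)) \<longlonglongrightarrow> ennreal ((cmod (g x - f n x))\<^sup>2)"
          by (intro tendsto_ennrealI tendsto_intros elim)
        from lim_imp_Liminf[OF trivial_limit_sequentially this] show ?case by (rule sym)
      qed
    qed
    also have "\<dots> \<le> liminf (\<lambda>m. \<integral>\<^sup>+x. ennreal ((cmod (f m x - f n x))\<^sup>2) \<partial>M)"
      by (rule nn_integral_liminf) measurable
    also have "\<dots> \<le> ennreal (((1/2) ^ n)\<^sup>2)"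
    proof (rule Liminf_le)
      show "\<forall>\<^sub>F m in sequentially. (\<integral>\<^sup>+x. ennreal ((cmod (f m x - f n x))\<^sup>2) \<partial>M) \<le> ennreal (((1/2) ^ n)\<^sup>2)"
        using eventually_ge_at_top[of n]
        by eventually_elim (auto simp only: nd intro!: ennreal_leI power_mono F norm_ge_zero)
    qed simp
    finally show ?thesis .
  qed
  have sqd: "square_integrable M (\<lambda>x. g x - f n x)" for n
    by (rule square_integrableI_nn) (use le_less_trans[OF fatou, of n \<infinity>] in auto)
  have "square_integrable M (\<lambda>x. (g x - f 0 x) + f 0 x)"
    by (rule square_integrable_add[OF sqd]) (simp add: f_def M_def square_integrable_L2_fun)
  then have sqg: "square_integrable M g" by simp
  define G where "G = (L2_class g :: 'd L2)"
  have "norm (F n - G) \<le> (1/2) ^ n" for n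
  proof -
    have "ennreal ((norm (G - F n))\<^sup>2) = (\<integral>\<^sup>+x. ennreal ((cmod (g x - f n x))\<^sup>2) \<partial>M)"
      unfolding nn_norm_L2[symmetric] M_def f_def G_def
    proof (rule nn_integral_cong_AE)
      show "AE x in line_measure TYPE('d). ennreal ((cmod (L2_fun (L2_class g - F n) x))\<^sup>2)
          = ennreal ((cmod (g x - L2_fun (F n) x))\<^sup>2)"
        using L2_fun_diff[of "L2_class g" "F n"] L2_fun_L2_class[OF sqg[unfolded M_def]]
      proof eventually_elim
        case (elim x)
        show ?case by (simp only: elim)
      qed
    qed
    with fatou[of n] have "ennreal ((norm (G - F n))\<^sup>2) \<le> ennreal (((1/2) ^ n)\<^sup>2)" by simp
    then have "(norm (G - F n))\<^sup>2 \<le> ((1/2) ^ n)\<^sup>2" by (subst (asm) ennreal_le_iff) auto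
    then show ?thesis by (simp add: norm_minus_commute power2_le_iff_abs_le)
  qed
  then have "(\<lambda>n. F n - G) \<longlonglongrightarrow> 0"
    by (intro Lim_null_comparison[OF always_eventually LIMSEQ_power_zero[of "1/2::real"]]) auto
  then show ?thesis by (intro exI[of _ G]) (rule LIM_zero_cancel)
qed

instance L2 :: (line_domain) complete_space
proof
  fix X :: "nat \<Rightarrow> 'a L2" assume X: "Cauchy X"
  define P where "P n m \<longleftrightarrow> (\<forall>i\<ge>m. \<forall>j\<ge>m. dist (X i) (X j) < (1/2) ^ n)" for n m :: nat
  have ex: "\<exists>m. P n m" for n
    using metric_CauchyD[OF X, of "(1/2) ^ n"] by (auto simp: P_def)
  have mono: "P n m \<Longrightarrow> m \<le> m' \<Longrightarrow> P n m'" for n m m' by (auto simp: P_def)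
  have "\<exists>r. \<forall>n. P n (r n) \<and> r n < r (Suc n)"
  proof (rule dependent_nat_choice)
    show "\<exists>m. P 0 m" by (rule ex)
    fix m n
    obtain m' where "P (Suc n) m'" using ex by blast
    then have "P (Suc n) (max m' (Suc m))" by (rule mono) simp
    then show "\<exists>y. P (Suc n) y \<and> m < y" by (intro exI[of _ "max m' (Suc m)"]) simp
  qed
  then obtain r where r: "\<And>n. P n (r n)" "\<And>n. r n < r (Suc n)" by blast
  then have sm: "strict_mono r" by (simp add: strict_mono_Suc_iff)
  have "\<exists>G. (\<lambda>n. X (r n)) \<longlonglongrightarrow> G"
  proof (rule L2_rapid_Cauchy_converges)
    fix m n :: nat assume "n \<le> m"
    then have "r n \<le> r m" using strict_mono_less_eq[OF sm] by simp
    then show "norm (X (r m) - X (r n)) \<le> (1/2) ^ n"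
      using r(1)[of n] by (auto simp: P_def dist_norm less_imp_le)
  qed
  then show "convergent X"
    using Cauchy_converges_subseq[OF X sm] by (auto simp: convergent_def o_def)
qed

section \<open>Square-integrable functions on the half-line\<close>

text \<open>Representatives extended by zero turn integrals over the half-line into integrals over \<open>\<real>\<close>.\<close>

definition ext :: "half_line L2 \<Rightarrow> real \<Rightarrow> complex" where
  "ext F x = (if 0 < x then L2_fun F x else 0)"

abbreviation half_class :: "(real \<Rightarrow> complex) \<Rightarrow> half_line L2" where
  "half_class f \<equiv> L2_class f"

lemma line_dom_half: "line_dom TYPE(half_line) = {0<..}"
  by (rule line_dom_half_line_def)

lemma half_sets: "{0<..} \<inter> space lborel \<in> sets (lborel :: real measure)" by simp

lemma AE_half: "(AE x in line_measure TYPE(half_line). P x) \<longleftrightarrow> (AE x in lborel. 0 < x \<longrightarrow> P x)"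
  unfolding line_dom_half by (subst AE_restrict_space_iff[OF half_sets]) auto

lemma nn_integral_half:
  "(\<integral>\<^sup>+x. f x \<partial>line_measure TYPE(half_line)) = (\<integral>\<^sup>+x. f x * indicator {0<..} x \<partial>lborel)"
  unfolding line_dom_half by (rule nn_integral_restrict_space[OF half_sets])

lemma square_integrable_half:
  "square_integrable (line_measure TYPE(half_line)) f
     \<longleftrightarrow> square_integrable lborel (\<lambda>x. if 0 < x then f x else 0)"
proof -
  have 1: "(\<lambda>x. indicator {0<..} x *\<^sub>R f x) = (\<lambda>x. if 0 < x then f x else 0)"
    by (auto simp: indicator_def)
  have 2: "(\<lambda>x. indicator {0<..} x *\<^sub>R (cmod (f x))\<^sup>2) = (\<lambda>x. (cmod (if 0 < x then f x else 0))\<^sup>2)"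
    by (auto simp: indicator_def)
  show ?thesis
    unfolding square_integrable_def line_dom_half borel_measurable_restrict_space_iff[OF half_sets]
      integrable_restrict_space[OF half_sets] 1 2 ..
qed

lemma square_integrable_half_if:
  "square_integrable lborel f \<Longrightarrow> square_integrable (line_measure TYPE(half_line)) f"
  unfolding square_integrable_def line_dom_half integrable_restrict_space[OF half_sets]
proof (elim conjE, intro conjI)
  assume f: "f \<in> borel_measurable lborel" "integrable lborel (\<lambda>x. (cmod (f x))\<^sup>2)"
  show "f \<in> borel_measurable (restrict_space lborel {0<..})"
    by (rule measurable_restrict_space1[OF f(1)])
  show "integrable lborel (\<lambda>x. indicator {0<..} x *\<^sub>R (cmod (f x))\<^sup>2)"
    by (rule integrable_mult_indicator[OF _ f(2)]) simp
qed

lemma square_integrable_ext: "square_integrable lborel (ext F)"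
  using square_integrable_L2_fun[of F] unfolding square_integrable_half by (simp add: ext_def[abs_def])

lemma ext_measurable [measurable]: "ext F \<in> borel_measurable borel"
  using square_integrable_ext[of F] by (simp add: square_integrable_def)

lemma ext_half_class:
  assumes "square_integrable lborel f"
  shows "AE x in lborel. 0 < x \<longrightarrow> ext (half_class f) x = f x"
  using L2_fun_L2_class[OF square_integrable_half_if[OF assms]] unfolding AE_half
  by (auto simp: ext_def)

lemma half_class_ext: "half_class (ext F) = F"
proof -
  have "half_class (ext F) = half_class (L2_fun F)"
    by (subst L2_class_eq_iff)
      (auto simp: AE_half ext_def square_integrable_L2_fun intro!: square_integrable_half_if square_integrable_ext)
  then show ?thesis by (simp add: L2_class_L2_fun)
qed

lemma half_class_cong:
  assumes "square_integrable lborel f" "square_integrable lborel g" "AE x in lborel. 0 < x \<longrightarrow> f x = g x"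
  shows "half_class f = half_class g"
  using assms by (subst L2_class_eq_iff) (auto simp: AE_half intro!: square_integrable_half_if)

lemma half_class_add:
  "square_integrable lborel f \<Longrightarrow> square_integrable lborel g \<Longrightarrow>
    half_class f + half_class g = half_class (\<lambda>x. f x + g x)"
  by (intro L2_class_add square_integrable_half_if)

lemma half_class_scale:
  "square_integrable lborel f \<Longrightarrow> c *\<^sub>C half_class f = half_class (\<lambda>x. c * f x)"
  by (intro L2_class_scale square_integrable_half_if)

lemma half_class_diff:
  assumes "square_integrable lborel f" "square_integrable lborel g"
  shows "half_class f - half_class g = half_class (\<lambda>x. f x - g x)"
proof -
  have "half_class f - half_class g = half_class f + (-1) *\<^sub>C half_class g"
    by (simp add: scaleC_minus_one)
  then show ?thesis
    unfolding half_class_scale[OF assms(2)] half_class_add[OF assms(1) square_integrable_scale[OF assms(2)]]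
    by simp
qed

lemma ext_add: "AE x in lborel. ext (F + G) x = ext F x + ext G x"
  using L2_fun_add[of F G] unfolding AE_half by eventually_elim (auto simp: ext_def)

lemma ext_scale: "AE x in lborel. ext (c *\<^sub>C F) x = c * ext F x"
  using L2_fun_scale[of c F] unfolding AE_half by eventually_elim (auto simp: ext_def)

lemma nn_norm_ext: "(\<integral>\<^sup>+x. ennreal ((cmod (ext F x))\<^sup>2) \<partial>lborel) = ennreal ((norm F)\<^sup>2)"
  unfolding nn_norm_L2[symmetric] nn_integral_half
  by (intro nn_integral_cong) (auto simp: ext_def indicator_def)

lemma norm_half_class_le:
  assumes "square_integrable lborel f"
  shows "ennreal ((norm (half_class f))\<^sup>2) \<le> (\<integral>\<^sup>+x. ennreal ((cmod (f x))\<^sup>2) \<partial>lborel)"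
  unfolding nn_norm_L2_class[OF square_integrable_half_if[OF assms], symmetric] nn_integral_half
  by (intro nn_integral_mono) (auto simp: indicator_def)

lemma cinner_ext: "cinner F G = (\<integral>x. ext F x * cnj (ext G x) \<partial>lborel)"
  unfolding cinner_L2_eq line_dom_half integral_restrict_space[OF half_sets]
  by (intro Bochner_Integration.integral_cong) (auto simp: ext_def indicator_def)

text \<open>
  The squared distances are dominated by the integrable function \<open>2 |h|\<^sup>2 + 2 |g|\<^sup>2\<close>.
\<close>

lemma half_class_dominated_convergence:
  assumes f: "\<And>n. f n \<in> borel_measurable borel" and g: "square_integrable lborel g"
    and h: "square_integrable lborel h"
    and bound: "\<And>n x. cmod (f n x) \<le> cmod (h x)"
    and lim: "AE x in lborel. (\<lambda>n. f n x) \<longlonglongrightarrow> g x"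
  shows "(\<lambda>n. half_class (f n)) \<longlonglongrightarrow> half_class g"
proof -
  have gm [measurable]: "g \<in> borel_measurable borel" and hm [measurable]: "h \<in> borel_measurable borel"
    using g h by (auto simp: square_integrable_def)
  have ih: "integrable lborel (\<lambda>x. (cmod (h x))\<^sup>2)" using h by (simp add: square_integrable_def)
  note f [measurable]
  have sqf: "square_integrable lborel (f n)" for n
    unfolding square_integrable_def
  proof
    show "integrable lborel (\<lambda>x. (cmod (f n x))\<^sup>2)"
    proof (rule Bochner_Integration.integrable_bound[OF ih])
      show "AE x in lborel. norm ((cmod (f n x))\<^sup>2) \<le> norm ((cmod (h x))\<^sup>2)"
        by (rule AE_I2) (simp add: bound)
    qed measurable
  qed measurable
  have il: "(\<lambda>n. \<integral>x. (cmod (f n x - g x))\<^sup>2 \<partial>lborel) \<longlonglongrightarrow> (\<integral>x. 0 \<partial>(lborel :: real measure))"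
  proof (rule integral_dominated_convergence[where w="\<lambda>x. 2 * (cmod (h x))\<^sup>2 + 2 * (cmod (g x))\<^sup>2"])
    show "integrable lborel (\<lambda>x. 2 * (cmod (h x))\<^sup>2 + 2 * (cmod (g x))\<^sup>2)"
      using g h by (auto simp: square_integrable_def)
    show "AE x in lborel. (\<lambda>n. (cmod (f n x - g x))\<^sup>2) \<longlonglongrightarrow> 0"
      using lim
    proof eventually_elim
      case (elim x)
      have "(\<lambda>n. (cmod (f n x - g x))\<^sup>2) \<longlonglongrightarrow> (cmod (g x - g x))\<^sup>2"
        by (intro tendsto_intros elim)
      then show ?case by simp
    qed
    show "AE x in lborel. norm ((cmod (f n x - g x))\<^sup>2) \<le> 2 * (cmod (h x))\<^sup>2 + 2 * (cmod (g x))\<^sup>2" for n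
    proof (rule AE_I2)
      fix x
      have "(cmod (f n x - g x))\<^sup>2 \<le> (cmod (h x) + cmod (g x))\<^sup>2"
        using norm_triangle_ineq4[of "f n x" "g x"] bound[of n x] by (intro power_mono) auto
      also have "\<dots> \<le> 2 * (cmod (h x))\<^sup>2 + 2 * (cmod (g x))\<^sup>2"
        using zero_le_power2[of "cmod (h x) - cmod (g x)"]
        by (simp add: power2_eq_square algebra_simps)
      finally show "norm ((cmod (f n x - g x))\<^sup>2) \<le> 2 * (cmod (h x))\<^sup>2 + 2 * (cmod (g x))\<^sup>2" by simp
    qed
  qed measurable
  have le: "(norm (half_class (f n) - half_class g))\<^sup>2 \<le> (\<integral>x. (cmod (f n x - g x))\<^sup>2 \<partial>lborel)" for n
  proof -
    have sq: "square_integrable lborel (\<lambda>x. f n x - g x)" by (rule square_integrable_diff[OF sqf g])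
    have "ennreal ((norm (half_class (\<lambda>x. f n x - g x)))\<^sup>2) \<le> (\<integral>\<^sup>+x. ennreal ((cmod (f n x - g x))\<^sup>2) \<partial>lborel)"
      by (rule norm_half_class_le[OF sq])
    also have "\<dots> = ennreal (\<integral>x. (cmod (f n x - g x))\<^sup>2 \<partial>lborel)"
      using sq by (intro nn_integral_eq_integral) (auto simp: square_integrable_def)
    finally show ?thesis
      unfolding half_class_diff[OF sqf g]
      by (subst (asm) ennreal_le_iff) (rule Bochner_Integration.integral_nonneg, simp)
  qed
  have "(\<lambda>n. (norm (half_class (f n) - half_class g))\<^sup>2) \<longlonglongrightarrow> 0"
  proof (rule Lim_null_comparison[OF always_eventually])
    show "\<forall>n. norm ((norm (half_class (f n) - half_class g))\<^sup>2) \<le> (\<integral>x. (cmod (f n x - g x))\<^sup>2 \<partial>lborel)"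
      using le by (simp only: real_norm_def abs_power2 simp_thms)
    show "(\<lambda>n. \<integral>x. (cmod (f n x - g x))\<^sup>2 \<partial>lborel) \<longlonglongrightarrow> 0"
      using il by (simp only: Bochner_Integration.integral_zero)
  qed
  then have "(\<lambda>n. sqrt ((norm (half_class (f n) - half_class g))\<^sup>2)) \<longlonglongrightarrow> sqrt 0"
    by (rule tendsto_real_sqrt)
  then have "(\<lambda>n. norm (half_class (f n) - half_class g)) \<longlonglongrightarrow> 0"
    by (simp only: real_sqrt_abs abs_norm_cancel real_sqrt_zero)
  then have "(\<lambda>n. half_class (f n) - half_class g) \<longlonglongrightarrow> 0"
    by (rule tendsto_norm_zero_cancel)
  then show ?thesis by (rule LIM_zero_cancel)
qed

section \<open>Dilation averages\<close>

text \<open>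
  The Cesaro operator, its adjoint and the Hoelder operators all have this form.
\<close>

definition dil :: "(real \<Rightarrow> complex) \<Rightarrow> (real \<Rightarrow> complex) \<Rightarrow> real \<Rightarrow> complex" where
  "dil k g x = (\<integral>u. k u * g (u * x) \<partial>lborel)"

text \<open>
  Dilation by \<open>u\<close> has norm \<open>u\<^sup>-\<^sup>1\<^sup>/\<^sup>2\<close> on \<open>L\<^sup>2\<close>, so the integral below bounds the norm of the average.
\<close>

definition dil_kernel :: "(real \<Rightarrow> complex) \<Rightarrow> bool" where
  "dil_kernel k \<longleftrightarrow> k \<in> borel_measurable borel \<and> (\<forall>u\<le>0. k u = 0) \<and>
     integrable lborel (\<lambda>u. cmod (k u) / sqrt u)"

lemma dil_kernel_measurable: "dil_kernel k \<Longrightarrow> k \<in> borel_measurable borel"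
  by (simp add: dil_kernel_def)

text \<open>
  Schur's test for a dilation average: splitting \<open>|k| = (|k| u\<^sup>-\<^sup>1\<^sup>/\<^sup>2)\<^sup>1\<^sup>/\<^sup>2 (|k| u\<^sup>1\<^sup>/\<^sup>2)\<^sup>1\<^sup>/\<^sup>2\<close>
  lets the factor \<open>1/u\<close> from the dilation of Lebesgue measure be absorbed.
\<close>

lemma dil_Schur:
  assumes k: "dil_kernel k" and g [measurable]: "g \<in> borel_measurable borel"
  shows "(\<integral>\<^sup>+x. (\<integral>\<^sup>+u. ennreal (cmod (k u * g (u * x))) \<partial>lborel)\<^sup>2 \<partial>lborel)
     \<le> (ennreal (\<integral>u. cmod (k u) / sqrt u \<partial>lborel))\<^sup>2 * (\<integral>\<^sup>+x. ennreal ((cmod (g x))\<^sup>2) \<partial>lborel)"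
proof -
  note km [measurable] = dil_kernel_measurable[OF k]
  have k0: "k u = 0" if "u \<le> 0" for u using k that by (simp add: dil_kernel_def)
  have ki: "integrable lborel (\<lambda>u. cmod (k u) / sqrt u)" using k by (simp add: dil_kernel_def)
  define c where "c = (\<integral>\<^sup>+u. ennreal (cmod (k u) / sqrt u) \<partial>lborel)"
  define N where "N = (\<integral>\<^sup>+x. ennreal ((cmod (g x))\<^sup>2) \<partial>lborel)"
  have kn: "0 \<le> cmod (k u) / sqrt u" for u
    using k0[of u] by (cases "u \<le> 0") auto
  have c: "c = ennreal (\<integral>u. cmod (k u) / sqrt u \<partial>lborel)"
    unfolding c_def by (rule nn_integral_eq_integral[OF ki]) (use kn in auto)
  have pt: "(\<integral>\<^sup>+u. ennreal (cmod (k u * g (u * x))) \<partial>lborel)\<^sup>2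
      \<le> c * (\<integral>\<^sup>+u. ennreal (cmod (k u) * sqrt u * (cmod (g (u * x)))\<^sup>2) \<partial>lborel)" for x
  proof -
    define a where "a u = ennreal (sqrt (cmod (k u) / sqrt u))" for u
    define b where "b u = ennreal (sqrt (cmod (k u) * sqrt u) * cmod (g (u * x)))" for u
    have "ennreal (cmod (k u * g (u * x))) = a u * b u" for u
    proof (cases "u \<le> 0")
      case False
      then have "sqrt (cmod (k u) / sqrt u) * sqrt (cmod (k u) * sqrt u) = cmod (k u)"
        by (simp flip: real_sqrt_mult)
      then show ?thesis unfolding a_def b_def using False
        by (subst ennreal_mult[symmetric]) (auto simp: norm_mult mult.assoc[symmetric])
    qed (simp add: k0 a_def b_def)
    then have "(\<integral>\<^sup>+u. ennreal (cmod (k u * g (u * x))) \<partial>lborel)\<^sup>2 = (\<integral>\<^sup>+u. a u * b u \<partial>lborel)\<^sup>2" by simp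
    also have "\<dots> \<le> (\<integral>\<^sup>+u. (a u)\<^sup>2 \<partial>lborel) * (\<integral>\<^sup>+u. (b u)\<^sup>2 \<partial>lborel)"
      unfolding a_def b_def by (rule Cauchy_Schwarz_nn_integral) measurable
    also have "(\<lambda>u. (a u)\<^sup>2) = (\<lambda>u. ennreal (cmod (k u) / sqrt u))"
      by (simp add: a_def ennreal_power kn fun_eq_iff)
    also have "(\<lambda>u. (b u)\<^sup>2) = (\<lambda>u. ennreal (cmod (k u) * sqrt u * (cmod (g (u * x)))\<^sup>2))"
    proof
      fix u show "(b u)\<^sup>2 = ennreal (cmod (k u) * sqrt u * (cmod (g (u * x)))\<^sup>2)"
      proof (cases "u \<le> 0")
        case False then show ?thesis by (simp add: b_def ennreal_power power_mult_distrib)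
      qed (simp add: b_def k0)
    qed
    finally show ?thesis by (simp only: c_def)
  qed
  have scale: "(\<integral>\<^sup>+x. ennreal (cmod (k u) * sqrt u * (cmod (g (u * x)))\<^sup>2) \<partial>lborel)
      = ennreal (cmod (k u) / sqrt u) * N" for u
  proof (cases "u \<le> 0")
    case False
    have "N = ennreal u * (\<integral>\<^sup>+x. ennreal ((cmod (g (u * x)))\<^sup>2) \<partial>lborel)"
      unfolding N_def using nn_integral_real_affine[of "\<lambda>x. ennreal ((cmod (g x))\<^sup>2)" u 0] False by simp
    then have "ennreal (cmod (k u) / sqrt u) * N
        = (ennreal (cmod (k u) / sqrt u) * ennreal u) * (\<integral>\<^sup>+x. ennreal ((cmod (g (u * x)))\<^sup>2) \<partial>lborel)"
      by (simp only: mult.assoc)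
    also have "ennreal (cmod (k u) / sqrt u) * ennreal u = ennreal (cmod (k u) / sqrt u * u)"
      by (rule ennreal_mult[symmetric]) (use False in auto)
    also have "cmod (k u) / sqrt u * u = cmod (k u) * sqrt u"
      using False by (simp add: real_div_sqrt field_simps)
    also have "ennreal (cmod (k u) * sqrt u) * (\<integral>\<^sup>+x. ennreal ((cmod (g (u * x)))\<^sup>2) \<partial>lborel)
        = (\<integral>\<^sup>+x. ennreal (cmod (k u) * sqrt u) * ennreal ((cmod (g (u * x)))\<^sup>2) \<partial>lborel)"
      by (rule nn_integral_cmult[symmetric]) measurable
    also have "\<dots> = (\<integral>\<^sup>+x. ennreal (cmod (k u) * sqrt u * (cmod (g (u * x)))\<^sup>2) \<partial>lborel)"
      using False by (simp add: ennreal_mult)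
    finally show ?thesis by simp
  qed (simp add: k0)
  have "(\<integral>\<^sup>+x. (\<integral>\<^sup>+u. ennreal (cmod (k u * g (u * x))) \<partial>lborel)\<^sup>2 \<partial>lborel)
      \<le> (\<integral>\<^sup>+x. c * (\<integral>\<^sup>+u. ennreal (cmod (k u) * sqrt u * (cmod (g (u * x)))\<^sup>2) \<partial>lborel) \<partial>lborel)"
    by (intro nn_integral_mono pt)
  also have "\<dots> = c * (\<integral>\<^sup>+x. (\<integral>\<^sup>+u. ennreal (cmod (k u) * sqrt u * (cmod (g (u * x)))\<^sup>2) \<partial>lborel) \<partial>lborel)"
    by (rule nn_integral_cmult) measurable
  also have "(\<integral>\<^sup>+x. (\<integral>\<^sup>+u. ennreal (cmod (k u) * sqrt u * (cmod (g (u * x)))\<^sup>2) \<partial>lborel) \<partial>lborel)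
      = (\<integral>\<^sup>+u. (\<integral>\<^sup>+x. ennreal (cmod (k u) * sqrt u * (cmod (g (u * x)))\<^sup>2) \<partial>lborel) \<partial>lborel)"
    by (rule lborel_pair.Fubini') measurable
  also have "\<dots> = (\<integral>\<^sup>+u. ennreal (cmod (k u) / sqrt u) * N \<partial>lborel)" by (simp only: scale)
  also have "\<dots> = c * N" unfolding c_def by (rule nn_integral_multc) measurable
  finally show ?thesis by (simp add: c N_def power2_eq_square mult.assoc)
qed

lemma dil_AE_integrable:
  assumes k: "dil_kernel k" and g: "square_integrable lborel g"
  shows "AE x in lborel. integrable lborel (\<lambda>u. k u * g (u * x))"
proof -
  have gm [measurable]: "g \<in> borel_measurable borel" using g by (simp add: square_integrable_def)
  note km [measurable] = dil_kernel_measurable[OF k]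
  have "(\<integral>\<^sup>+x. (\<integral>\<^sup>+u. ennreal (cmod (k u * g (u * x))) \<partial>lborel)\<^sup>2 \<partial>lborel) < \<infinity>"
    using dil_Schur[OF k gm] square_integrable_nn[OF g]
    by (elim le_less_trans) (auto simp: ennreal_mult_less_top power_less_top_ennreal)
  then have "AE x in lborel. (\<integral>\<^sup>+u. ennreal (cmod (k u * g (u * x))) \<partial>lborel)\<^sup>2 \<noteq> \<infinity>"
    by (intro nn_integral_PInf_AE) (auto intro!: borel_measurable_power)
  then show ?thesis
  proof eventually_elim
    case (elim x)
    then have "(\<integral>\<^sup>+u. ennreal (cmod (k u * g (u * x))) \<partial>lborel) < \<infinity>"
      by (simp add: power_less_top_ennreal less_top[symmetric] power_eq_top_ennreal)
    then show ?case by (intro integrableI_bounded) auto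
  qed
qed

lemma dil_bound:
  assumes k: "dil_kernel k" and g [measurable]: "g \<in> borel_measurable borel"
  shows "(\<integral>\<^sup>+x. ennreal ((cmod (dil k g x))\<^sup>2) \<partial>lborel)
     \<le> (ennreal (\<integral>u. cmod (k u) / sqrt u \<partial>lborel))\<^sup>2 * (\<integral>\<^sup>+x. ennreal ((cmod (g x))\<^sup>2) \<partial>lborel)"
proof -
  note km [measurable] = dil_kernel_measurable[OF k]
  have "(\<integral>\<^sup>+x. ennreal ((cmod (dil k g x))\<^sup>2) \<partial>lborel)
      \<le> (\<integral>\<^sup>+x. (\<integral>\<^sup>+u. ennreal (cmod (k u * g (u * x))) \<partial>lborel)\<^sup>2 \<partial>lborel)"
  proof (rule nn_integral_mono)
    fix x
    have "ennreal (cmod (dil k g x)) \<le> (\<integral>\<^sup>+u. ennreal (cmod (k u * g (u * x))) \<partial>lborel)"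
    proof (cases "integrable lborel (\<lambda>u. k u * g (u * x))")
      case True
      then show ?thesis unfolding dil_def by (rule integral_norm_bound_ennreal)
    next
      case False
      then show ?thesis by (simp add: dil_def not_integrable_integral_eq)
    qed
    then have "(ennreal (cmod (dil k g x)))\<^sup>2 \<le> (\<integral>\<^sup>+u. ennreal (cmod (k u * g (u * x))) \<partial>lborel)\<^sup>2"
      by (rule power_mono) simp
    then show "ennreal ((cmod (dil k g x))\<^sup>2) \<le> (\<integral>\<^sup>+u. ennreal (cmod (k u * g (u * x))) \<partial>lborel)\<^sup>2"
      by (simp add: ennreal_power)
  qed
  also note dil_Schur[OF k g]
  finally show ?thesis .
qed

lemma dil_measurable:
  assumes "dil_kernel k" and [measurable]: "g \<in> borel_measurable borel"
  shows "dil k g \<in> borel_measurable borel"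
proof -
  note [measurable] = dil_kernel_measurable[OF assms(1)]
  have "(\<lambda>x. \<integral>u. k u * g (u * x) \<partial>lborel) \<in> borel_measurable borel" by measurable
  then show ?thesis by (simp add: dil_def[abs_def])
qed

lemma square_integrable_dil:
  assumes k: "dil_kernel k" and g: "square_integrable lborel g"
  shows "square_integrable lborel (dil k g)"
proof (rule square_integrableI_nn)
  have gm: "g \<in> borel_measurable borel" using g by (simp add: square_integrable_def)
  show "dil k g \<in> borel_measurable lborel" using dil_measurable[OF k gm] by simp
  show "(\<integral>\<^sup>+x. ennreal ((cmod (dil k g x))\<^sup>2) \<partial>lborel) < \<infinity>"
    using dil_bound[OF k gm] square_integrable_nn[OF g]
    by (elim le_less_trans) (auto simp: ennreal_mult_less_top power_less_top_ennreal)
qed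

lemma AE_dilate:
  assumes "AE y in lborel. P y" "Measurable.pred borel P" "(x::real) \<noteq> 0"
  shows "AE u in lborel. P (u * x)"
  using AE_borel_affine[OF assms(3,2,1), of 0] by (simp add: mult.commute)

lemma dil_cong_AE:
  assumes [measurable]: "k \<in> borel_measurable borel" "g \<in> borel_measurable borel" "h \<in> borel_measurable borel"
    and "AE y in lborel. g y = h y" and x: "x \<noteq> 0"
  shows "dil k g x = dil k h x"
proof -
  have "AE u in lborel. g (u * x) = h (u * x)"
    by (rule AE_dilate[OF assms(4) _ x]) measurable
  then show ?thesis unfolding dil_def
    by (intro integral_cong_AE) (auto elim: eventually_mono)
qed

lemma AE_nonzero: "AE x in lborel. x \<noteq> (0::real)"
  by (rule AE_lborel_singleton)

definition Dil :: "(real \<Rightarrow> complex) \<Rightarrow> half_line L2 \<Rightarrow> half_line L2" where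
  "Dil k F = half_class (dil k (ext F))"

lemma ext_Dil:
  assumes "dil_kernel k" shows "AE x in lborel. 0 < x \<longrightarrow> ext (Dil k F) x = dil k (ext F) x"
  unfolding Dil_def by (rule ext_half_class[OF square_integrable_dil[OF assms square_integrable_ext]])

lemma Dil_half_class:
  assumes k: "dil_kernel k" and f: "square_integrable lborel f" and f0: "\<And>x. x \<le> 0 \<Longrightarrow> f x = 0"
  shows "Dil k (half_class f) = half_class (dil k f)"
  unfolding Dil_def
proof (rule half_class_cong)
  have fm: "f \<in> borel_measurable borel" using f by (simp add: square_integrable_def)
  have eq: "AE x in lborel. ext (half_class f) x = f x"
    using ext_half_class[OF f] by eventually_elim (auto simp: ext_def f0)
  show "AE x in lborel. 0 < x \<longrightarrow> dil k (ext (half_class f)) x = dil k f x"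
  proof (intro AE_I2 impI)
    fix x :: real assume "0 < x"
    then have "x \<noteq> 0" by simp
    then show "dil k (ext (half_class f)) x = dil k f x"
      by (rule dil_cong_AE[OF dil_kernel_measurable[OF k] ext_measurable fm eq])
  qed
qed (intro square_integrable_dil k f square_integrable_ext)+

lemma bounded_op_Dil:
  assumes k: "dil_kernel k" shows "bounded_op (Dil k)"
proof (rule bounded_opI)
  note [measurable] = dil_kernel_measurable[OF k]
  note sq = square_integrable_dil[OF k square_integrable_ext]
  show "Dil k (F + G) = Dil k F + Dil k G" for F G
    unfolding Dil_def half_class_add[OF sq sq]
  proof (rule half_class_cong[OF sq square_integrable_add[OF sq sq]])
    show "AE x in lborel. 0 < x \<longrightarrow> dil k (ext (F + G)) x = dil k (ext F) x + dil k (ext G) x"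
      using dil_AE_integrable[OF k square_integrable_ext[of F]] dil_AE_integrable[OF k square_integrable_ext[of G]]
    proof (eventually_elim, intro impI)
      fix x :: real assume 1: "integrable lborel (\<lambda>u. k u * ext F (u * x))" "integrable lborel (\<lambda>u. k u * ext G (u * x))" "0 < x"
      have "dil k (ext (F + G)) x = dil k (\<lambda>x. ext F x + ext G x) x"
        by (rule dil_cong_AE) (use 1 ext_add in auto)
      also have "\<dots> = dil k (ext F) x + dil k (ext G) x"
        unfolding dil_def using 1 by (simp add: distrib_left)
      finally show "dil k (ext (F + G)) x = dil k (ext F) x + dil k (ext G) x" .
    qed
  qed
  show "Dil k (c *\<^sub>C F) = c *\<^sub>C Dil k F" for c F
    unfolding Dil_def half_class_scale[OF sq]
  proof (rule half_class_cong[OF sq square_integrable_scale[OF sq]], intro AE_I2 impI)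
    fix x :: real assume "0 < x"
    then have "dil k (ext (c *\<^sub>C F)) x = dil k (\<lambda>x. c * ext F x) x"
      by (intro dil_cong_AE) (use ext_scale in auto)
    also have "\<dots> = c * dil k (ext F) x"
      unfolding dil_def by (simp add: mult.left_commute)
    finally show "dil k (ext (c *\<^sub>C F)) x = c * dil k (ext F) x" .
  qed
  define C where "C = (\<integral>u. cmod (k u) / sqrt u \<partial>lborel)"
  have C: "C \<ge> 0" unfolding C_def
  proof (rule Bochner_Integration.integral_nonneg)
    fix u show "0 \<le> cmod (k u) / sqrt u"
      using k by (cases "u \<le> 0") (auto simp: dil_kernel_def)
  qed
  show "norm (Dil k F) \<le> C * norm F" for F
  proof -
    have "ennreal ((norm (Dil k F))\<^sup>2) \<le> (\<integral>\<^sup>+x. ennreal ((cmod (dil k (ext F) x))\<^sup>2) \<partial>lborel)"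
      unfolding Dil_def by (rule norm_half_class_le[OF sq])
    also have "\<dots> \<le> (ennreal C)\<^sup>2 * ennreal ((norm F)\<^sup>2)"
      using dil_bound[OF k ext_measurable[of F]] by (simp only: C_def nn_norm_ext)
    also have "\<dots> = ennreal ((C * norm F)\<^sup>2)"
      using C by (simp add: ennreal_power ennreal_mult power_mult_distrib)
    finally have "(norm (Dil k F))\<^sup>2 \<le> (C * norm F)\<^sup>2"
      by (subst (asm) ennreal_le_iff) auto
    then show ?thesis using C by (simp add: power2_le_iff_abs_le)
  qed
qed

section \<open>The kernels of the Hoelder and Cesaro operators\<close>

text \<open>
  Euler's integral after the substitution \<open>t = - c ln u\<close>. Taking \<open>c\<close> real avoids complex scaling of the
  path of integration.
\<close>

lemma Gamma_log_integral:
  fixes z :: complex and c :: real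
  assumes z: "Re z > 0" and c: "c > 0"
  defines "f \<equiv> \<lambda>u. indicator {0<..<1::real} u *\<^sub>R
     (of_real (ln (1/u)) powr (z - 1) * complex_of_real (u powr (c - 1)))"
  shows "integrable lborel f" and "(\<integral>u. f u \<partial>lborel) = Gamma z / of_real c powr z"
proof -
  define S where "S = {0<..<1::real}"
  define q where "q t = complex_of_real t powr (z - 1) / of_real (exp t)" for t
  define g where "g u = - c * ln u" for u
  define h where "h u = - c / u" for u :: real
  define r where "r u = of_real (ln (1/u)) powr (z - 1) * complex_of_real (u powr (c - 1))" for u
  have img: "g ` S = {0<..}"
  proof (intro equalityI subsetI)
    fix t :: real assume "t \<in> {0<..}"
    then have "exp (- t / c) \<in> S" "g (exp (- t / c)) = t" using c by (auto simp: S_def g_def)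
    then show "t \<in> g ` S" by (metis imageI)
  qed (use c in \<open>auto simp: S_def g_def mult_less_0_iff\<close>)
  have inj: "inj_on g S" using c by (auto simp: inj_on_def S_def g_def)
  have der: "(g has_field_derivative h x) (at x within S)" if "x \<in> S" for x
    using that unfolding g_def h_def S_def by (auto intro!: derivative_eq_intros)
  have "q absolutely_integrable_on g ` S \<and> integral (g ` S) q = Gamma z"
    unfolding img q_def
    using absolutely_integrable_Gamma_integral'[OF z] Gamma_integral_complex'[OF z] integral_unique by blast
  then have A: "(\<lambda>x. \<bar>h x\<bar> *\<^sub>R q (g x)) absolutely_integrable_on S"
    "integral S (\<lambda>x. \<bar>h x\<bar> *\<^sub>R q (g x)) = Gamma z"
    using has_absolute_integral_change_of_variables_real[OF _ der inj, of q "Gamma z"]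
    by (auto simp: S_def)
  have eq: "\<bar>h x\<bar> *\<^sub>R q (g x) = of_real c powr z * r x" if "x \<in> S" for x
  proof -
    have x: "0 < x" "x < 1" "ln x < 0" using that by (auto simp: S_def)
    have "of_real (g x) = of_real c * complex_of_real (ln (1/x))"
      using x by (simp add: g_def ln_div)
    then have "of_real (g x) powr (z - 1) = of_real c powr (z - 1) * complex_of_real (ln (1/x)) powr (z - 1)"
      using x c by (simp only:) (rule powr_times_real, auto simp: ln_div)
    moreover have cc: "of_real c * complex_of_real c powr (z - 1) = of_real c powr z"
      using c powr_add[of "complex_of_real c" 1 "z - 1"] by simp
    moreover have "\<bar>h x\<bar> / exp (g x) = c * x powr (c - 1)"
      using x c by (simp add: h_def g_def powr_def exp_minus exp_diff field_simps)
    moreover have "\<bar>h x\<bar> *\<^sub>R q (g x) = complex_of_real (\<bar>h x\<bar> / exp (g x)) * of_real (g x) powr (z - 1)"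
      by (simp add: q_def scaleR_conv_of_real)
    ultimately have "\<bar>h x\<bar> *\<^sub>R q (g x) = (of_real c * of_real (x powr (c - 1)))
        * (of_real c powr (z - 1) * complex_of_real (ln (1/x)) powr (z - 1))"
      by (simp only: of_real_mult)
    also have "\<dots> = (of_real c * of_real c powr (z - 1)) * r x"
      by (simp only: r_def mult_ac)
    also have "of_real c * complex_of_real c powr (z - 1) = of_real c powr z" by (rule cc)
    finally show ?thesis .
  qed
  have nz: "of_real c powr z \<noteq> 0" using c by simp
  have "(\<lambda>x. of_real c powr z * r x) absolutely_integrable_on S"
    using A(1) eq by (subst set_integrable_cong[OF refl refl]) auto
  then have rI: "r absolutely_integrable_on S" using nz by simp
  have rG: "integral S r = Gamma z / of_real c powr z"
  proof -
    have "Gamma z = integral S (\<lambda>x. of_real c powr z * r x)"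
      unfolding A(2)[symmetric] by (rule integral_cong) (rule eq)
    then show ?thesis using nz by simp
  qed
  have "f = (\<lambda>u. if 0 < u \<and> u < 1 then exp ((z - 1) * of_real (ln (ln (1/u)))) * complex_of_real (u powr (c - 1)) else 0)"
    by (auto simp: f_def fun_eq_iff powr_def Ln_of_real)
  then have fm: "f \<in> borel_measurable lborel" by simp
  have fi: "integrable lebesgue f"
    using rI by (simp add: set_integrable_def f_def S_def r_def)
  then show "integrable lborel f" using integrable_completion[OF fm] by simp
  then have "set_integrable lborel S r" by (simp add: set_integrable_def f_def S_def r_def)
  from set_borel_integral_eq_integral(2)[OF this] rG
  show "(\<integral>u. f u \<partial>lborel) = Gamma z / of_real c powr z"
    by (simp add: set_lebesgue_integral_def f_def S_def r_def)
qed

definition holder_kernel :: "complex \<Rightarrow> real \<Rightarrow> complex" where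
  "holder_kernel \<alpha> u = (if 0 < u \<and> u < 1 then of_real (ln (1/u)) powr (\<alpha> - 1) / Gamma \<alpha> else 0)"

lemma holder_kernel_measurable: "holder_kernel \<alpha> \<in> borel_measurable borel"
proof -
  have "holder_kernel \<alpha> = (\<lambda>u. if 0 < u \<and> u < 1 then exp ((\<alpha> - 1) * of_real (ln (ln (1/u)))) / Gamma \<alpha> else 0)"
    by (auto simp: holder_kernel_def fun_eq_iff powr_def Ln_of_real)
  then show ?thesis by simp
qed

lemma holder_kernel_one: "holder_kernel 1 u = (if 0 < u \<and> u < 1 then 1 else 0)"
  by (auto simp: holder_kernel_def)

lemma dil_kernel_holder:
  assumes "Re \<alpha> > 0" shows "dil_kernel (holder_kernel \<alpha>)"
  unfolding dil_kernel_def
proof (intro conjI holder_kernel_measurable allI impI)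
  show "holder_kernel \<alpha> u = 0" if "u \<le> 0" for u using that by (simp add: holder_kernel_def)
  have "integrable lborel (\<lambda>u. 1 / cmod (Gamma \<alpha>) * cmod (indicator {0<..<1::real} u *\<^sub>R
     (of_real (ln (1/u)) powr (\<alpha> - 1) * complex_of_real (u powr (1/2 - 1)))))"
    using Gamma_log_integral(1)[OF assms, of "1/2"] by (intro integrable_mult_right integrable_norm) auto
  also have "(\<lambda>u. 1 / cmod (Gamma \<alpha>) * cmod (indicator {0<..<1::real} u *\<^sub>R
     (of_real (ln (1/u)) powr (\<alpha> - 1) * complex_of_real (u powr (1/2 - 1)))))
     = (\<lambda>u. cmod (holder_kernel \<alpha> u) / sqrt u)"
    by (auto simp: fun_eq_iff holder_kernel_def norm_mult norm_divide powr_minus_divide powr_half_sqrt)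
  finally show "integrable lborel (\<lambda>u. cmod (holder_kernel \<alpha> u) / sqrt u)" .
qed

text \<open>
  This is the factor by which the Hoelder operator multiplies \<open>x\<^sup>n\<close> near \<open>0\<close>.
\<close>

lemma holder_kernel_moment:
  assumes "Re \<alpha> > 0"
  shows "(\<integral>u. holder_kernel \<alpha> u * of_real u ^ n \<partial>lborel) = (1 / of_nat (Suc n)) powr \<alpha>"
proof -
  have "Gamma \<alpha> \<noteq> 0" using assms by (auto simp: Gamma_eq_zero_iff elim!: nonpos_Ints_cases)
  have "holder_kernel \<alpha> u * of_real u ^ n = 1 / Gamma \<alpha> * (indicator {0<..<1::real} u *\<^sub>R
     (of_real (ln (1/u)) powr (\<alpha> - 1) * complex_of_real (u powr (real (Suc n) - 1))))" for u
    by (auto simp: holder_kernel_def powr_realpow)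
  then have "(\<integral>u. holder_kernel \<alpha> u * of_real u ^ n \<partial>lborel) = 1 / Gamma \<alpha> * (Gamma \<alpha> / of_real (real (Suc n)) powr \<alpha>)"
    using Gamma_log_integral(2)[OF assms, of "real (Suc n)"]
    by (simp only: Bochner_Integration.integral_mult_right_zero of_nat_0_less_iff zero_less_Suc)
  also have "\<dots> = 1 / of_real (real (Suc n)) powr \<alpha>" using \<open>Gamma \<alpha> \<noteq> 0\<close> by simp
  also have "\<dots> = of_real (1 / real (Suc n)) powr \<alpha>"
    by (simp add: powr_def Ln_of_real ln_div exp_minus field_simps del: of_real_divide of_real_of_nat_eq of_nat_Suc)
  finally show ?thesis by simp
qed

definition cesaro_adj_kernel :: "real \<Rightarrow> complex" where
  "cesaro_adj_kernel u = (if 1 < u then of_real (1 / u) else 0)"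

lemma dil_kernel_cesaro_adj: "dil_kernel cesaro_adj_kernel"
  unfolding dil_kernel_def
proof (intro conjI allI impI)
  show "cesaro_adj_kernel \<in> borel_measurable borel" unfolding cesaro_adj_kernel_def[abs_def] by measurable
  show "cesaro_adj_kernel u = 0" if "u \<le> 0" for u using that by (simp add: cesaro_adj_kernel_def)
  define p where "p u = (1 / u) / sqrt u" for u :: real
  have "(\<integral>\<^sup>+x. ennreal (p x) * indicator {1..} x \<partial>lborel) = ennreal (0 - (- 2 / sqrt 1))"
  proof (rule nn_integral_FTC_atLeast)
    show "p \<in> borel_measurable borel" unfolding p_def[abs_def] by measurable
    show "DERIV (\<lambda>x. - 2 / sqrt x) x :> p x" if "1 \<le> x" for x
      unfolding p_def using that by (auto intro!: derivative_eq_intros simp: field_simps)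
    show "0 \<le> p x" if "1 \<le> x" for x using that by (simp add: p_def)
    show "((\<lambda>x. - 2 / sqrt x) \<longlongrightarrow> 0) at_top"
      by (intro tendsto_divide_0[OF tendsto_const] filterlim_at_top_imp_at_infinity sqrt_at_top)
  qed
  then have fin: "(\<integral>\<^sup>+x. ennreal (p x) * indicator {1..} x \<partial>lborel) < \<infinity>" by simp
  show "integrable lborel (\<lambda>u. cmod (cesaro_adj_kernel u) / sqrt u)"
  proof (rule integrableI_bounded)
    show "(\<lambda>u. cmod (cesaro_adj_kernel u) / sqrt u) \<in> borel_measurable lborel"
      unfolding cesaro_adj_kernel_def by measurable
    have "(\<integral>\<^sup>+u. ennreal (norm (cmod (cesaro_adj_kernel u) / sqrt u)) \<partial>lborel)
        \<le> (\<integral>\<^sup>+x. ennreal (p x) * indicator {1..} x \<partial>lborel)"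
      by (rule nn_integral_mono) (auto simp: cesaro_adj_kernel_def p_def indicator_def norm_divide)
    then show "(\<integral>\<^sup>+u. ennreal (norm (cmod (cesaro_adj_kernel u) / sqrt u)) \<partial>lborel) < \<infinity>"
      using fin by (rule le_less_trans)
  qed
qed

lemma dil_cesaro:
  assumes "x > 0"
  shows "dil (holder_kernel 1) g x = (\<integral>t. (if 0 < t \<and> t < x then g t else 0) \<partial>lborel) / of_real x"
    and "integrable lborel (\<lambda>u. holder_kernel 1 u * g (u * x))
      \<longleftrightarrow> integrable lborel (\<lambda>t. if 0 < t \<and> t < x then g t else 0)"
proof -
  have eq: "(if 0 < 0 + x * u \<and> 0 + x * u < x then g (0 + x * u) else 0) = holder_kernel 1 u * g (u * x)" for u
    using assms by (auto simp: holder_kernel_one mult.commute zero_less_mult_iff)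
  show "dil (holder_kernel 1) g x = (\<integral>t. (if 0 < t \<and> t < x then g t else 0) \<partial>lborel) / of_real x"
    using assms unfolding dil_def
    by (subst lborel_integral_real_affine[of x _ 0], simp, unfold eq) (simp add: scaleR_conv_of_real)
  show "integrable lborel (\<lambda>u. holder_kernel 1 u * g (u * x))
      \<longleftrightarrow> integrable lborel (\<lambda>t. if 0 < t \<and> t < x then g t else 0)"
    using lborel_integrable_real_affine_iff[of x "\<lambda>t. if 0 < t \<and> t < x then g t else 0" 0] assms
    unfolding eq by simp
qed

lemma dil_cesaro_adj:
  assumes "x > 0"
  shows "dil cesaro_adj_kernel g x = (\<integral>t. (if x < t then g t / of_real t else 0) \<partial>lborel)"
    and "integrable lborel (\<lambda>u. cesaro_adj_kernel u * g (u * x))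
      \<longleftrightarrow> integrable lborel (\<lambda>t. if x < t then g t / of_real t else 0)"
proof -
  have eq: "(if x < 0 + x * u then g (0 + x * u) / of_real (0 + x * u) else 0)
      = (cesaro_adj_kernel u * g (u * x)) / of_real x" for u
    using assms by (auto simp: cesaro_adj_kernel_def field_simps)
  show "dil cesaro_adj_kernel g x = (\<integral>t. (if x < t then g t / of_real t else 0) \<partial>lborel)"
    using assms unfolding dil_def
    by (subst lborel_integral_real_affine[of x _ 0], simp, unfold eq) (simp add: scaleR_conv_of_real)
  show "integrable lborel (\<lambda>u. cesaro_adj_kernel u * g (u * x))
      \<longleftrightarrow> integrable lborel (\<lambda>t. if x < t then g t / of_real t else 0)"
  proof -
    have "integrable lborel (\<lambda>u. cesaro_adj_kernel u * g (u * x))"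
      if "integrable lborel (\<lambda>u. (cesaro_adj_kernel u * g (u * x)) / of_real x)"
      using Bochner_Integration.integrable_mult_left[OF that, of "of_real x"] assms by simp
    then have "integrable lborel (\<lambda>u. (cesaro_adj_kernel u * g (u * x)) / of_real x)
        \<longleftrightarrow> integrable lborel (\<lambda>u. cesaro_adj_kernel u * g (u * x))"
      by (intro iffI Bochner_Integration.integrable_divide)
    moreover have "integrable lborel (\<lambda>u. (cesaro_adj_kernel u * g (u * x)) / of_real x)
        \<longleftrightarrow> integrable lborel (\<lambda>t. if x < t then g t / of_real t else 0)"
      using lborel_integrable_real_affine_iff[of x "\<lambda>t. if x < t then g t / of_real t else 0" 0] assms
      unfolding eq by simp
    ultimately show ?thesis by simp
  qed
qed

lemma cesaro_plus_eq_Dil: "cesaro_plus = Dil (holder_kernel 1)"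
proof
  fix F
  have sq: "square_integrable lborel (dil (holder_kernel 1) (ext F))"
    by (intro square_integrable_dil dil_kernel_holder square_integrable_ext) simp
  have eq: "(1 / x) *\<^sub>R (LINT t:{0<..<x}|lborel. L2_fun F t) = dil (holder_kernel 1) (ext F) x" if "x > 0" for x
  proof -
    have "(LINT t:{0<..<x}|lborel. L2_fun F t) = (\<integral>t. (if 0 < t \<and> t < x then ext F t else 0) \<partial>lborel)"
      unfolding set_lebesgue_integral_def
      by (rule Bochner_Integration.integral_cong) (auto simp: ext_def indicator_def)
    then show ?thesis using that by (simp add: dil_cesaro(1) scaleR_conv_of_real)
  qed
  have "(\<lambda>x. if 0 < x then (1 / x) *\<^sub>R (LINT t:{0<..<x}|lborel. L2_fun F t) else 0)
      = (\<lambda>x. if 0 < x then dil (holder_kernel 1) (ext F) x else 0)"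
  proof (rule ext)
    fix x
    show "(if 0 < x then (1 / x) *\<^sub>R (LINT t:{0<..<x}|lborel. L2_fun F t) else 0)
      = (if 0 < x then dil (holder_kernel 1) (ext F) x else 0)"
      by (cases "0 < x") (simp_all only: eq if_True if_False)
  qed
  then have sqf: "square_integrable (line_measure TYPE(half_line)) (\<lambda>x. (1 / x) *\<^sub>R (LINT t:{0<..<x}|lborel. L2_fun F t))"
    using square_integrable_half_if[OF sq] unfolding square_integrable_half by (simp only:)
  show "cesaro_plus F = Dil (holder_kernel 1) F"
    unfolding cesaro_plus_def Dil_def L2_class_eq_iff[OF sqf square_integrable_half_if[OF sq]] AE_half
  proof (intro AE_I2 impI)
    fix x :: real assume "0 < x"
    then show "(1 / x) *\<^sub>R (LINT t:{0<..<x}|lborel. L2_fun F t) = dil (holder_kernel 1) (ext F) x"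
      by (rule eq)
  qed
qed

section \<open>The Cesaro operator is one plus a unitary\<close>

lemma integral_inverse_square:
  fixes m :: real assumes m: "m > 0"
  shows "(\<integral>t. (if m < t then complex_of_real (1 / t\<^sup>2) else 0) \<partial>lborel) = of_real (1 / m)"
proof -
  have "(\<integral>\<^sup>+t. ennreal (1 / t\<^sup>2) * indicator {m..} t \<partial>lborel) = ennreal (0 - (- (1 / m)))"
  proof (rule nn_integral_FTC_atLeast)
    show "(\<lambda>t. 1 / t\<^sup>2 :: real) \<in> borel_measurable borel" by measurable
    show "DERIV (\<lambda>x. - (1 / x)) x :> 1 / x\<^sup>2" if "m \<le> x" for x
      using that m by (auto intro!: derivative_eq_intros simp: power2_eq_square)
    have "((\<lambda>x::real. - (1 / x)) \<longlongrightarrow> - 0) at_top"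
      by (intro tendsto_minus tendsto_divide_0[OF tendsto_const] filterlim_at_top_imp_at_infinity filterlim_ident)
    then show "((\<lambda>x::real. - (1 / x)) \<longlongrightarrow> 0) at_top" by simp
  qed simp
  also have "(\<integral>\<^sup>+t. ennreal (1 / t\<^sup>2) * indicator {m..} t \<partial>lborel)
      = (\<integral>\<^sup>+t. ennreal (if m < t then 1 / t\<^sup>2 else 0) \<partial>lborel)"
    using AE_lborel_singleton[of m] by (intro nn_integral_cong_AE) (auto simp: indicator_def elim!: eventually_mono)
  finally have "has_bochner_integral lborel (\<lambda>t. if m < t then 1 / t\<^sup>2 else 0) (1 / m)"
    using m by (intro has_bochner_integral_nn_integral) auto
  then have "(\<integral>t. (if m < t then 1 / t\<^sup>2 else 0) \<partial>lborel) = 1 / m"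
    by (rule has_bochner_integral_integral_eq)
  then have "(\<integral>t. complex_of_real (if m < t then 1 / t\<^sup>2 else 0) \<partial>lborel) = of_real (1 / m)"
    by (simp only: integral_complex_of_real)
  then show ?thesis by (simp add: if_distrib[of complex_of_real] cong: if_cong)
qed

lemma integral_interval_const:
  fixes m :: real assumes m: "m > 0"
  shows "(\<integral>t. (if 0 < t \<and> t < m then c else 0) \<partial>lborel) = of_real m * (c::complex)"
proof -
  have "(\<integral>t. (if 0 < t \<and> t < m then c else 0) \<partial>lborel) = (\<integral>t. indicator {0<..<m} t *\<^sub>R c \<partial>lborel)"
    by (rule Bochner_Integration.integral_cong) (auto simp: indicator_def)
  also have "\<dots> = of_real m * c" using m by (simp add: scaleR_conv_of_real)
  finally show ?thesis .
qed

lemma square_integrable_cmod: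
  "square_integrable M g \<Longrightarrow> square_integrable M (\<lambda>x. complex_of_real (cmod (g x)))"
  unfolding square_integrable_def
proof (elim conjE, intro conjI)
  assume [measurable]: "g \<in> borel_measurable M"
  show "(\<lambda>x. complex_of_real (cmod (g x))) \<in> borel_measurable M" by measurable
qed simp

text \<open>
  Both products of \<open>\<C>\<close> and its adjoint are the integral operator with kernel \<open>1 / max x s\<close>,
  by Fubini from \<open>\<integral>\<^sub>m\<^sup>\<infinity> t\<^sup>-\<^sup>2 dt = 1/m\<close> and \<open>min x s / (x s) = 1 / max x s\<close>; splitting at
  \<open>s = x\<close> this is the sum of the two operators.
\<close>

definition max_kernel_op :: "(real \<Rightarrow> complex) \<Rightarrow> real \<Rightarrow> complex" where
  "max_kernel_op g x = (\<integral>s. (if 0 < s then g s / of_real (max x s) else 0) \<partial>lborel)"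

lemma max_kernel_op_eq:
  assumes g: "square_integrable lborel g"
  shows "AE x in lborel. 0 < x \<longrightarrow>
     max_kernel_op g x = dil (holder_kernel 1) g x + dil cesaro_adj_kernel g x"
proof -
  have k1: "dil_kernel (holder_kernel 1)" by (rule dil_kernel_holder) simp
  show ?thesis
    using dil_AE_integrable[OF k1 g] dil_AE_integrable[OF dil_kernel_cesaro_adj g]
  proof (eventually_elim, intro impI)
    fix x :: real
    assume i: "integrable lborel (\<lambda>u. holder_kernel 1 u * g (u * x))"
      "integrable lborel (\<lambda>u. cesaro_adj_kernel u * g (u * x))" and x: "0 < x"
    note i1 = i(1)[unfolded dil_cesaro(2)[OF x]] and i2 = i(2)[unfolded dil_cesaro_adj(2)[OF x]]
    have gm [measurable]: "g \<in> borel_measurable borel" using g by (simp add: square_integrable_def)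
    have "max_kernel_op g x = (\<integral>s. (if 0 < s \<and> s < x then g s else 0) / of_real x
        + (if x < s then g s / of_real s else 0) \<partial>lborel)"
      unfolding max_kernel_op_def
    proof (rule integral_cong_AE)
      show "AE s in lborel. (if 0 < s then g s / of_real (max x s) else 0)
          = (if 0 < s \<and> s < x then g s else 0) / of_real x + (if x < s then g s / of_real s else 0)"
        using AE_lborel_singleton[of x] by eventually_elim (use x in \<open>auto simp: max_def\<close>)
    qed measurable
    also have "\<dots> = (\<integral>s. (if 0 < s \<and> s < x then g s else 0) / of_real x \<partial>lborel)
        + (\<integral>s. (if x < s then g s / of_real s else 0) \<partial>lborel)"
      by (rule Bochner_Integration.integral_add[OF _ i2]) (use i1 in simp)
    also have "\<dots> = dil (holder_kernel 1) g x + dil cesaro_adj_kernel g x"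
      using x by (simp add: dil_cesaro(1) dil_cesaro_adj(1))
    finally show "max_kernel_op g x = dil (holder_kernel 1) g x + dil cesaro_adj_kernel g x" .
  qed
qed

lemma dil_adj_cesaro:
  assumes g: "square_integrable lborel g"
  shows "AE x in lborel. 0 < x \<longrightarrow>
     dil cesaro_adj_kernel (dil (holder_kernel 1) g) x = max_kernel_op g x"
proof -
  have k1: "dil_kernel (holder_kernel 1)" by (rule dil_kernel_holder) simp
  have gm [measurable]: "g \<in> borel_measurable borel" using g by (simp add: square_integrable_def)
  define A where "A = dil (holder_kernel 1) (\<lambda>x. complex_of_real (cmod (g x)))"
  have sA: "square_integrable lborel A"
    unfolding A_def by (rule square_integrable_dil[OF k1 square_integrable_cmod[OF g]])
  have ig: "AE t in lborel. 0 < t \<longrightarrow> integrable lborel (\<lambda>s. if 0 < s \<and> s < t then g s else 0)"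
    using dil_AE_integrable[OF k1 g]
  proof eventually_elim
    case (elim t)
    show ?case
    proof
      assume t: "0 < t"
      show "integrable lborel (\<lambda>s. if 0 < s \<and> s < t then g s else 0)"
        using elim unfolding dil_cesaro(2)[OF t] .
    qed
  qed
  show ?thesis
    using dil_AE_integrable[OF dil_kernel_cesaro_adj sA]
  proof (eventually_elim, intro impI)
    fix x :: real
    assume i: "integrable lborel (\<lambda>u. cesaro_adj_kernel u * A (u * x))" and x: "0 < x"
    note iA = i[unfolded dil_cesaro_adj(2)[OF x]]
    define \<phi> where "\<phi> t s = (if x < t \<and> 0 < s \<and> s < t then g s / (of_real t)\<^sup>2 else 0)" for t s
    have \<phi>m [measurable]: "case_prod \<phi> \<in> borel_measurable (lborel \<Otimes>\<^sub>M lborel)"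
      unfolding \<phi>_def by measurable
    have \<phi>t: "\<phi> t s = (if x < t then (if 0 < s \<and> s < t then g s else 0) / (of_real t)\<^sup>2 else 0)" for t s
      by (auto simp: \<phi>_def)
    have int: "integrable (lborel \<Otimes>\<^sub>M lborel) (case_prod \<phi>)"
    proof (rule lborel_pair.Fubini_integrable[OF \<phi>m])
      have "(\<integral>s. norm (case_prod \<phi> (t, s)) \<partial>lborel) = Re (if x < t then A t / of_real t else 0)" for t
      proof (cases "x < t")
        case True
        then have t: "t > 0" using x by simp
        have "A t / of_real t = (\<integral>s. complex_of_real (if 0 < s \<and> s < t then cmod (g s) else 0) \<partial>lborel) / (of_real t)\<^sup>2"
          unfolding A_def dil_cesaro(1)[OF t] by (simp add: power2_eq_square if_distrib[of complex_of_real] cong: if_cong)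
        also have "\<dots> = of_real ((\<integral>s. (if 0 < s \<and> s < t then cmod (g s) else 0) \<partial>lborel) / t\<^sup>2)"
          by simp
        also have "(\<integral>s. (if 0 < s \<and> s < t then cmod (g s) else 0) \<partial>lborel) / t\<^sup>2
            = (\<integral>s. (if 0 < s \<and> s < t then cmod (g s) else 0) / t\<^sup>2 \<partial>lborel)"
          by simp
        also have "\<dots> = (\<integral>s. norm (case_prod \<phi> (t, s)) \<partial>lborel)"
          by (rule Bochner_Integration.integral_cong) (use True in \<open>auto simp: \<phi>_def norm_divide norm_power\<close>)
        finally show ?thesis using True by simp
      qed (simp add: \<phi>_def)
      then show "integrable lborel (\<lambda>t. \<integral>s. norm (case_prod \<phi> (t, s)) \<partial>lborel)"
        using integrable_Re[OF iA] by (simp only:)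
      show "AE t in lborel. integrable lborel (\<lambda>s. case_prod \<phi> (t, s))"
        using ig
      proof eventually_elim
        case (elim t)
        show ?case
        proof (cases "x < t")
          case True then show ?thesis using elim x by (simp add: \<phi>t)
        qed (simp add: \<phi>t)
      qed
    qed
    have "dil cesaro_adj_kernel (dil (holder_kernel 1) g) x = (\<integral>t. (\<integral>s. \<phi> t s \<partial>lborel) \<partial>lborel)"
      unfolding dil_cesaro_adj(1)[OF x]
    proof (rule Bochner_Integration.integral_cong[OF refl])
      fix t
      show "(if x < t then dil (holder_kernel 1) g t / of_real t else 0) = (\<integral>s. \<phi> t s \<partial>lborel)"
        using x by (cases "x < t") (auto simp: dil_cesaro(1) \<phi>t power2_eq_square)
    qed
    also have "\<dots> = (\<integral>s. (\<integral>t. \<phi> t s \<partial>lborel) \<partial>lborel)"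
      by (rule lborel_pair.Fubini_integral[OF int, symmetric])
    also have "\<dots> = max_kernel_op g x"
      unfolding max_kernel_op_def
    proof (rule Bochner_Integration.integral_cong[OF refl])
      fix s
      show "(\<integral>t. \<phi> t s \<partial>lborel) = (if 0 < s then g s / of_real (max x s) else 0)"
      proof (cases "0 < s")
        case True
        have "(\<integral>t. \<phi> t s \<partial>lborel) = (\<integral>t. g s * (if max x s < t then complex_of_real (1 / t\<^sup>2) else 0) \<partial>lborel)"
          by (rule Bochner_Integration.integral_cong) (use True in \<open>auto simp: \<phi>_def\<close>)
        also have "\<dots> = g s * (\<integral>t. (if max x s < t then complex_of_real (1 / t\<^sup>2) else 0) \<partial>lborel)"
          by (rule Bochner_Integration.integral_mult_right_zero)
        also have "\<dots> = g s * of_real (1 / max x s)"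
          by (subst integral_inverse_square) (use x in auto)
        finally show ?thesis using True by simp
      qed (simp add: \<phi>_def)
    qed
    finally show "dil cesaro_adj_kernel (dil (holder_kernel 1) g) x = max_kernel_op g x" .
  qed
qed

lemma dil_cesaro_adj_swap:
  assumes g: "square_integrable lborel g"
  shows "AE x in lborel. 0 < x \<longrightarrow>
     dil (holder_kernel 1) (dil cesaro_adj_kernel g) x = max_kernel_op g x"
proof -
  have k1: "dil_kernel (holder_kernel 1)" by (rule dil_kernel_holder) simp
  have gm [measurable]: "g \<in> borel_measurable borel" using g by (simp add: square_integrable_def)
  define B where "B = dil cesaro_adj_kernel (\<lambda>x. complex_of_real (cmod (g x)))"
  have sB: "square_integrable lborel B"
    unfolding B_def by (rule square_integrable_dil[OF dil_kernel_cesaro_adj square_integrable_cmod[OF g]])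
  have ig: "AE t in lborel. 0 < t \<longrightarrow> integrable lborel (\<lambda>s. if t < s then g s / of_real s else 0)"
    using dil_AE_integrable[OF dil_kernel_cesaro_adj g]
  proof eventually_elim
    case (elim t)
    show ?case
    proof
      assume t: "0 < t"
      show "integrable lborel (\<lambda>s. if t < s then g s / of_real s else 0)"
        using elim unfolding dil_cesaro_adj(2)[OF t] .
    qed
  qed
  show ?thesis
    using dil_AE_integrable[OF k1 sB]
  proof (eventually_elim, intro impI)
    fix x :: real
    assume i: "integrable lborel (\<lambda>u. holder_kernel 1 u * B (u * x))" and x: "0 < x"
    note iB = i[unfolded dil_cesaro(2)[OF x]]
    define \<phi> where "\<phi> t s = (if 0 < t \<and> t < x \<and> t < s then g s / of_real s else 0)" for t s
    have \<phi>m [measurable]: "case_prod \<phi> \<in> borel_measurable (lborel \<Otimes>\<^sub>M lborel)"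
      unfolding \<phi>_def by measurable
    have \<phi>t: "\<phi> t s = (if 0 < t \<and> t < x then (if t < s then g s / of_real s else 0) else 0)" for t s
      by (auto simp: \<phi>_def)
    have int: "integrable (lborel \<Otimes>\<^sub>M lborel) (case_prod \<phi>)"
    proof (rule lborel_pair.Fubini_integrable[OF \<phi>m])
      have "(\<integral>s. norm (case_prod \<phi> (t, s)) \<partial>lborel) = Re (if 0 < t \<and> t < x then B t else 0)" for t
      proof (cases "0 < t \<and> t < x")
        case True
        then have t: "t > 0" by simp
        have "B t = (\<integral>s. complex_of_real (if t < s then cmod (g s) / s else 0) \<partial>lborel)"
          unfolding B_def dil_cesaro_adj(1)[OF t] by (simp add: if_distrib[of complex_of_real] cong: if_cong)
        also have "\<dots> = of_real (\<integral>s. (if t < s then cmod (g s) / s else 0) \<partial>lborel)"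
          by (rule integral_complex_of_real)
        also have "(\<integral>s. (if t < s then cmod (g s) / s else 0) \<partial>lborel) = (\<integral>s. norm (case_prod \<phi> (t, s)) \<partial>lborel)"
          by (rule Bochner_Integration.integral_cong) (use True in \<open>auto simp: \<phi>_def norm_divide\<close>)
        finally show ?thesis using True by simp
      qed (auto simp: \<phi>_def)
      then show "integrable lborel (\<lambda>t. \<integral>s. norm (case_prod \<phi> (t, s)) \<partial>lborel)"
        using integrable_Re[OF iB] by (simp only:)
      show "AE t in lborel. integrable lborel (\<lambda>s. case_prod \<phi> (t, s))"
        using ig
      proof eventually_elim
        case (elim t)
        show ?case
        proof (cases "0 < t \<and> t < x")
          case True then show ?thesis using elim by (simp add: \<phi>t)
        next
          case False
          then have "case_prod \<phi> (t, s) = 0" for s by (auto simp: \<phi>_def)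
          then show ?thesis by simp
        qed
      qed
    qed
    have "dil (holder_kernel 1) (dil cesaro_adj_kernel g) x = (\<integral>t. (\<integral>s. \<phi> t s \<partial>lborel) \<partial>lborel) / of_real x"
      unfolding dil_cesaro(1)[OF x]
    proof (rule arg_cong[where f="\<lambda>y. y / of_real x"], rule Bochner_Integration.integral_cong[OF refl])
      fix t
      show "(if 0 < t \<and> t < x then dil cesaro_adj_kernel g t else 0) = (\<integral>s. \<phi> t s \<partial>lborel)"
      proof (cases "0 < t \<and> t < x")
        case True then show ?thesis by (simp add: dil_cesaro_adj(1) \<phi>t)
      next
        case False
        then have "\<phi> t s = 0" for s by (auto simp: \<phi>_def)
        then show ?thesis using False by auto
      qed
    qed
    also have "(\<integral>t. (\<integral>s. \<phi> t s \<partial>lborel) \<partial>lborel) = (\<integral>s. (\<integral>t. \<phi> t s \<partial>lborel) \<partial>lborel)"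
      by (rule lborel_pair.Fubini_integral[OF int, symmetric])
    also have "\<dots> / of_real x = (\<integral>s. (\<integral>t. \<phi> t s \<partial>lborel) / of_real x \<partial>lborel)" by simp
    also have "\<dots> = max_kernel_op g x"
      unfolding max_kernel_op_def
    proof (rule Bochner_Integration.integral_cong[OF refl])
      fix s
      show "(\<integral>t. \<phi> t s \<partial>lborel) / of_real x = (if 0 < s then g s / of_real (max x s) else 0)"
      proof (cases "0 < s")
        case True
        have "(\<integral>t. \<phi> t s \<partial>lborel) = (\<integral>t. (if 0 < t \<and> t < min x s then g s / of_real s else 0) \<partial>lborel)"
          by (rule Bochner_Integration.integral_cong) (auto simp: \<phi>_def)
        also have "\<dots> = of_real (min x s) * (g s / of_real s)"
          by (rule integral_interval_const) (use True x in auto)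
        finally show ?thesis using True x by (auto simp: min_def max_def)
      next
        case False
        then have "\<phi> t s = 0" for t by (auto simp: \<phi>_def)
        then show ?thesis using False by simp
      qed
    qed
    finally show "dil (holder_kernel 1) (dil cesaro_adj_kernel g) x = max_kernel_op g x" .
  qed
qed

lemma borel_measurable_cnj [measurable (raw)]:
  assumes "f \<in> borel_measurable M" shows "(\<lambda>x. cnj (f x)) \<in> borel_measurable M"
proof -
  have "continuous_on UNIV cnj" by (rule continuous_on_cnj, rule continuous_on_id)
  then have "cnj \<in> borel_measurable borel" by (rule borel_measurable_continuous_onI)
  with assms show ?thesis by (rule measurable_compose)
qed

text \<open>
  Fubini's theorem; absolute integrability holds because averaging the modulus of \<open>f\<close> gives again a
  function in \<open>L\<^sup>2\<close>.
\<close>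

lemma cinner_cesaro:
  "cinner (Dil (holder_kernel 1) F) G = cinner F (Dil cesaro_adj_kernel G)"
proof -
  have k1: "dil_kernel (holder_kernel 1)" by (rule dil_kernel_holder) simp
  define f g where "f = ext F" and "g = ext G"
  have f: "square_integrable lborel f" and g: "square_integrable lborel g"
    by (simp_all add: f_def g_def square_integrable_ext)
  have [measurable]: "f \<in> borel_measurable borel" "g \<in> borel_measurable borel" by (simp_all add: f_def g_def)
  have f0: "f x = 0" and g0: "g x = 0" if "x \<le> 0" for x using that by (simp_all add: f_def g_def ext_def)
  define A where "A = dil (holder_kernel 1) (\<lambda>x. complex_of_real (cmod (f x)))"
  have sA: "square_integrable lborel A"
    unfolding A_def by (rule square_integrable_dil[OF k1 square_integrable_cmod[OF f]])
  have [measurable]: "A \<in> borel_measurable borel" using sA by (simp add: square_integrable_def)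
  define \<phi> where "\<phi> x t = (if 0 < t \<and> t < x then f t else 0) / of_real x * cnj (g x)" for x t
  have \<phi>m [measurable]: "case_prod \<phi> \<in> borel_measurable (lborel \<Otimes>\<^sub>M lborel)"
    unfolding \<phi>_def by measurable
  have \<phi>m' [measurable]: "(\<lambda>(t, x). \<phi> x t) \<in> borel_measurable (lborel \<Otimes>\<^sub>M lborel)"
    unfolding \<phi>_def by measurable
  note m = lborel.borel_measurable_lebesgue_integral[OF \<phi>m] lborel.borel_measurable_lebesgue_integral[OF \<phi>m']
  have \<phi>0: "\<phi> x t = 0" if "x \<le> 0" for x t using that by (simp add: \<phi>_def g0)
  have int: "integrable (lborel \<Otimes>\<^sub>M lborel) (case_prod \<phi>)"
  proof (rule lborel_pair.Fubini_integrable[OF \<phi>m])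
    have "(\<integral>t. norm (case_prod \<phi> (x, t)) \<partial>lborel) = Re (A x * cnj (complex_of_real (cmod (g x))))" for x
    proof (cases "0 < x")
      case True
      have "A x = (\<integral>t. complex_of_real (if 0 < t \<and> t < x then cmod (f t) else 0) \<partial>lborel) / of_real x"
        unfolding A_def dil_cesaro(1)[OF True] by (simp add: if_distrib[of complex_of_real] cong: if_cong)
      also have "\<dots> = of_real ((\<integral>t. (if 0 < t \<and> t < x then cmod (f t) else 0) \<partial>lborel) / x)"
        by simp
      finally have "Re (A x * cnj (complex_of_real (cmod (g x))))
          = (\<integral>t. (if 0 < t \<and> t < x then cmod (f t) else 0) \<partial>lborel) / x * cmod (g x)" by simp
      also have "\<dots> = (\<integral>t. (if 0 < t \<and> t < x then cmod (f t) else 0) / x * cmod (g x) \<partial>lborel)"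
        by simp
      also have "\<dots> = (\<integral>t. norm (case_prod \<phi> (x, t)) \<partial>lborel)"
        by (rule Bochner_Integration.integral_cong) (use True in \<open>auto simp: \<phi>_def norm_divide norm_mult\<close>)
      finally show ?thesis ..
    next
      case False
      then show ?thesis by (simp add: \<phi>0 g0)
    qed
    then show "integrable lborel (\<lambda>x. \<integral>t. norm (case_prod \<phi> (x, t)) \<partial>lborel)"
      using integrable_Re[OF square_integrable_prod[OF sA square_integrable_cmod[OF g]]] by (simp only:)
    show "AE x in lborel. integrable lborel (\<lambda>t. case_prod \<phi> (x, t))"
      using dil_AE_integrable[OF k1 f]
    proof eventually_elim
      case (elim x)
      show ?case
      proof (cases "0 < x")
        case True
        then show ?thesis using elim unfolding dil_cesaro(2)[OF True]
          by (simp add: \<phi>_def)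
      qed (simp add: \<phi>0)
    qed
  qed
  have "cinner (Dil (holder_kernel 1) F) G = (\<integral>x. (\<integral>t. \<phi> x t \<partial>lborel) \<partial>lborel)"
    unfolding cinner_ext
  proof (rule integral_cong_AE)
    show "AE x in lborel. ext (Dil (holder_kernel 1) F) x * cnj (ext G x) = (\<integral>t. \<phi> x t \<partial>lborel)"
      using ext_Dil[OF k1, of F]
    proof eventually_elim
      case (elim x)
      show ?case
      proof (cases "0 < x")
        case True
        then show ?thesis using elim unfolding \<phi>_def f_def g_def by (simp add: dil_cesaro(1))
      next
        case False
        then show ?thesis by (simp add: \<phi>0) (simp add: ext_def)
      qed
    qed
  qed (use m in simp_all)
  also have "\<dots> = (\<integral>t. (\<integral>x. \<phi> x t \<partial>lborel) \<partial>lborel)"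
    by (rule lborel_pair.Fubini_integral[OF int, symmetric])
  also have "\<dots> = cinner F (Dil cesaro_adj_kernel G)"
    unfolding cinner_ext
  proof (rule integral_cong_AE)
    show "AE t in lborel. (\<integral>x. \<phi> x t \<partial>lborel) = ext F t * cnj (ext (Dil cesaro_adj_kernel G) t)"
      using ext_Dil[OF dil_kernel_cesaro_adj, of G]
    proof eventually_elim
      case (elim t)
      show ?case
      proof (cases "0 < t")
        case True
        have "(\<integral>x. \<phi> x t \<partial>lborel) = (\<integral>x. f t * cnj (if t < x then g x / of_real x else 0) \<partial>lborel)"
          by (rule Bochner_Integration.integral_cong) (use True in \<open>auto simp: \<phi>_def\<close>)
        also have "\<dots> = f t * cnj (\<integral>x. (if t < x then g x / of_real x else 0) \<partial>lborel)"
          by (simp only: Bochner_Integration.integral_mult_right_zero Bochner_Integration.integral_cnj)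
        finally show ?thesis using elim True unfolding f_def g_def by (simp add: dil_cesaro_adj(1))
      next
        case False
        then have "\<phi> x t = 0" for x by (simp add: \<phi>_def)
        then show ?thesis using False by (simp add: ext_def)
      qed
    qed
  qed (use m in simp_all)
  finally show ?thesis .
qed

text \<open>
  With \<open>C D = D C = C + D\<close> for the adjoint \<open>D\<close> of \<open>C\<close>, both products of \<open>C - 1\<close> and \<open>D - 1\<close> are
  the identity.
\<close>

lemma unitary_cesaro:
  "unitary_op (\<lambda>F. cesaro_plus F - F) (\<lambda>F. Dil cesaro_adj_kernel F - F)"
proof -
  have k1: "dil_kernel (holder_kernel 1)" by (rule dil_kernel_holder) simp
  define C D where "C = Dil (holder_kernel 1)" and "D = Dil cesaro_adj_kernel"
  have bC: "bounded_op C" and bD: "bounded_op D"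
    unfolding C_def D_def by (intro bounded_op_Dil k1 dil_kernel_cesaro_adj)+
  have sq1: "square_integrable lborel (dil (holder_kernel 1) (ext F))"
    and sq2: "square_integrable lborel (dil cesaro_adj_kernel (ext F))" for F
    by (intro square_integrable_dil k1 dil_kernel_cesaro_adj square_integrable_ext)+
  have sum: "C F + D F = half_class (\<lambda>x. dil (holder_kernel 1) (ext F) x + dil cesaro_adj_kernel (ext F) x)" for F
    unfolding C_def D_def Dil_def by (rule half_class_add[OF sq1 sq2])
  have comp: "Dil k (Dil l F) = C F + D F" 
    if kl: "dil_kernel k" "dil_kernel l"
      and eq: "AE x in lborel. 0 < x \<longrightarrow> dil k (dil l (ext F)) x = max_kernel_op (ext F) x"
      and supp: "\<And>h h' x. 0 < x \<Longrightarrow> (\<And>t. 0 < t \<Longrightarrow> h t = h' t) \<Longrightarrow> dil k h x = dil k h' x" for k l F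
  proof -
    define h where "h x = (if 0 < x then dil l (ext F) x else 0)" for x
    have sl: "square_integrable lborel (dil l (ext F))"
      by (rule square_integrable_dil[OF kl(2) square_integrable_ext])
    have sh: "square_integrable lborel h"
      using square_integrable_half_if[OF sl] unfolding square_integrable_half h_def[abs_def] .
    have "Dil l F = half_class h"
      unfolding Dil_def by (rule half_class_cong[OF sl sh]) (simp add: h_def)
    then have "Dil k (Dil l F) = half_class (dil k h)"
      by (simp only:) (rule Dil_half_class[OF kl(1) sh], simp add: h_def)
    also have "\<dots> = C F + D F"
      unfolding sum
    proof (rule half_class_cong[OF square_integrable_dil[OF kl(1) sh] square_integrable_add[OF sq1 sq2]])
      show "AE x in lborel. 0 < x \<longrightarrow> dil k h x = dil (holder_kernel 1) (ext F) x + dil cesaro_adj_kernel (ext F) x"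
        using eq max_kernel_op_eq[OF square_integrable_ext[of F]]
      proof eventually_elim
        case (elim x)
        show ?case
        proof
          assume x: "0 < x"
          have "dil k h x = dil k (dil l (ext F)) x" by (rule supp[OF x]) (simp add: h_def)
          also have "\<dots> = dil (holder_kernel 1) (ext F) x + dil cesaro_adj_kernel (ext F) x"
            using elim x by simp
          finally show "dil k h x = dil (holder_kernel 1) (ext F) x + dil cesaro_adj_kernel (ext F) x" .
        qed
      qed
    qed
    finally show ?thesis .
  qed
  have supp: "dil k h x = dil k h' x"
    if "dil_kernel k" "0 < x" "\<And>t. 0 < t \<Longrightarrow> h t = h' t" for k h h' x
    unfolding dil_def
  proof (rule Bochner_Integration.integral_cong[OF refl])
    fix u show "k u * h (u * x) = k u * h' (u * x)"
      using that by (cases "u \<le> 0") (auto simp: dil_kernel_def)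
  qed
  have CD: "C (D F) = C F + D F" for F
  proof -
    have "Dil (holder_kernel 1) (Dil cesaro_adj_kernel F) = C F + D F"
    proof (rule comp[OF k1 dil_kernel_cesaro_adj dil_cesaro_adj_swap[OF square_integrable_ext]])
      fix h h' :: "real \<Rightarrow> complex" and x :: real
      assume "0 < x" "\<And>t. 0 < t \<Longrightarrow> h t = h' t"
      then show "dil (holder_kernel 1) h x = dil (holder_kernel 1) h' x"
        by (rule supp[OF k1])
    qed
    then show ?thesis by (simp only: C_def D_def)
  qed
  have DC: "D (C F) = C F + D F" for F
  proof -
    have "Dil cesaro_adj_kernel (Dil (holder_kernel 1) F) = C F + D F"
    proof (rule comp[OF dil_kernel_cesaro_adj k1 dil_adj_cesaro[OF square_integrable_ext]])
      fix h h' :: "real \<Rightarrow> complex" and x :: real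
      assume "0 < x" "\<And>t. 0 < t \<Longrightarrow> h t = h' t"
      then show "dil cesaro_adj_kernel h x = dil cesaro_adj_kernel h' x"
        by (rule supp[OF dil_kernel_cesaro_adj])
    qed
    then show ?thesis by (simp only: C_def D_def)
  qed
  have adj: "cinner (C F) G = cinner F (D G)" for F G
    unfolding C_def D_def by (rule cinner_cesaro)
  show ?thesis
    unfolding cesaro_plus_eq_Dil C_def[symmetric] D_def[symmetric]
  proof
    show "bounded_op (\<lambda>F. C F - F)" by (intro bounded_op_minus bC bounded_op_id)
    show "is_adjoint (\<lambda>F. C F - F) (\<lambda>F. D F - F)"
      by (simp add: is_adjoint_def cinner_diff_left cinner_diff_right adj)
    show "D (C F - F) - (C F - F) = F" for F
      by (simp add: bounded_op_diff[OF bD] DC)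
    show "C (D F - F) - (D F - F) = F" for F
      by (simp add: bounded_op_diff[OF bC] CD)
  qed
qed

section \<open>Causality and power functions\<close>

definition trunc :: "real \<Rightarrow> half_line L2 \<Rightarrow> half_line L2" where
  "trunc b F = half_class (\<lambda>x. if x < b then ext F x else 0)"

lemma square_integrable_trunc:
  assumes "square_integrable lborel f"
  shows "square_integrable lborel (\<lambda>x. if x < b then f x else 0)"
proof (rule square_integrableI_nn)
  have [measurable]: "f \<in> borel_measurable borel" using assms by (simp add: square_integrable_def)
  show "(\<lambda>x. if x < b then f x else 0) \<in> borel_measurable lborel" by measurable
  have "(\<integral>\<^sup>+x. ennreal ((cmod (if x < b then f x else 0))\<^sup>2) \<partial>lborel) \<le> (\<integral>\<^sup>+x. ennreal ((cmod (f x))\<^sup>2) \<partial>lborel)"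
    by (rule nn_integral_mono) simp
  also have "\<dots> < \<infinity>" by (rule square_integrable_nn[OF assms])
  finally show "(\<integral>\<^sup>+x. ennreal ((cmod (if x < b then f x else 0))\<^sup>2) \<partial>lborel) < \<infinity>" .
qed

lemma trunc_half_class:
  assumes f: "square_integrable lborel f"
  shows "trunc b (half_class f) = half_class (\<lambda>x. if x < b then f x else 0)"
  unfolding trunc_def
proof (rule half_class_cong)
  show "AE x in lborel. 0 < x \<longrightarrow> (if x < b then ext (half_class f) x else 0) = (if x < b then f x else 0)"
    using ext_half_class[OF f] by eventually_elim auto
qed (intro square_integrable_trunc square_integrable_ext f)+

lemma bounded_op_trunc: "bounded_op (trunc b)"
proof (rule bounded_opI)
  note sq = square_integrable_trunc[OF square_integrable_ext]
  show "trunc b (F + G) = trunc b F + trunc b G" for F G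
    unfolding trunc_def half_class_add[OF sq sq]
  proof (rule half_class_cong[OF sq square_integrable_add[OF sq sq]])
    show "AE x in lborel. 0 < x \<longrightarrow> (if x < b then ext (F + G) x else 0)
        = (if x < b then ext F x else 0) + (if x < b then ext G x else 0)"
      using ext_add[of F G] by eventually_elim auto
  qed
  show "trunc b (c *\<^sub>C F) = c *\<^sub>C trunc b F" for c F
    unfolding trunc_def half_class_scale[OF sq]
  proof (rule half_class_cong[OF sq square_integrable_scale[OF sq]])
    show "AE x in lborel. 0 < x \<longrightarrow> (if x < b then ext (c *\<^sub>C F) x else 0) = c * (if x < b then ext F x else 0)"
      using ext_scale[of c F] by eventually_elim auto
  qed
  show "norm (trunc b F) \<le> 1 * norm F" for F
  proof -
    have "ennreal ((norm (trunc b F))\<^sup>2) \<le> (\<integral>\<^sup>+x. ennreal ((cmod (if x < b then ext F x else 0))\<^sup>2) \<partial>lborel)"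
      unfolding trunc_def by (rule norm_half_class_le[OF sq])
    also have "\<dots> \<le> (\<integral>\<^sup>+x. ennreal ((cmod (ext F x))\<^sup>2) \<partial>lborel)"
      by (rule nn_integral_mono) simp
    also have "\<dots> = ennreal ((norm F)\<^sup>2)" by (rule nn_norm_ext)
    finally have "(norm (trunc b F))\<^sup>2 \<le> (norm F)\<^sup>2" by (subst (asm) ennreal_le_iff) auto
    then show ?thesis by (simp add: power2_le_iff_abs_le)
  qed
qed

lemma trunc_trunc: "trunc b (trunc b F) = trunc b F"
  unfolding trunc_def[of b F] trunc_half_class[OF square_integrable_trunc[OF square_integrable_ext]]
  by (rule arg_cong[where f=L2_class]) auto

text \<open>Averages over smaller arguments cannot see what happens beyond \<open>b\<close>.\<close>

lemma trunc_Dil_trunc: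
  assumes k: "dil_kernel k" and k1: "\<And>u. u \<ge> 1 \<Longrightarrow> k u = 0"
  shows "trunc b (Dil k (trunc b F)) = trunc b (Dil k F)"
proof -
  define f where "f x = (if x < b then ext F x else 0)" for x
  have sf: "square_integrable lborel f" unfolding f_def[abs_def]
    by (rule square_integrable_trunc[OF square_integrable_ext])
  have "Dil k (trunc b F) = half_class (dil k f)"
    unfolding trunc_def f_def[symmetric] by (rule Dil_half_class[OF k sf]) (simp add: f_def ext_def)
  then have "trunc b (Dil k (trunc b F)) = half_class (\<lambda>x. if x < b then dil k f x else 0)"
    by (simp only: trunc_half_class[OF square_integrable_dil[OF k sf]])
  also have "\<dots> = half_class (\<lambda>x. if x < b then dil k (ext F) x else 0)"
  proof (rule half_class_cong, intro square_integrable_trunc square_integrable_dil k sf,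
      intro square_integrable_trunc square_integrable_dil k square_integrable_ext, intro AE_I2 impI)
    fix x :: real assume x: "0 < x"
    have "dil k f x = dil k (ext F) x" if "x < b"
      unfolding dil_def
    proof (rule Bochner_Integration.integral_cong[OF refl])
      fix u show "k u * f (u * x) = k u * ext F (u * x)"
      proof (cases "u \<ge> 1")
        case False
        then have "u * x < 1 * x" using x by (intro mult_strict_right_mono) auto
        then have "u * x < b" using that by simp
        then show ?thesis using that by (simp add: f_def)
      qed (simp add: k1)
    qed
    then show "(if x < b then dil k f x else 0) = (if x < b then dil k (ext F) x else 0)" by simp
  qed
  also have "\<dots> = trunc b (Dil k F)"
    unfolding Dil_def by (rule trunc_half_class[symmetric, OF square_integrable_dil[OF k square_integrable_ext]])
  finally show ?thesis .
qed

definition trunc_fun :: "real \<Rightarrow> (real \<Rightarrow> complex) \<Rightarrow> real \<Rightarrow> complex" where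
  "trunc_fun b h x = (if 0 < x \<and> x < b then h x else 0)"

definition trunc_power :: "real \<Rightarrow> nat \<Rightarrow> half_line L2" where
  "trunc_power b n = half_class (trunc_fun b (\<lambda>x. of_real x ^ n))"

lemma square_integrable_trunc_fun_bounded:
  assumes [measurable]: "h \<in> borel_measurable borel" and B: "\<And>x. 0 < x \<Longrightarrow> x < b \<Longrightarrow> cmod (h x) \<le> B"
  shows "square_integrable lborel (trunc_fun b h)"
proof (rule square_integrableI_nn)
  show "trunc_fun b h \<in> borel_measurable lborel" unfolding trunc_fun_def[abs_def] by measurable
  have "(\<integral>\<^sup>+x. ennreal ((cmod (trunc_fun b h x))\<^sup>2) \<partial>lborel) \<le> (\<integral>\<^sup>+x. ennreal (B\<^sup>2) * indicator {0..b} x \<partial>lborel)"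
    by (rule nn_integral_mono) (auto simp: trunc_fun_def indicator_def intro!: ennreal_leI power_mono B)
  also have "\<dots> < \<infinity>" by (simp add: nn_integral_cmult ennreal_mult_less_top emeasure_lborel_Icc_eq)
  finally show "(\<integral>\<^sup>+x. ennreal ((cmod (trunc_fun b h x))\<^sup>2) \<partial>lborel) < \<infinity>" .
qed

lemma square_integrable_trunc_fun_continuous:
  assumes h: "continuous_on UNIV h"
  shows "square_integrable lborel (trunc_fun b h)"
proof -
  have "compact (h ` {0..b})"
    using h by (intro compact_continuous_image continuous_on_subset[OF h]) auto
  then obtain B where "\<forall>z\<in>h ` {0..b}. cmod z \<le> B" using compact_imp_bounded bounded_iff by metis
  then show ?thesis
    by (intro square_integrable_trunc_fun_bounded[of _ _ B] borel_measurable_continuous_onI[OF h]) auto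
qed

text \<open>
  For \<open>x < b\<close> the average only involves \<open>(u x)\<^sup>n = u\<^sup>n x\<^sup>n\<close> with \<open>u < 1\<close>. The truncation removes the
  tail beyond \<open>b\<close>, where the average is no multiple of \<open>x\<^sup>n\<close>.
\<close>

lemma trunc_Dil_power:
  assumes k: "dil_kernel k" and k1: "\<And>u. u \<ge> 1 \<Longrightarrow> k u = 0"
  shows "trunc b (Dil k (trunc_power b n)) = (\<integral>u. k u * of_real u ^ n \<partial>lborel) *\<^sub>C trunc_power b n"
proof -
  define f where "f = trunc_fun b (\<lambda>x. of_real x ^ n)"
  have sf: "square_integrable lborel f" unfolding f_def
    by (intro square_integrable_trunc_fun_continuous continuous_intros)
  have "Dil k (trunc_power b n) = half_class (dil k f)"
    unfolding trunc_power_def f_def[symmetric] by (rule Dil_half_class[OF k sf]) (simp add: f_def trunc_fun_def)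
  then have "trunc b (Dil k (trunc_power b n)) = half_class (\<lambda>x. if x < b then dil k f x else 0)"
    by (simp only: trunc_half_class[OF square_integrable_dil[OF k sf]])
  also have "\<dots> = half_class (\<lambda>x. (\<integral>u. k u * of_real u ^ n \<partial>lborel) * f x)"
  proof (rule half_class_cong, intro square_integrable_trunc square_integrable_dil k sf,
      intro square_integrable_scale sf, intro AE_I2 impI)
    fix x :: real assume x: "0 < x"
    have "dil k f x = (\<integral>u. k u * of_real u ^ n \<partial>lborel) * f x" if "x < b"
    proof -
      have "dil k f x = (\<integral>u. (k u * of_real u ^ n) * of_real x ^ n \<partial>lborel)"
        unfolding dil_def
      proof (rule Bochner_Integration.integral_cong[OF refl])
        fix u show "k u * f (u * x) = (k u * of_real u ^ n) * of_real x ^ n"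
        proof (cases "0 < u \<and> u < 1")
          case True
          then have "u * x < 1 * x" using x by (intro mult_strict_right_mono) auto
          then have "u * x < b" using that by simp
          then show ?thesis using that True x by (simp add: f_def trunc_fun_def power_mult_distrib)
        next
          case False
          then have "k u = 0" using k k1[of u] by (cases "u \<le> 0") (auto simp: dil_kernel_def)
          then show ?thesis by simp
        qed
      qed
      also have "\<dots> = (\<integral>u. k u * of_real u ^ n \<partial>lborel) * of_real x ^ n" by simp
      finally show ?thesis using x that by (simp add: f_def trunc_fun_def)
    qed
    then show "(if x < b then dil k f x else 0) = (\<integral>u. k u * of_real u ^ n \<partial>lborel) * f x"
      by (auto simp: f_def trunc_fun_def)
  qed
  also have "\<dots> = (\<integral>u. k u * of_real u ^ n \<partial>lborel) *\<^sub>C trunc_power b n"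
    unfolding trunc_power_def f_def[symmetric] by (rule half_class_scale[symmetric, OF sf])
  finally show ?thesis .
qed

section \<open>Density of polynomials\<close>

lemma trunc_eq_trunc_fun: "trunc b F = half_class (trunc_fun b (ext F))"
  unfolding trunc_def
proof (rule half_class_cong[OF square_integrable_trunc[OF square_integrable_ext]])
  have "trunc_fun b (ext F) = (\<lambda>x. if x < b then ext F x else 0)"
    by (auto simp: trunc_fun_def ext_def fun_eq_iff)
  then show "square_integrable lborel (trunc_fun b (ext F))"
    by (simp only: square_integrable_trunc[OF square_integrable_ext])
qed (simp add: trunc_fun_def)

lemma trunc_trunc_power: "trunc b (trunc_power b n) = trunc_power b n"
  unfolding trunc_power_def
  by (subst trunc_half_class, intro square_integrable_trunc_fun_continuous continuous_intros)
    (rule arg_cong[where f=L2_class], auto simp: trunc_fun_def)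

text \<open>
  The closed subspace of all \<open>F\<close> with \<open>G (trunc b F) = 0\<close> contains the polynomials, hence by the
  Weierstrass theorem the continuous functions, hence by dominated convergence
  first the bounded and then all functions.
\<close>

lemma bounded_op_kills_polynomials:
  fixes r :: "real \<Rightarrow> real"
  assumes G: "bounded_op G" and p: "\<And>n. G (trunc_power b n) = 0" and r: "real_polynomial_function r"
  shows "G (half_class (trunc_fun b (\<lambda>x. of_real (r x)))) = 0"
proof -
  obtain a m where ra: "r = (\<lambda>x. \<Sum>i\<le>m. a i * x ^ i)"
    using r unfolding real_polynomial_function_iff_sum by (elim exE)
  have sq: "square_integrable lborel (trunc_fun b (\<lambda>x. complex_of_real (h x)))" if "continuous_on UNIV h" for h
    by (intro square_integrable_trunc_fun_continuous continuous_intros that)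
  have "half_class (trunc_fun b (\<lambda>x. complex_of_real (\<Sum>i<j. a i * x ^ i))) = (\<Sum>i<j. of_real (a i) *\<^sub>C trunc_power b i)" for j
  proof (induction j)
    case 0
    have "trunc_fun b (\<lambda>x. 0) = (\<lambda>x. 0)" by (simp add: trunc_fun_def fun_eq_iff)
    moreover have "half_class (\<lambda>x. 0) = 0 *\<^sub>C half_class (\<lambda>x. 0)"
      by (simp only: half_class_scale[OF square_integrable_zero] mult_zero_left)
    ultimately show ?case by simp
  next
    case (Suc j)
    have s1: "square_integrable lborel (trunc_fun b (\<lambda>x. complex_of_real (\<Sum>i<j. a i * x ^ i)))"
      by (rule sq) (intro continuous_intros)
    have s2: "square_integrable lborel (trunc_fun b (\<lambda>x. complex_of_real x ^ j))"
      by (intro square_integrable_trunc_fun_continuous continuous_intros)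
    have "trunc_fun b (\<lambda>x. complex_of_real (\<Sum>i<Suc j. a i * x ^ i))
        = (\<lambda>x. trunc_fun b (\<lambda>x. complex_of_real (\<Sum>i<j. a i * x ^ i)) x + of_real (a j) * trunc_fun b (\<lambda>x. complex_of_real x ^ j) x)"
      by (auto simp: trunc_fun_def fun_eq_iff)
    then show ?case
      using half_class_add[OF s1 square_integrable_scale[OF s2]] half_class_scale[OF s2, of "of_real (a j)"] Suc
      by (simp add: trunc_power_def)
  qed
  from this[of "Suc m"] have "half_class (trunc_fun b (\<lambda>x. of_real (r x))) = (\<Sum>i<Suc m. of_real (a i) *\<^sub>C trunc_power b i)"
    by (simp only: ra lessThan_Suc_atMost)
  then show ?thesis by (simp only: bounded_op_sum[OF G] bounded_op_scaleC[OF G] p scaleC_zero_right sum.neutral_const)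
qed

lemma bounded_op_limit_zero:
  assumes G: "bounded_op G" and z: "\<And>n. G (f n) = 0" and lim: "f \<longlonglongrightarrow> F"
  shows "G F = (0 :: half_line L2)"
proof -
  have "bounded_linear G" using G by (simp add: bounded_op_def)
  from bounded_linear.tendsto[OF this lim] have "(\<lambda>n. G (f n)) \<longlonglongrightarrow> G F" .
  then have "(\<lambda>n. 0) \<longlonglongrightarrow> G F" by (simp only: z)
  from LIMSEQ_unique[OF this tendsto_const] show ?thesis .
qed

lemma bounded_op_kills_continuous:
  assumes G: "bounded_op G" and p: "\<And>n. G (trunc_power b n) = 0" and h: "continuous_on UNIV h"
  shows "G (half_class (trunc_fun b h)) = 0"
proof -
  have approx: "\<exists>r. \<forall>n. real_polynomial_function (r n) \<and> (\<forall>x\<in>{0..b}. \<bar>q x - r n x\<bar> < inverse (real (Suc n)))"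
    if "continuous_on {0..b} q" for q :: "real \<Rightarrow> real"
  proof (rule choice, rule allI)
    fix n
    show "\<exists>r. real_polynomial_function r \<and> (\<forall>x\<in>{0..b}. \<bar>q x - r x\<bar> < inverse (real (Suc n)))"
      by (rule Stone_Weierstrass_real_polynomial_function[OF compact_Icc that, of "inverse (real (Suc n))"]) auto
  qed
  have "continuous_on {0..b} (\<lambda>x. Re (h x))" "continuous_on {0..b} (\<lambda>x. Im (h x))"
    by (intro continuous_intros continuous_on_subset[OF h] subset_UNIV)+
  from approx[OF this(1)] approx[OF this(2)] obtain r s
    where r: "\<And>n. real_polynomial_function (r n)" "\<And>n x. x \<in> {0..b} \<Longrightarrow> \<bar>Re (h x) - r n x\<bar> < inverse (real (Suc n))"
      and s: "\<And>n. real_polynomial_function (s n)" "\<And>n x. x \<in> {0..b} \<Longrightarrow> \<bar>Im (h x) - s n x\<bar> < inverse (real (Suc n))"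
    by metis
  define f where "f n x = complex_of_real (r n x) + \<i> * complex_of_real (s n x)" for n x
  have cr: "continuous_on UNIV (r n)" and cs: "continuous_on UNIV (s n)" for n
    using continuous_on_polymonial_function r(1) s(1) real_polynomial_function_eq by blast+
  have cf: "continuous_on UNIV (f n)" for n
    unfolding f_def[abs_def] by (intro continuous_intros cr cs)
  have Gf: "G (half_class (trunc_fun b (f n))) = 0" for n
  proof -
    have s1: "square_integrable lborel (trunc_fun b (\<lambda>x. complex_of_real (r n x)))"
      and s2: "square_integrable lborel (trunc_fun b (\<lambda>x. complex_of_real (s n x)))"
      by (intro square_integrable_trunc_fun_continuous continuous_intros cr cs)+
    have "trunc_fun b (f n) = (\<lambda>x. trunc_fun b (\<lambda>x. complex_of_real (r n x)) x + \<i> * trunc_fun b (\<lambda>x. complex_of_real (s n x)) x)"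
      by (auto simp: trunc_fun_def f_def fun_eq_iff)
    then have "half_class (trunc_fun b (f n)) = half_class (trunc_fun b (\<lambda>x. complex_of_real (r n x)))
        + \<i> *\<^sub>C half_class (trunc_fun b (\<lambda>x. complex_of_real (s n x)))"
      by (simp only: half_class_scale[OF s2] half_class_add[OF s1 square_integrable_scale[OF s2]])
    then show ?thesis
      by (simp add: bounded_op_add[OF G] bounded_op_scaleC[OF G] bounded_op_kills_polynomials[OF G p r(1)]
          bounded_op_kills_polynomials[OF G p s(1)])
  qed
  have near: "cmod (f n x - h x) \<le> 2 * inverse (real (Suc n))" if "x \<in> {0..b}" for n x
  proof -
    have "cmod (f n x - h x) \<le> \<bar>Re (f n x - h x)\<bar> + \<bar>Im (f n x - h x)\<bar>" by (rule cmod_le)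
    also have "\<dots> \<le> 2 * inverse (real (Suc n))"
      using r(2)[OF that, of n] s(2)[OF that, of n] by (simp add: f_def abs_minus_commute del: of_nat_Suc)
    finally show ?thesis .
  qed
  have "(\<lambda>n. half_class (trunc_fun b (f n))) \<longlonglongrightarrow> half_class (trunc_fun b h)"
  proof (rule half_class_dominated_convergence)
    show "trunc_fun b (f n) \<in> borel_measurable borel" for n
      using square_integrable_trunc_fun_continuous[OF cf[of n], of b] by (simp add: square_integrable_def)
    show "square_integrable lborel (trunc_fun b h)"
      by (rule square_integrable_trunc_fun_continuous[OF h])
    show "square_integrable lborel (trunc_fun b (\<lambda>x. complex_of_real (cmod (h x) + 2)))"
      by (intro square_integrable_trunc_fun_continuous continuous_intros h)
    show "cmod (trunc_fun b (f n) x) \<le> cmod (trunc_fun b (\<lambda>x. complex_of_real (cmod (h x) + 2)) x)" for n x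
    proof (cases "0 < x \<and> x < b")
      case True
      have "cmod (f n x) \<le> cmod (h x) + cmod (f n x - h x)" using norm_triangle_sub by blast
      also have "cmod (f n x - h x) \<le> 2 * inverse (real (Suc n))" using near True by simp
      also have "\<dots> \<le> 2 * 1" by (intro mult_left_mono) (auto simp: inverse_le_1_iff)
      finally show ?thesis using True by (simp add: trunc_fun_def flip: of_real_add)
    qed (auto simp: trunc_fun_def)
    show "AE x in lborel. (\<lambda>n. trunc_fun b (f n) x) \<longlonglongrightarrow> trunc_fun b h x"
    proof (rule AE_I2)
      fix x
      show "(\<lambda>n. trunc_fun b (f n) x) \<longlonglongrightarrow> trunc_fun b h x"
      proof (cases "0 < x \<and> x < b")
        case True
        have l: "(\<lambda>n. 2 * inverse (real (Suc n))) \<longlonglongrightarrow> 0"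
          using tendsto_mult_right_zero[OF LIMSEQ_inverse_real_of_nat, of 2] by simp
        have "(\<lambda>n. f n x - h x) \<longlonglongrightarrow> 0"
        proof (rule Lim_null_comparison[OF always_eventually l], rule allI)
          show "norm (f n x - h x) \<le> 2 * inverse (real (Suc n))" for n using near True by simp
        qed
        then have "(\<lambda>n. f n x) \<longlonglongrightarrow> h x" by (rule LIM_zero_cancel)
        then show ?thesis using True by (simp add: trunc_fun_def)
      next
        case False
        then have "trunc_fun b k x = 0" for k by (auto simp: trunc_fun_def)
        then show ?thesis by simp
      qed
    qed
  qed
  then show ?thesis by (rule bounded_op_limit_zero[OF G Gf])
qed

lemma bounded_op_kills_bounded:
  assumes G: "bounded_op G" and p: "\<And>n. G (trunc_power b n) = 0"
    and f: "f \<in> borel_measurable borel" and B: "\<And>x. cmod (f x) \<le> B" "B > 0"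
  shows "G (half_class (trunc_fun b f)) = 0"
proof -
  have "f \<in> borel_measurable lebesgue" using f by (intro measurable_completion) simp
  then have "f measurable_on UNIV" by (intro lebesgue_measurable_imp_measurable_on) auto
  then obtain N g where N: "negligible N" and g: "\<And>n. continuous_on UNIV (g n)"
    and lim: "\<And>x. x \<notin> N \<Longrightarrow> (\<lambda>n. g n x) \<longlonglongrightarrow> f x"
    unfolding measurable_on_def by auto
  have "AE x in lebesgue. x \<notin> N" using N by (intro AE_not_in) (simp add: negligible_iff_null_sets)
  then have AE_N: "AE x in lborel. x \<notin> N" unfolding AE_completion_iff .
  \<comment> \<open>The continuous approximants are pulled back into the disc of radius \<open>B\<close>.\<close>
  define c where "c z = (B / max B (cmod z)) *\<^sub>R z" for z
  have cc: "continuous_on UNIV c"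
    unfolding c_def by (intro continuous_intros) (use B(2) in auto)
  have cB: "cmod (c z) \<le> B" for z
  proof -
    have "cmod (c z) = B * (cmod z / max B (cmod z))" using B(2) by (simp add: c_def)
    also have "\<dots> \<le> B * 1" using B(2) by (intro mult_left_mono) (auto simp: divide_le_eq)
    finally show ?thesis by simp
  qed
  have cf: "c (f x) = f x" for x using B(1)[of x] B(2) by (simp add: c_def max_def)
  have ccg: "continuous_on UNIV (\<lambda>x. c (g n x))" for n
    by (rule continuous_on_compose2[OF cc g]) auto
  have sB: "square_integrable lborel (trunc_fun b (\<lambda>x. complex_of_real B))"
    by (intro square_integrable_trunc_fun_continuous continuous_intros)
  have "(\<lambda>n. half_class (trunc_fun b (\<lambda>x. c (g n x)))) \<longlonglongrightarrow> half_class (trunc_fun b f)"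
  proof (rule half_class_dominated_convergence[OF _ _ sB])
    show "trunc_fun b (\<lambda>x. c (g n x)) \<in> borel_measurable borel" for n
      using square_integrable_trunc_fun_continuous[OF ccg[of n], of b] by (simp add: square_integrable_def)
    show "square_integrable lborel (trunc_fun b f)"
      by (rule square_integrable_trunc_fun_bounded[OF f B(1)])
    show "cmod (trunc_fun b (\<lambda>x. c (g n x)) x) \<le> cmod (trunc_fun b (\<lambda>x. complex_of_real B) x)" for n x
      using cB[of "g n x"] B(2) by (simp add: trunc_fun_def)
    show "AE x in lborel. (\<lambda>n. trunc_fun b (\<lambda>x. c (g n x)) x) \<longlonglongrightarrow> trunc_fun b f x"
      using AE_N
    proof eventually_elim
      case (elim x)
      have "isCont c (f x)" using cc by (simp add: continuous_on_eq_continuous_at)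
      from isCont_tendsto_compose[OF this lim[OF elim]]
      have "(\<lambda>n. c (g n x)) \<longlonglongrightarrow> f x" by (simp only: cf)
      then show ?case
      proof (cases "0 < x \<and> x < b")
        case False
        then have "trunc_fun b k x = 0" for k by (auto simp: trunc_fun_def)
        then show ?thesis by simp
      qed (simp add: trunc_fun_def)
    qed
  qed
  then show ?thesis
    by (rule bounded_op_limit_zero[OF G bounded_op_kills_continuous[OF G p ccg]])
qed

lemma bounded_op_kills_trunc:
  assumes G: "bounded_op G" and p: "\<And>n. G (trunc_power b n) = 0"
  shows "G (trunc b F) = 0"
proof -
  define f where "f n x = (if cmod (ext F x) \<le> real (Suc n) then ext F x else 0)" for n x
  have fm: "f n \<in> borel_measurable borel" for n unfolding f_def[abs_def] by measurable
  have Gf: "G (half_class (trunc_fun b (f n))) = 0" for n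
    by (rule bounded_op_kills_bounded[OF G p fm, of _ "real (Suc n)"]) (auto simp: f_def)
  have "(\<lambda>n. half_class (trunc_fun b (f n))) \<longlonglongrightarrow> half_class (trunc_fun b (ext F))"
  proof (rule half_class_dominated_convergence[OF _ _ square_integrable_ext[of F]])
    show "trunc_fun b (f n) \<in> borel_measurable borel" for n
      using fm[of n] unfolding trunc_fun_def[abs_def] by measurable
    have "trunc_fun b (ext F) = (\<lambda>x. if x < b then ext F x else 0)"
      by (auto simp: trunc_fun_def ext_def fun_eq_iff)
    then show "square_integrable lborel (trunc_fun b (ext F))"
      by (simp only: square_integrable_trunc[OF square_integrable_ext])
    show "cmod (trunc_fun b (f n) x) \<le> cmod (ext F x)" for n x
      by (simp add: trunc_fun_def f_def)
    show "AE x in lborel. (\<lambda>n. trunc_fun b (f n) x) \<longlonglongrightarrow> trunc_fun b (ext F) x"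
    proof (rule AE_I2)
      fix x
      obtain m where m: "cmod (ext F x) \<le> real m" using real_arch_simple by blast
      have "\<forall>\<^sub>F n in sequentially. trunc_fun b (f n) x = trunc_fun b (ext F) x"
        using eventually_ge_at_top[of m]
      proof eventually_elim
        case (elim n)
        then have "cmod (ext F x) \<le> real (Suc n)" using m by simp
        then show ?case by (simp add: trunc_fun_def f_def)
      qed
      then show "(\<lambda>n. trunc_fun b (f n) x) \<longlonglongrightarrow> trunc_fun b (ext F) x"
        by (rule tendsto_eventually)
    qed
  qed
  then show ?thesis unfolding trunc_eq_trunc_fun by (rule bounded_op_limit_zero[OF G Gf])
qed

section \<open>The restricted Hoelder operator\<close>

lemma line_measure_whole: "line_measure TYPE(whole_line) = lborel"
  by (rule measure_eqI) (auto simp: line_dom_whole_line_def sets_restrict_space emeasure_restrict_space)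

lemma extend_zero_ext: "extend_zero F = L2_class (ext F)"
  by (simp add: extend_zero_def ext_def[abs_def])

lemma L2_class_whole_eq_iff:
  assumes "square_integrable lborel f" "square_integrable lborel g"
  shows "L2_class f = (L2_class g :: whole_line L2) \<longleftrightarrow> (AE x in lborel. f x = g x)"
  using L2_class_eq_iff[where 'd=whole_line, of f g, unfolded line_measure_whole, OF assms] .

lemma inj_extend_zero: "inj extend_zero"
proof (rule injI)
  fix F G assume "extend_zero F = extend_zero G"
  then have "AE x in lborel. ext F x = ext G x"
    by (simp add: extend_zero_ext L2_class_whole_eq_iff square_integrable_ext)
  then have "half_class (ext F) = half_class (ext G)"
    by (intro half_class_cong square_integrable_ext) (auto elim: eventually_mono)
  then show "F = G" by (simp add: half_class_ext)
qed

lemma holder_plus_eq_Dil: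
  assumes "Re \<alpha> > 0"
  shows "holder_plus \<alpha> = Dil (holder_kernel \<alpha>)"
proof
  fix F
  note k = dil_kernel_holder[OF assms]
  define E where "E = L2_fun (extend_zero F)"
  have sE: "square_integrable lborel E"
    using square_integrable_L2_fun[of "extend_zero F"] by (simp add: E_def line_measure_whole)
  have Em: "E \<in> borel_measurable borel" using sE by (simp add: square_integrable_def)
  have E: "AE x in lborel. E x = ext F x"
    using L2_fun_L2_class[where 'd=whole_line, of "ext F", unfolded line_measure_whole, OF square_integrable_ext]
    unfolding E_def extend_zero_ext .
  have "1 / Gamma \<alpha> * (LINT u:{0<..<1}|lborel. complex_of_real (ln (1 / u)) powr (\<alpha> - 1) * E (u * x))
      = dil (holder_kernel \<alpha>) E x" for x
    unfolding set_lebesgue_integral_def dil_def Bochner_Integration.integral_mult_right_zero[symmetric]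
    by (rule Bochner_Integration.integral_cong) (auto simp: holder_kernel_def indicator_def)
  then have "holder \<alpha> (extend_zero F) = L2_class (dil (holder_kernel \<alpha>) E)"
    unfolding holder_def E_def[symmetric] by (simp only:)
  also have "\<dots> = L2_class (ext (Dil (holder_kernel \<alpha>) F))"
    unfolding L2_class_whole_eq_iff[OF square_integrable_dil[OF k sE] square_integrable_ext]
    using ext_Dil[OF k, of F] AE_nonzero
  proof eventually_elim
    case (elim x)
    have d: "dil (holder_kernel \<alpha>) E x = dil (holder_kernel \<alpha>) (ext F) x"
      by (rule dil_cong_AE[OF holder_kernel_measurable Em ext_measurable E elim(2)])
    show ?case
    proof (cases "0 < x")
      case True
      then show ?thesis using d elim(1) by simp
    next
      case False
      have "holder_kernel \<alpha> u * ext F (u * x) = 0" for u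
        using False by (auto simp: holder_kernel_def ext_def zero_less_mult_iff)
      then have "dil (holder_kernel \<alpha>) (ext F) x = 0"
        by (simp only: dil_def Bochner_Integration.integral_zero)
      then show ?thesis using False d by (simp add: ext_def)
    qed
  qed
  also have "\<dots> = extend_zero (Dil (holder_kernel \<alpha>) F)" by (rule extend_zero_ext[symmetric])
  finally show "holder_plus \<alpha> F = Dil (holder_kernel \<alpha>) F"
    unfolding holder_plus_def by (simp only: the_inv_f_f[OF inj_extend_zero])
qed

section \<open>Powers of the Cesaro operator\<close>

lemma is_adjoint_trunc: "is_adjoint (trunc b) (trunc b)"
proof -
  have *: "cinner (trunc b F) G = (\<integral>x. trunc_fun b (\<lambda>x. ext F x * cnj (ext G x)) x \<partial>lborel)" for F G
    unfolding cinner_ext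
  proof (rule integral_cong_AE)
    show "(\<lambda>x. trunc_fun b (\<lambda>x. ext F x * cnj (ext G x)) x) \<in> borel_measurable lborel"
      unfolding trunc_fun_def by measurable
    show "AE x in lborel. ext (trunc b F) x * cnj (ext G x) = trunc_fun b (\<lambda>x. ext F x * cnj (ext G x)) x"
      using ext_half_class[OF square_integrable_trunc[OF square_integrable_ext[of F], of b]]
      by eventually_elim (auto simp: trunc_def trunc_fun_def ext_def[of G])
  qed measurable
  show ?thesis
    unfolding is_adjoint_def
  proof safe
    fix F G
    have "cinner F (trunc b G) = cnj (cinner (trunc b G) F)" by (rule cinner_commute)
    also have "\<dots> = (\<integral>x. cnj (trunc_fun b (\<lambda>x. ext G x * cnj (ext F x)) x) \<partial>lborel)"
      by (simp only: * Bochner_Integration.integral_cnj)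
    also have "\<dots> = cinner (trunc b F) G"
      unfolding * by (rule Bochner_Integration.integral_cong) (auto simp: trunc_fun_def)
    finally show "cinner (trunc b F) G = cinner F (trunc b G)" by simp
  qed
qed

lemma trunc_power_nonzero: "trunc_power 1 0 \<noteq> 0"
proof
  assume 0: "trunc_power 1 0 = 0"
  have sq: "square_integrable lborel (trunc_fun 1 (\<lambda>x. complex_of_real x ^ 0))"
    by (intro square_integrable_trunc_fun_continuous continuous_intros)
  have "ennreal ((norm (trunc_power 1 0))\<^sup>2) = (\<integral>\<^sup>+x. indicator {0<..<1::real} x \<partial>lborel)"
    unfolding nn_norm_ext[symmetric]
  proof (rule nn_integral_cong_AE)
    show "AE x in lborel. ennreal ((cmod (ext (trunc_power 1 0) x))\<^sup>2) = indicator {0<..<1::real} x"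
      using ext_half_class[OF sq]
    proof eventually_elim
      case (elim x)
      then show ?case
        by (cases "0 < x") (auto simp: trunc_power_def trunc_fun_def indicator_def, simp add: ext_def)
    qed
  qed
  also have "\<dots> = 1" by simp
  finally show False using 0 by simp
qed

definition cesaro_shift :: "half_line L2 \<Rightarrow> half_line L2" where
  "cesaro_shift = (\<lambda>F. cesaro_plus F - F)"

lemma cesaro_kernel: "dil_kernel (holder_kernel 1)"
  by (rule dil_kernel_holder) simp

lemma trunc_shift_trunc: "trunc b (cesaro_shift (trunc b F)) = trunc b (cesaro_shift F)"
  by (simp add: cesaro_shift_def cesaro_plus_eq_Dil bounded_op_diff[OF bounded_op_trunc] trunc_trunc
      trunc_Dil_trunc[OF cesaro_kernel] holder_kernel_def)

lemma trunc_shift_funpow: "trunc b ((cesaro_shift ^^ k) (trunc b F)) = trunc b ((cesaro_shift ^^ k) F)"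
proof (induction k)
  case 0 then show ?case by (simp add: trunc_trunc)
next
  case (Suc k)
  have "trunc b (cesaro_shift ((cesaro_shift ^^ k) (trunc b F))) = trunc b (cesaro_shift (trunc b ((cesaro_shift ^^ k) (trunc b F))))"
    by (rule trunc_shift_trunc[symmetric])
  also have "\<dots> = trunc b (cesaro_shift (trunc b ((cesaro_shift ^^ k) F)))" by (simp only: Suc)
  also have "\<dots> = trunc b (cesaro_shift ((cesaro_shift ^^ k) F))" by (rule trunc_shift_trunc)
  finally show ?case by simp
qed

lemma trunc_shift_power:
  "trunc b (cesaro_shift (trunc_power b n)) = (1 / of_nat (Suc n) - 1) *\<^sub>C trunc_power b n"
proof -
  have "trunc b (Dil (holder_kernel 1) (trunc_power b n)) = (1 / of_nat (Suc n)) *\<^sub>C trunc_power b n"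
    by (subst trunc_Dil_power[OF cesaro_kernel])
      (simp_all add: holder_kernel_def holder_kernel_moment[unfolded holder_kernel_def])
  then show ?thesis
    by (simp only: cesaro_shift_def cesaro_plus_eq_Dil bounded_op_diff[OF bounded_op_trunc] trunc_trunc_power
        scaleC_diff_left scaleC_one)
qed

lemma trunc_shift_funpow_power:
  "trunc b ((cesaro_shift ^^ k) (trunc_power b n)) = ((1 / of_nat (Suc n) - 1) ^ k) *\<^sub>C trunc_power b n"
proof (induction k)
  case 0 then show ?case by (simp add: trunc_trunc_power)
next
  case (Suc k)
  have bU: "bounded_op cesaro_shift"
    unfolding cesaro_shift_def cesaro_plus_eq_Dil by (intro bounded_op_minus bounded_op_Dil cesaro_kernel bounded_op_id)
  have "trunc b (cesaro_shift ((cesaro_shift ^^ k) (trunc_power b n))) = trunc b (cesaro_shift (trunc b ((cesaro_shift ^^ k) (trunc_power b n))))"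
    by (rule trunc_shift_trunc[symmetric])
  also have "\<dots> = ((1 / of_nat (Suc n) - 1) ^ k) *\<^sub>C trunc b (cesaro_shift (trunc_power b n))"
    by (simp only: Suc bounded_op_scaleC[OF bU] bounded_op_scaleC[OF bounded_op_trunc])
  also have "\<dots> = ((1 / of_nat (Suc n) - 1) ^ Suc k) *\<^sub>C trunc_power b n"
    by (simp only: trunc_shift_power scaleC_scaleC power_Suc2)
  finally show ?case by simp
qed

text \<open>
  The constant function on \<open>(0,1)\<close> has eigenvalue \<open>1\<close> under the truncated Cesaro operator, so its image
  under \<open>cesaro_shift\<close>, and by causality under every higher power, vanishes on \<open>(0,1)\<close>.
\<close>

lemma cesaro_shift_wandering:
  assumes "n \<ge> 1" shows "cinner ((cesaro_shift ^^ n) (trunc_power 1 0)) (trunc_power 1 0) = 0"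
proof -
  let ?e = "trunc_power 1 0"
  have "cinner ((cesaro_shift ^^ n) ?e) ?e = cinner ((cesaro_shift ^^ n) ?e) (trunc 1 ?e)" by (simp only: trunc_trunc_power)
  also have "\<dots> = cinner (trunc 1 ((cesaro_shift ^^ n) ?e)) ?e"
    using is_adjoint_trunc[of 1] unfolding is_adjoint_def by simp
  also have "\<dots> = 0" using assms by (simp add: trunc_shift_funpow_power power_0_left)
  finally show ?thesis .
qed


theorem theorem20:
  fixes \<alpha> :: complex
  assumes "Re \<alpha> > 0"
  shows "op_power cesaro_plus \<alpha> = holder_plus \<alpha>"
proof
  fix F
  interpret unitary_op cesaro_shift "\<lambda>F. Dil cesaro_adj_kernel F - F"
    unfolding cesaro_shift_def by (rule unitary_cesaro)
  define S where "S = op_power cesaro_plus \<alpha>"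
  have one_shift: "(\<lambda>F. F + cesaro_shift F) = cesaro_plus" by (simp add: cesaro_shift_def)
  have Ssum: "(\<lambda>n. (\<alpha> gchoose n) *\<^sub>C (cesaro_shift ^^ n) F) sums S F" for F
    using op_power_one_plus_sums(2)[OF cesaro_shift_wandering trunc_power_nonzero assms, of F] by (simp add: one_shift S_def)
  have bS: "bounded_op S"
    using op_power_one_plus_sums(1)[OF cesaro_shift_wandering trunc_power_nonzero assms] by (simp add: one_shift S_def)
  have H: "holder_plus \<alpha> = Dil (holder_kernel \<alpha>)" by (rule holder_plus_eq_Dil[OF assms])
  note kH = dil_kernel_holder[OF assms]
  have k0: "holder_kernel \<alpha> u = 0" if "u \<ge> 1" for u using that by (simp add: holder_kernel_def)
  have H_power: "trunc b (holder_plus \<alpha> (trunc_power b n)) = ((1 / of_nat (Suc n)) powr \<alpha>) *\<^sub>C trunc_power b n" for b n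
    unfolding H holder_kernel_moment[OF assms, symmetric] by (rule trunc_Dil_power[OF kH]) (rule k0)
  have H_trunc: "trunc b (holder_plus \<alpha> (trunc b F)) = trunc b (holder_plus \<alpha> F)" for b F
    unfolding H by (rule trunc_Dil_trunc[OF kH]) (rule k0)
  have bH: "bounded_op (holder_plus \<alpha>)" unfolding H by (rule bounded_op_Dil[OF kH])
  have tS: "(\<lambda>n. (\<alpha> gchoose n) *\<^sub>C trunc b ((cesaro_shift ^^ n) F)) sums trunc b (S F)" for b F
  proof -
    have "bounded_linear (trunc b)" using bounded_op_trunc[of b] by (simp add: bounded_op_def)
    from bounded_linear.sums[OF this Ssum[of F]] show ?thesis
      by (simp only: bounded_op_scaleC[OF bounded_op_trunc])
  qed
  have S_trunc: "trunc b (S (trunc b F)) = trunc b (S F)" for b F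
    using tS[of b "trunc b F"] unfolding trunc_shift_funpow by (rule sums_unique2) (rule tS)
  have S_power: "trunc b (S (trunc_power b n)) = ((1 / of_nat (Suc n)) powr \<alpha>) *\<^sub>C trunc_power b n" for b n
  proof -
    define \<mu> where "\<mu> = 1 / complex_of_nat (Suc n)"
    have "cmod (\<mu> - 1) \<le> 1"
    proof -
      have "\<mu> - 1 = complex_of_real (1 / real (Suc n) - 1)" by (simp add: \<mu>_def)
      then have "cmod (\<mu> - 1) = \<bar>1 / real (Suc n) - 1\<bar>" by (simp only: norm_of_real)
      also have "\<dots> \<le> 1" by (simp add: field_simps abs_le_iff)
      finally show ?thesis .
    qed
    from binomial_series_closed_disc[OF assms this]
    have series: "(\<lambda>k. (\<alpha> gchoose k) * (\<mu> - 1) ^ k) sums \<mu> powr \<alpha>" by simp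
    have bl: "bounded_linear (\<lambda>c. c *\<^sub>C trunc_power b n)"
    proof (rule bounded_linear_intro)
      show "(c + d) *\<^sub>C trunc_power b n = c *\<^sub>C trunc_power b n + d *\<^sub>C trunc_power b n" for c d
        by (rule scaleC_add_left)
      show "(r *\<^sub>R c) *\<^sub>C trunc_power b n = r *\<^sub>R (c *\<^sub>C trunc_power b n)" for r c
        by (simp only: scaleC_of_real[symmetric] scaleC_scaleC scaleR_conv_of_real)
      show "norm (c *\<^sub>C trunc_power b n) \<le> norm c * norm (trunc_power b n)" for c
        by (simp add: norm_scaleC)
    qed
    have "(\<lambda>k. ((\<alpha> gchoose k) * (\<mu> - 1) ^ k) *\<^sub>C trunc_power b n) sums ((\<mu> powr \<alpha>) *\<^sub>C trunc_power b n)"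
      by (rule bounded_linear.sums[OF bl series])
    moreover have "(\<lambda>k. ((\<alpha> gchoose k) * (\<mu> - 1) ^ k) *\<^sub>C trunc_power b n) sums trunc b (S (trunc_power b n))"
      using tS[of b "trunc_power b n"] unfolding trunc_shift_funpow_power scaleC_scaleC \<mu>_def .
    ultimately show ?thesis unfolding \<mu>_def[symmetric] by (rule sums_unique2[rotated])
  qed
  \<comment> \<open>Both operators agree on polynomials on \<open>(0,b)\<close>, hence by density on everything there.\<close>
  have eq: "trunc b (S F) = trunc b (holder_plus \<alpha> F)" for b
  proof -
    define G where "G F = trunc b (S F) - trunc b (holder_plus \<alpha> F)" for F
    have bG: "bounded_op G" unfolding G_def
      by (rule bounded_op_minus[OF bounded_op_comp[OF bounded_op_trunc bS] bounded_op_comp[OF bounded_op_trunc bH]])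
    have "G (trunc_power b n) = 0" for n
      unfolding G_def S_power H_power by simp
    then have "G (trunc b F) = 0" by (rule bounded_op_kills_trunc[OF bG])
    then show ?thesis unfolding G_def S_trunc H_trunc by simp
  qed
  have "AE x in lborel. \<forall>n::nat. 0 < x \<longrightarrow> x < real n \<longrightarrow> ext (S F) x = ext (holder_plus \<alpha> F) x"
    unfolding AE_all_countable
  proof
    fix n :: nat
    note sq = square_integrable_trunc[OF square_integrable_ext, of "real n"]
    have "AE x in lborel. 0 < x \<longrightarrow> (if x < real n then ext (S F) x else 0) = (if x < real n then ext (holder_plus \<alpha> F) x else 0)"
      using ext_half_class[OF sq[of "S F"]] ext_half_class[OF sq[of "holder_plus \<alpha> F"]]
      unfolding trunc_def[symmetric] eq by eventually_elim auto
    then show "AE x in lborel. 0 < x \<longrightarrow> x < real n \<longrightarrow> ext (S F) x = ext (holder_plus \<alpha> F) x"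
      by eventually_elim auto
  qed
  then have "AE x in lborel. 0 < x \<longrightarrow> ext (S F) x = ext (holder_plus \<alpha> F) x"
    by eventually_elim (use reals_Archimedean2 in blast)
  then have "half_class (ext (S F)) = half_class (ext (holder_plus \<alpha> F))"
    by (intro half_class_cong square_integrable_ext)
  then show "op_power cesaro_plus \<alpha> F = holder_plus \<alpha> F" by (simp only: half_class_ext S_def)
qed

end
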